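(* Assume that the optimal control problem $\mathcal{J}=\langle U,f,g\rangle$ is compact nonexpansive, with compact invariant set $Y$. Then $\mathcal{J}$ has a general uniform value, given by the function $$V^*(y_0)=\sup_{\theta\in\Delta(\mathbb{R}_+)}\ \inf_{s\in\mathbb{R}_+}\ \inf_{\mathbf{u}\in\mathcal{U}}\int_{0}^{\infty} g\big(\mathbf{y}(t+s,\mathbf{u},y_0)\big)\,d\theta(t),\qquad y_0\in Y.$$
   Context: Setting. $U$ is a compact subset of a separable metric space. A (pure) control is a measurable function $\mathbf{u}:\mathbb{R}_+\to U$; $\mathcal{U}$ is the set of all controls. Consider $\mathbf{y}'(t)=f(\mathbf{y}(t),\mathbf{u}(t))$, $\mathbf{y}(0)=y_0\in\mathbb{R}^d$. Standing assumptions: the running cost $g:\mathbb{R}^d\times U\to\mathbb{R}$ is Borel measurable and bounded; $f:\mathbb{R}^d\times U\to\mathbb{R}^d$ is Borel measurable, there is $L\ge 0$ with $\|f(y,u)-f(\bar y,u)\|\le L\|y-\bar y\|$ for all $y,\bar y\in\mathbb{R}^d$, $u\in U$, and there is $a>0$ with $\|f(y,u)\|\le a(1+\|y\|)$ for all $(y,u)$. Then for every $y_0$ and $\mathbf{u}\in\mathcal{U}$ there is a unique absolutely continuous solution on $\mathbb{R}_+$, denoted $t\mapsto\mathbf{y}(t,\mathbf{u},y_0)$. Evaluations. $\Delta(\mathbb{R}_+)$ is the set of (Borel) probability measures on $\mathbb{R}_+=[0,+\infty)$; its elements are called evaluations. For $\theta\in\Delta(\mathbb{R}_+)$, $\gamma_\theta(y_0,\mathbf{u})=\int_{[0,+\infty)}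 g(\mathbf{y}(t,\mathbf{u},y_0),\mathbf{u}(t))\,d\theta(t)$ and $V_\theta(y_0)=\inf_{\mathbf{u}\in\mathcal{U}}\gamma_\theta(y_0,\mathbf{u})$. For $s\ge 0$, the $s$-total variation of $\theta$ is $TV_s(\theta)=\max_{Q\in\mathcal{B}(\mathbb{R}_+)}|\theta(Q)-\theta(Q+s)|$, where $\mathcal{B}(\mathbb{R}_+)$ denotes the Borel subsets of $\mathbb{R}_+$. Compact nonexpansive. $\mathcal{J}=\langle U,f,g\rangle$ is compact nonexpansive if: (i) there is a compact set $Y\subseteq\mathbb{R}^d$ that is invariant: $\mathbf{y}(t,\mathbf{u},y_0)\in Y$ for all $t\ge0$, $\mathbf{u}\in\mathcal{U}$, $y_0\in Y$; (ii) $g$ does not depend on $u$ and is continuous in $y\in Y$ (write $g(y)$); (iii) for all $y_1,y_2\in\mathbb{R}^d$, $\sup_{a\in U}\inf_{b\in U}\langle y_1-y_2,f(y_1,a)-f(y_2,b)\rangle\le 0$. Random controls. A random control is a pair $((\Omega,\mathcal{B}(\Omega),\lambda),\mathbf{u})$ with $(\Omega,\mathcal{B}(\Omega),\lambda)$ a standard Borel probability space and $\mathbf{u}:Y\times\Omega\times[0,+\infty)\to U$ Borel measurable; $\tilde{\mathcal{U}}$ is the set of random controls. For $y_0\in Y$, $\omega\in\Omega$, $\mathbf{u}_\omega(y_0)=\mathbf{u}(y_0,\omega,\cdot)\in\mathcal{U}$. The expected payoff is $\gamma_\theta(y_0,\mathbf{u})=\int_\Omega\gamma_\theta(y_0,\mathbf{u}_\omega(y_0))\,d\lambda(\omega)$.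 General limit value. $\mathcal{J}$ has general limit value $V:Y\to\mathbb{R}$ if for each $\varepsilon>0$ there are $\eta>0$ and $S>0$ such that for all $\theta\in\Delta(\mathbb{R}_+)$: $\sup_{0\le s\le S}TV_s(\theta)\le\eta$ implies $|V_\theta(y_0)-V(y_0)|\le\varepsilon$ for all $y_0\in Y$. General uniform value. $\mathcal{J}$ has a general uniform value $V$ if $V$ is the general limit value of $\mathcal{J}$ and moreover for each $\varepsilon>0$ there are $\eta>0$, $S>0$ and a random control $\mathbf{u}\in\tilde{\mathcal{U}}$ such that for all $\theta\in\Delta(\mathbb{R}_+)$: $\sup_{0\le s\le S}TV_s(\theta)\le\eta$ implies $\gamma_\theta(y_0,\mathbf{u})\le V(y_0)+\varepsilon$ for all $y_0\in Y$. *)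

theory Defs
  imports "HOL-Probability.Probability"
begin

text \<open>A problem is given by a set \<open>U\<close>, dynamics \<open>f\<close> and a running cost \<open>g\<close>, whose values for
  controls outside \<open>U\<close> play no role. \<open>U\<close> is taken nonempty, since otherwise there is no control
  and the value functions are infima over the empty set.\<close>

definition control_problem ::
  "'u::{metric_space,second_countable_topology} set \<Rightarrow> (real^'n \<Rightarrow> 'u \<Rightarrow> real^'n) \<Rightarrow>
   (real^'n \<Rightarrow> 'u \<Rightarrow> real) \<Rightarrow> bool" where
  "control_problem U f g \<longleftrightarrow>
     compact U \<and> U \<noteq> {} \<and>
     (\<lambda>(y, u). g y u) \<in> borel \<Otimes>\<^sub>M restrict_space borel U \<rightarrow>\<^sub>M borel \<and>
     (\<exists>C. \<forall>y. \<forall>u\<in>U. \<bar>g y u\<bar> \<le> C) \<and>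
     (\<lambda>(y, u). f y u) \<in> borel \<Otimes>\<^sub>M restrict_space borel U \<rightarrow>\<^sub>M borel \<and>
     (\<exists>L\<ge>0. \<forall>y z. \<forall>u\<in>U. norm (f y u - f z u) \<le> L * norm (y - z)) \<and>
     (\<exists>a>0. \<forall>y. \<forall>u\<in>U. norm (f y u) \<le> a * (1 + norm y))"

abbreviation nonneg_borel :: "real measure" where
  "nonneg_borel \<equiv> restrict_space borel {0..}"

definition controls :: "'u::topological_space set \<Rightarrow> (real \<Rightarrow> 'u) set" where
  "controls U = nonneg_borel \<rightarrow>\<^sub>M restrict_space borel U"

definition absolutely_continuous_on :: "real set \<Rightarrow> (real \<Rightarrow> 'a::real_normed_vector) \<Rightarrow> bool" where
  "absolutely_continuous_on I \<phi> \<longleftrightarrow>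
     (\<forall>\<epsilon>>0. \<exists>\<delta>>0. \<forall>(n::nat) a b.
        (\<forall>i<n. a i \<le> b i \<and> {a i..b i} \<subseteq> I) \<and>
        (\<forall>i<n. \<forall>j<i. {a i<..<b i} \<inter> {a j<..<b j} = {}) \<and>
        (\<Sum>i<n. b i - a i) < \<delta> \<longrightarrow>
        (\<Sum>i<n. norm (\<phi> (b i) - \<phi> (a i))) < \<epsilon>)"

text \<open>On the unbounded half-line, absolute continuity is understood on every compact subinterval.\<close>

definition is_solution ::
  "(real^'n \<Rightarrow> 'u \<Rightarrow> real^'n) \<Rightarrow> (real \<Rightarrow> 'u) \<Rightarrow> real^'n \<Rightarrow> (real \<Rightarrow> real^'n) \<Rightarrow> bool" where
  "is_solution f u y0 y \<longleftrightarrow>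
     (\<forall>T\<ge>0. absolutely_continuous_on {0..T} y) \<and> y 0 = y0 \<and>
     (AE t in lborel. 0 \<le> t \<longrightarrow> (y has_vector_derivative f (y t) (u t)) (at t within {0..}))"

text \<open>The solution is unique on \<open>{0..}\<close> only: its values at negative times are unspecified, hence
  \<open>SOME\<close> instead of \<open>THE\<close>. It is only ever evaluated at nonnegative times.\<close>

definition trajectory ::
  "(real^'n \<Rightarrow> 'u \<Rightarrow> real^'n) \<Rightarrow> (real \<Rightarrow> 'u) \<Rightarrow> real^'n \<Rightarrow> real \<Rightarrow> real^'n" where
  "trajectory f u y0 = (SOME y. is_solution f u y0 y)"

definition evaluations :: "real measure set" where
  "evaluations = {\<theta>. prob_space \<theta> \<and> sets \<theta> = sets nonneg_borel}"

definition payoff ::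
  "(real^'n \<Rightarrow> 'u \<Rightarrow> real^'n) \<Rightarrow> (real^'n \<Rightarrow> 'u \<Rightarrow> real) \<Rightarrow> real measure \<Rightarrow> real^'n \<Rightarrow>
   (real \<Rightarrow> 'u) \<Rightarrow> real" where
  "payoff f g \<theta> y0 u = (\<integral>t. g (trajectory f u y0 t) (u t) \<partial>\<theta>)"

definition value_fun ::
  "'u::topological_space set \<Rightarrow> (real^'n \<Rightarrow> 'u \<Rightarrow> real^'n) \<Rightarrow> (real^'n \<Rightarrow> 'u \<Rightarrow> real) \<Rightarrow>
   real measure \<Rightarrow> real^'n \<Rightarrow> real" where
  "value_fun U f g \<theta> y0 = (INF u\<in>controls U. payoff f g \<theta> y0 u)"

definition TV :: "real \<Rightarrow> real measure \<Rightarrow> real" where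
  "TV s \<theta> = (SUP Q\<in>sets nonneg_borel. \<bar>measure \<theta> Q - measure \<theta> ((\<lambda>t. t + s) ` Q)\<bar>)"

text \<open>The common value \<open>g(y)\<close> of a running cost that does not depend on the control.\<close>

definition state_cost :: "'u set \<Rightarrow> (real^'n \<Rightarrow> 'u \<Rightarrow> real) \<Rightarrow> real^'n \<Rightarrow> real" where
  "state_cost U g y = (THE r. \<forall>u\<in>U. g y u = r)"

definition compact_nonexpansive ::
  "'u::topological_space set \<Rightarrow> (real^'n \<Rightarrow> 'u \<Rightarrow> real^'n) \<Rightarrow> (real^'n \<Rightarrow> 'u \<Rightarrow> real) \<Rightarrow>
   (real^'n) set \<Rightarrow> bool" where
  "compact_nonexpansive U f g Y \<longleftrightarrow>
     compact Y \<and>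
     (\<forall>y0\<in>Y. \<forall>u\<in>controls U. \<forall>t\<ge>0. trajectory f u y0 t \<in> Y) \<and>
     (\<forall>y. \<forall>u\<in>U. \<forall>v\<in>U. g y u = g y v) \<and>
     continuous_on Y (state_cost U g) \<and>
     (\<forall>y1 y2. (SUP a\<in>U. INF b\<in>U. (y1 - y2) \<bullet> (f y1 a - f y2 b)) \<le> 0)"

definition general_limit_value ::
  "'u::topological_space set \<Rightarrow> (real^'n \<Rightarrow> 'u \<Rightarrow> real^'n) \<Rightarrow> (real^'n \<Rightarrow> 'u \<Rightarrow> real) \<Rightarrow>
   (real^'n) set \<Rightarrow> (real^'n \<Rightarrow> real) \<Rightarrow> bool" where
  "general_limit_value U f g Y V \<longleftrightarrow>
     (\<forall>\<epsilon>>0. \<exists>\<eta>>0. \<exists>S>0. \<forall>\<theta>\<in>evaluations.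
        (SUP s\<in>{0..S}. TV s \<theta>) \<le> \<eta> \<longrightarrow> (\<forall>y0\<in>Y. \<bar>value_fun U f g \<theta> y0 - V y0\<bar> \<le> \<epsilon>))"

definition standard_borel :: "'w measure \<Rightarrow> bool" where
  "standard_borel M \<longleftrightarrow>
     (\<exists>X. completely_metrizable_space X \<and> separable_space X \<and> topspace X = space M \<and>
          sets M = sigma_sets (topspace X) {G. openin X G})"

definition random_control ::
  "'u::topological_space set \<Rightarrow> (real^'n) set \<Rightarrow> 'w measure \<Rightarrow> (real^'n \<Rightarrow> 'w \<Rightarrow> real \<Rightarrow> 'u) \<Rightarrow> bool"
  where
  "random_control U Y M u \<longleftrightarrow>
     standard_borel M \<and> prob_space M \<and>
     (\<lambda>(y0, \<omega>, t). u y0 \<omega> t)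
       \<in> restrict_space borel Y \<Otimes>\<^sub>M M \<Otimes>\<^sub>M nonneg_borel \<rightarrow>\<^sub>M restrict_space borel U"

definition expected_payoff ::
  "(real^'n \<Rightarrow> 'u \<Rightarrow> real^'n) \<Rightarrow> (real^'n \<Rightarrow> 'u \<Rightarrow> real) \<Rightarrow> real measure \<Rightarrow> real^'n \<Rightarrow>
   'w measure \<Rightarrow> (real^'n \<Rightarrow> 'w \<Rightarrow> real \<Rightarrow> 'u) \<Rightarrow> real" where
  "expected_payoff f g \<theta> y0 M u = (\<integral>\<omega>. payoff f g \<theta> y0 (u y0 \<omega>) \<partial>M)"

text \<open>A standard Borel space has at most the cardinality of the continuum, so up to relabelling its
  points its carrier is a set of reals (with an arbitrary Polish topology, not necessarily the
  Euclidean one). Quantifying over \<open>real measure\<close> therefore covers all random controls.\<close>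

definition general_uniform_value ::
  "'u::topological_space set \<Rightarrow> (real^'n \<Rightarrow> 'u \<Rightarrow> real^'n) \<Rightarrow> (real^'n \<Rightarrow> 'u \<Rightarrow> real) \<Rightarrow>
   (real^'n) set \<Rightarrow> (real^'n \<Rightarrow> real) \<Rightarrow> bool" where
  "general_uniform_value U f g Y V \<longleftrightarrow>
     general_limit_value U f g Y V \<and>
     (\<forall>\<epsilon>>0. \<exists>\<eta>>0. \<exists>S>0. \<exists>(M :: real measure) u. random_control U Y M u \<and>
        (\<forall>\<theta>\<in>evaluations. (SUP s\<in>{0..S}. TV s \<theta>) \<le> \<eta> \<longrightarrow>
           (\<forall>y0\<in>Y. expected_payoff f g \<theta> y0 M u \<le> V y0 + \<epsilon>)))"

end

theory Submission
  imports Defs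
begin

text \<open>By condition (iii), a control picked to minimise \<open>\<langle>x - z, f x b\<rangle>\<close> keeps the state \<open>x\<close> from
  drifting away from the state \<open>z\<close> of any other trajectory, whatever control the latter uses. With
  decreasing steps and finite menus of controls, every trajectory is therefore shadowed for all times
  by one that is coded by a sequence of digits. Shadowing makes the values equicontinuous. For a slowly
  varying \<open>\<theta>\<close> a time shift hardly matters, so the value is almost nondecreasing along trajectories; since
  the reachable set is totally bounded, bounded shifts suffice, and the limit is the stated supremum.

  For the uniform value, take a control that is almost optimal for the uniform distribution on
  \<open>[0, T]\<close>, draw \<open>\<tau>\<close> uniformly in \<open>[0, T]\<close>, go in bounded time near the position at \<open>\<tau>\<close> and follow
  the trajectory from there. The mean cost at any fixed time is then close to the optimum as \<open>T\<close> grows.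
  The laws of the codes of these random controls live on a compact space of digit sequences, and a
  weak limit as \<open>T\<close> tends to infinity (Helly) no longer depends on \<open>T\<close> and serves all \<open>\<theta>\<close> at once.\<close>

section \<open>Differentiation of indefinite integrals and absolutely continuous functions\<close>

text \<open>A control that is almost optimal for one \<theta> says nothing about the costs it
  collects on other time scales, while one random control has to serve all \<theta>. A uniformly
  drawn starting position turns the mean cost at a fixed time t into an average over [t, t + T], but
  this is near the average over [0, T] only while t is small compared with T. With the thresholds
  fixed, the mass of \<theta> may still lie arbitrarily far out, so a limit in T is taken, and for
  that compactness of the laws is required. The controls themselves offer none, since f is merely
  Borel in the control. Codes do: up to a given time the state depends on finitely many digits, so
  the payoff is continuous in the code. The steps are multiples of 1/(k+1). Their sum diverges, so
  the codes reach all times; the sum of their squares converges, and the tracking error gained in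
  one step is of the order of the squared step, so the total error stays small forever. Finally, a
  random starting position must be approached first; total boundedness of the reachable set bounds
  the time this takes by some S independent of T, and the control of the total variation up to S
  pays for it.\<close>

lemma vderiv_within_iff:
  fixes F :: "real \<Rightarrow> 'a::real_normed_vector"
  shows "(F has_vector_derivative D) (at x within S) \<longleftrightarrow>
    (\<forall>e>0. \<exists>d>0. \<forall>y\<in>S. \<bar>y - x\<bar> < d \<longrightarrow> norm (F y - F x - (y - x) *\<^sub>R D) \<le> e * \<bar>y - x\<bar>)"
  unfolding has_vector_derivative_def has_derivative_within_alt
  by (auto simp: bounded_linear_scaleR_left)

lemma cball_real_interval:
  fixes x y :: real
  shows "cball ((x + y) / 2) (\<bar>x - y\<bar> / 2) = {min x y..max x y}"
  by (auto simp: cball_eq_atLeastAtMost min_def max_def field_simps split: if_splits)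

lemma increment_minmax:
  fixes F :: "real \<Rightarrow> 'a::real_normed_vector"
  shows "norm ((max x y - min x y) *\<^sub>R D - (F (max x y) - F (min x y)))
    = norm (F y - F x - (y - x) *\<^sub>R D)"
proof (cases "x \<le> y")
  case True
  then show ?thesis by (simp add: norm_minus_commute)
next
  case False
  then have "(max x y - min x y) *\<^sub>R D - (F (max x y) - F (min x y)) = F y - F x - (y - x) *\<^sub>R D"
    by (simp add: algebra_simps)
  then show ?thesis by simp
qed

text \<open>Vitali's theorem covers the bad points, up to a null set, by disjoint intervals on each
  of which the Riemann term misses the integral by more than \<open>m\<close> times the length. The
  Henstock lemma bounds the sum of these errors by \<open>e * m\<close>, so the total length is at
  most \<open>e\<close>.\<close>

lemma indefinite_integral_bad_set_negligible:
  fixes \<phi> :: "real \<Rightarrow> 'a::euclidean_space" and m :: real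
  assumes int: "\<phi> integrable_on {a..b}" and m: "m > 0"
  defines "F \<equiv> \<lambda>t. integral {a..t} \<phi>"
  defines "E \<equiv> {x\<in>{a..b}. \<forall>d>0. \<exists>y\<in>{a..b}. \<bar>y - x\<bar> < d \<and>
      norm (F y - F x - (y - x) *\<^sub>R \<phi> x) > m * \<bar>y - x\<bar>}"
  shows "negligible E"
  unfolding negligible_outer_le
proof (intro allI impI)
  fix e :: real assume e: "e > 0"
  have em: "e * m > 0" using e m by simp
  from int have int': "\<phi> integrable_on cbox a b" by simp
  obtain \<gamma> where \<gamma>: "gauge \<gamma>"
    and fine: "\<And>p. \<lbrakk>p tagged_partial_division_of (cbox a b); \<gamma> fine p\<rbrakk> \<Longrightarrow>
        (\<Sum>(x,k)\<in>p. norm (measure lborel k *\<^sub>R \<phi> x - integral k \<phi>)) < e * m"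
    by (rule Henstock_lemma[OF int' em]) blast
  \<comment> \<open>The interval between \<open>x\<close> and \<open>y\<close> is tagged at its
    endpoint \<open>x\<close> and lies in the gauge set of that tag, so disjoint members of
    \<open>K\<close> form a fine partial division.\<close>
  define K where "K = {(x, y). x \<in> {a..b} \<and> y \<in> {a..b} \<and> x \<noteq> y \<and> {min x y..max x y} \<subseteq> \<gamma> x \<and>
      norm (F y - F x - (y - x) *\<^sub>R \<phi> x) > m * \<bar>y - x\<bar>}"
  define I where "I = (\<lambda>(x::real, y::real). {min x y..max x y})"
  have F_diff: "F (max x y) - F (min x y) = integral {min x y..max x y} \<phi>"
    if "x \<in> {a..b}" "y \<in> {a..b}" for x y
  proof -
    have "integral {a..min x y} \<phi> + integral {min x y..max x y} \<phi> = integral {a..max x y} \<phi>"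
      using that by (intro Henstock_Kurzweil_Integration.integral_combine
        integrable_on_subinterval[OF int]) (auto simp: min_def max_def)
    then show ?thesis by (simp add: F_def algebra_simps)
  qed
  obtain C where C: "countable C" "C \<subseteq> K"
     "pairwise (\<lambda>i j. disjnt (I i) (I j)) C" "negligible (E - (\<Union>i\<in>C. I i))"
  proof (rule Vitali_covering_theorem_cballs[where K = K and S = E and
        a = "\<lambda>(x,y). (x+y)/2" and r = "\<lambda>(x,y). \<bar>x-y\<bar>/2"])
    show "0 < (case i of (x, y) \<Rightarrow> \<bar>x - y\<bar> / 2)" if "i \<in> K" for i
      using that by (auto simp: K_def)
    show "\<exists>i. i \<in> K \<and> x \<in> cball (case i of (x, y) \<Rightarrow> (x + y) / 2) (case i of (x, y) \<Rightarrow> \<bar>x - y\<bar> / 2) \<and>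
        (case i of (x, y) \<Rightarrow> \<bar>x - y\<bar> / 2) < d" if x: "x \<in> E" and d: "0 < d" for x d
    proof -
      from \<gamma> obtain r where r: "r > 0" "ball x r \<subseteq> \<gamma> x"
        unfolding gauge_def by (meson open_contains_ball)
      have "0 < min r d" using r d by simp
      with x have "\<exists>y\<in>{a..b}. \<bar>y - x\<bar> < min r d \<and> norm (F y - F x - (y - x) *\<^sub>R \<phi> x) > m * \<bar>y - x\<bar>"
        unfolding E_def by blast
      then obtain y where y: "y \<in> {a..b}" "\<bar>y - x\<bar> < min r d"
        "norm (F y - F x - (y - x) *\<^sub>R \<phi> x) > m * \<bar>y - x\<bar>" by blast
      have "{min x y..max x y} \<subseteq> ball x r" using y(2)
        by (auto simp: dist_real_def min_def max_def split: if_splits)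
      then have "(x, y) \<in> K" using x y r unfolding K_def E_def by auto
      moreover have "\<bar>x - y\<bar> / 2 < d" using y(2) by auto
      ultimately show ?thesis
        by (intro exI[of _ "(x,y)"]) (auto simp: cball_real_interval)
    qed
    fix C assume C: "countable C" "C \<subseteq> K"
      "pairwise (\<lambda>i j. disjnt (cball (case i of (x, y) \<Rightarrow> (x + y) / 2) (case i of (x, y) \<Rightarrow> \<bar>x - y\<bar> / 2))
                  (cball (case j of (x, y) \<Rightarrow> (x + y) / 2) (case j of (x, y) \<Rightarrow> \<bar>x - y\<bar> / 2))) C"
      "negligible (E - (\<Union>i\<in>C. cball (case i of (x, y) \<Rightarrow> (x + y) / 2) (case i of (x, y) \<Rightarrow> \<bar>x - y\<bar> / 2)))"
    have *: "cball (case i of (x, y) \<Rightarrow> (x + y) / 2) (case i of (x, y) \<Rightarrow> \<bar>x - y\<bar> / 2) = I i" for i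
      by (cases i) (simp add: I_def cball_real_interval)
    show thesis using C unfolding * by (rule that)
  qed
  have fin: "(\<Sum>i\<in>C'. measure lebesgue (I i)) \<le> e" if C': "finite C'" "C' \<subseteq> C" for C'
  proof -
    define p where "p = (\<lambda>i. (fst i, I i)) ` C'"
    have inj: "inj_on (\<lambda>i. (fst i, I i)) C'"
    proof (rule inj_onI)
      fix i j assume ij: "i \<in> C'" "j \<in> C'" "(fst i, I i) = (fst j, I j)"
      show "i = j"
      proof (rule ccontr)
        assume "i \<noteq> j"
        then have "disjnt (I i) (I j)" using pairwiseD[OF C(3)] ij(1,2) C'(2) by blast
        moreover have "fst j \<in> I j" by (cases j) (auto simp: I_def)
        moreover have "I i = I j" using ij(3) by simp
        ultimately show False by (simp add: disjnt_iff)
      qed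
    qed
    have tp: "p tagged_partial_division_of cbox a b"
      unfolding tagged_partial_division_of_def
    proof (intro conjI allI impI)
      show "finite p" using C' by (simp add: p_def)
      fix x k assume xk: "(x, k) \<in> p"
      then obtain y where xy: "(x, y) \<in> C'" "k = {min x y..max x y}" by (auto simp: p_def I_def)
      then have "(x, y) \<in> K" using C C' by auto
      then have xy': "x \<in> {a..b}" "y \<in> {a..b}" by (auto simp: K_def)
      show "x \<in> k" using xy by auto
      show "k \<subseteq> cbox a b" using xy xy' by auto
      show "\<exists>a b. k = cbox a b" using xy by (intro exI[of _ "min x y"] exI[of _ "max x y"]) simp
    next
      fix x1 k1 x2 k2 assume k: "(x1, k1) \<in> p \<and> (x2, k2) \<in> p \<and> (x1, k1) \<noteq> (x2, k2)"
      then obtain i j where ij: "i \<in> C'" "j \<in> C'" "k1 = I i" "k2 = I j" "i \<noteq> j" by (auto simp: p_def)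
      then have "disjnt (I i) (I j)" using C(3) C' by (auto simp: pairwise_def)
      then have "I i \<inter> I j = {}" by (simp add: disjnt_def)
      then show "interior k1 \<inter> interior k2 = {}"
        using ij interior_subset by blast
    qed
    have "\<gamma> fine p" using C C' by (fastforce simp: fine_def p_def I_def K_def)
    from fine[OF tp this] have "(\<Sum>(x,k)\<in>p. norm (measure lborel k *\<^sub>R \<phi> x - integral k \<phi>)) < e * m" .
    also have "(\<Sum>(x,k)\<in>p. norm (measure lborel k *\<^sub>R \<phi> x - integral k \<phi>))
        = (\<Sum>i\<in>C'. norm (measure lborel (I i) *\<^sub>R \<phi> (fst i) - integral (I i) \<phi>))"
      unfolding p_def by (subst sum.reindex[OF inj]) simp
    finally have less: "(\<Sum>i\<in>C'. norm (measure lborel (I i) *\<^sub>R \<phi> (fst i) - integral (I i) \<phi>)) < e * m" .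
    have "m * (\<Sum>i\<in>C'. measure lebesgue (I i)) \<le> (\<Sum>i\<in>C'. norm (measure lborel (I i) *\<^sub>R \<phi> (fst i) - integral (I i) \<phi>))"
      unfolding sum_distrib_left
    proof (rule sum_mono)
      fix i assume i: "i \<in> C'"
      obtain x y where xy: "i = (x, y)" by (cases i)
      have K: "(x, y) \<in> K" using i xy C C' by auto
      then have "m * \<bar>y - x\<bar> < norm (F y - F x - (y - x) *\<^sub>R \<phi> x)" by (auto simp: K_def)
      also have "\<dots> = norm ((max x y - min x y) *\<^sub>R \<phi> x - (F (max x y) - F (min x y)))"
        by (rule increment_minmax[symmetric])
      also have "\<dots> = norm (measure lborel (I i) *\<^sub>R \<phi> (fst i) - integral (I i) \<phi>)"
        using F_diff K by (auto simp: I_def xy K_def)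
      finally have "m * \<bar>y - x\<bar> \<le> norm (measure lborel (I i) *\<^sub>R \<phi> (fst i) - integral (I i) \<phi>)" by simp
      moreover have "measure lebesgue (I i) = \<bar>y - x\<bar>" by (auto simp: xy I_def)
      ultimately show "m * measure lebesgue (I i) \<le> norm (measure lborel (I i) *\<^sub>R \<phi> (fst i) - integral (I i) \<phi>)"
        by simp
    qed
    with less have "m * (\<Sum>i\<in>C'. measure lebesgue (I i)) < m * e" by (simp add: mult.commute)
    then show ?thesis using m by simp
  qed
  have meas: "I i \<in> lmeasurable" for i by (cases i) (auto simp: I_def)
  have fin': "measure lebesgue (\<Union>i\<in>C'. I i) \<le> e" if "C' \<subseteq> C" "finite C'" for C'
    by (rule order_trans[OF measure_UNION_le fin]) (use that meas in \<open>auto dest: fmeasurableD\<close>)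
  have U1: "(\<Union>i\<in>C. I i) \<in> lmeasurable" and U2: "measure lebesgue (\<Union>i\<in>C. I i) \<le> e"
    by (rule fmeasurable_UN_bound[OF C(1) meas fin'], assumption+)
      (rule measure_UN_bound[OF C(1) meas fin'], assumption+)
  have nn: "E - (\<Union>i\<in>C. I i) \<in> lmeasurable" "measure lebesgue (E - (\<Union>i\<in>C. I i)) = 0"
    using C(4) negligible_iff_measure by blast+
  have "measure lebesgue ((\<Union>i\<in>C. I i) \<union> (E - (\<Union>i\<in>C. I i))) \<le> measure lebesgue (\<Union>i\<in>C. I i) + measure lebesgue (E - (\<Union>i\<in>C. I i))"
    using U1 nn(1) by (intro measure_Un_le) auto
  then have "measure lebesgue ((\<Union>i\<in>C. I i) \<union> (E - (\<Union>i\<in>C. I i))) \<le> e"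
    using U2 nn(2) by linarith
  moreover have "(\<Union>i\<in>C. I i) \<union> (E - (\<Union>i\<in>C. I i)) \<in> lmeasurable"
    using U1 nn(1) by (rule fmeasurable.Un)
  moreover have "E \<subseteq> (\<Union>i\<in>C. I i) \<union> (E - (\<Union>i\<in>C. I i))" by auto
  ultimately show "\<exists>T. E \<subseteq> T \<and> T \<in> lmeasurable \<and> measure lebesgue T \<le> e"
    by (intro exI conjI)
qed

theorem indefinite_integral_has_vector_derivative_ae:
  fixes \<phi> :: "real \<Rightarrow> 'a::euclidean_space"
  assumes int: "\<phi> integrable_on {a..b}"
  shows "\<exists>N. negligible N \<and> (\<forall>x\<in>{a..b} - N.
    ((\<lambda>t. integral {a..t} \<phi>) has_vector_derivative \<phi> x) (at x within {a..b}))"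
proof -
  define F where "F = (\<lambda>t. integral {a..t} \<phi>)"
  define E where "E m = {x\<in>{a..b}. \<forall>d>0. \<exists>y\<in>{a..b}. \<bar>y - x\<bar> < d \<and>
      norm (F y - F x - (y - x) *\<^sub>R \<phi> x) > inverse (real (Suc m)) * \<bar>y - x\<bar>}" for m :: nat
  have "negligible (E m)" for m
    using indefinite_integral_bad_set_negligible[OF int, of "inverse (real (Suc m))"]
    unfolding E_def F_def by simp
  then have "negligible (\<Union>m. E m)" by (intro negligible_countable_Union) auto
  moreover have "(F has_vector_derivative \<phi> x) (at x within {a..b})" if x: "x \<in> {a..b} - (\<Union>m. E m)" for x
    unfolding vderiv_within_iff
  proof (intro allI impI)
    fix e :: real assume "e > 0"
    then obtain m where m: "inverse (real (Suc m)) < e" using reals_Archimedean by blast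
    from x have "x \<notin> E m" "x \<in> {a..b}" by auto
    then have "\<not> (\<forall>d>0. \<exists>y\<in>{a..b}. \<bar>y - x\<bar> < d \<and>
      norm (F y - F x - (y - x) *\<^sub>R \<phi> x) > inverse (real (Suc m)) * \<bar>y - x\<bar>)"
      unfolding E_def mem_Collect_eq by simp
    then have "\<exists>d>0. \<forall>y\<in>{a..b}. \<bar>y - x\<bar> < d \<longrightarrow>
        norm (F y - F x - (y - x) *\<^sub>R \<phi> x) \<le> inverse (real (Suc m)) * \<bar>y - x\<bar>"
      by (force simp only: not_all not_ex not_less Bex_def Ball_def)
    then obtain d where d: "d > 0" "\<And>y. y \<in> {a..b} \<Longrightarrow> \<bar>y - x\<bar> < d \<Longrightarrow>
        norm (F y - F x - (y - x) *\<^sub>R \<phi> x) \<le> inverse (real (Suc m)) * \<bar>y - x\<bar>"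
      by blast
    show "\<exists>d>0. \<forall>y\<in>{a..b}. \<bar>y - x\<bar> < d \<longrightarrow> norm (F y - F x - (y - x) *\<^sub>R \<phi> x) \<le> e * \<bar>y - x\<bar>"
    proof (intro exI[of _ d] conjI ballI impI)
      fix y assume "y \<in> {a..b}" "\<bar>y - x\<bar> < d"
      then have "norm (F y - F x - (y - x) *\<^sub>R \<phi> x) \<le> inverse (real (Suc m)) * \<bar>y - x\<bar>" by (rule d(2))
      also have "\<dots> \<le> e * \<bar>y - x\<bar>" using m by (intro mult_right_mono) auto
      finally show "norm (F y - F x - (y - x) *\<^sub>R \<phi> x) \<le> e * \<bar>y - x\<bar>" .
    qed (rule d(1))
  qed
  ultimately show ?thesis unfolding F_def by blast
qed

text \<open>Passes from numbered families of intervals to finite sets of them, the shape in which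
  tagged divisions deliver intervals.\<close>

lemma absolutely_continuous_onD:
  fixes \<phi> :: "real \<Rightarrow> 'a::real_normed_vector"
  assumes "absolutely_continuous_on I \<phi>" "e > 0"
  obtains d where "d > 0" "\<And>C :: (real \<times> real) set. finite C \<Longrightarrow>
     (\<And>u v. (u, v) \<in> C \<Longrightarrow> u \<le> v \<and> {u..v} \<subseteq> I) \<Longrightarrow>
     (\<And>u v u' v'. (u, v) \<in> C \<Longrightarrow> (u', v') \<in> C \<Longrightarrow> (u, v) \<noteq> (u', v') \<Longrightarrow> {u<..<v} \<inter> {u'<..<v'} = {}) \<Longrightarrow>
     (\<Sum>(u, v)\<in>C. v - u) < d \<Longrightarrow> (\<Sum>(u, v)\<in>C. norm (\<phi> v - \<phi> u)) < e"
proof -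
  from assms(1)[unfolded absolutely_continuous_on_def, THEN spec, THEN mp, OF assms(2)]
  obtain d where d': "d > 0 \<and> (\<forall>(n::nat) a b.
        (\<forall>i<n. a i \<le> b i \<and> {a i..b i} \<subseteq> I) \<and>
        (\<forall>i<n. \<forall>j<i. {a i<..<b i} \<inter> {a j<..<b j} = {}) \<and>
        (\<Sum>i<n. b i - a i) < d \<longrightarrow>
        (\<Sum>i<n. norm (\<phi> (b i) - \<phi> (a i))) < e)" ..
  note d = conjunct1[OF d'] conjunct2[OF d']
  show thesis
  proof (rule that[OF d(1)])
    fix C :: "(real \<times> real) set"
    assume C: "finite C" "\<And>u v. (u, v) \<in> C \<Longrightarrow> u \<le> v \<and> {u..v} \<subseteq> I"
     "\<And>u v u' v'. (u, v) \<in> C \<Longrightarrow> (u', v') \<in> C \<Longrightarrow> (u, v) \<noteq> (u', v') \<Longrightarrow> {u<..<v} \<inter> {u'<..<v'} = {}"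
     "(\<Sum>(u, v)\<in>C. v - u) < d"
    obtain h where h: "bij_betw h {0..<card C} C" using ex_bij_betw_nat_finite[OF C(1)] by blast
    then have h': "bij_betw h {..<card C} C" by (simp add: atLeast0LessThan)
    have hC: "(fst (h i), snd (h i)) \<in> C" if "i < card C" for i
      using h' that by (auto simp: bij_betw_def)
    have hne: "h i \<noteq> h j" if "i < card C" "j < i" for i j
      using bij_betw_imp_inj_on[OF h'] that by (metis inj_onD lessThan_iff less_trans less_irrefl)
    have "(\<Sum>i<card C. norm (\<phi> (snd (h i)) - \<phi> (fst (h i)))) < e"
    proof (rule d(2)[rule_format], intro conjI)
      show "\<forall>i<card C. fst (h i) \<le> snd (h i) \<and> {fst (h i)..snd (h i)} \<subseteq> I"
        using C(2) hC by blast
      show "\<forall>i<card C. \<forall>j<i. {fst (h i)<..<snd (h i)} \<inter> {fst (h j)<..<snd (h j)} = {}"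
        using C(3) hC hne by (metis order.strict_trans prod.collapse)
      show "(\<Sum>i<card C. snd (h i) - fst (h i)) < d"
        using C(4) sum.reindex_bij_betw[OF h', of "\<lambda>p. snd p - fst p"] by (simp add: split_beta)
    qed
    then show "(\<Sum>(u, v)\<in>C. norm (\<phi> v - \<phi> u)) < e"
      using sum.reindex_bij_betw[OF h', of "\<lambda>p. norm (\<phi> (snd p) - \<phi> (fst p))"] by (simp add: split_beta)
  qed
qed

text \<open>At tags outside \<open>N\<close> the derivative controls the increment of the interval.
  At tags in \<open>N\<close> the gauge forces the intervals into an open set of measure less than
  \<open>d\<close>, so absolute continuity makes the increments sum to less than
  \<open>e / 2\<close>.\<close>

theorem absolutely_continuous_fundamental_theorem:
  fixes \<phi> :: "real \<Rightarrow> 'a::real_normed_vector"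
  assumes ab: "a \<le> b" and ac: "absolutely_continuous_on {a..b} \<phi>" and N: "negligible N"
    and deriv: "\<And>t. t \<in> {a..b} - N \<Longrightarrow> (\<phi> has_vector_derivative h t) (at t within {a..b})"
  shows "(h has_integral (\<phi> b - \<phi> a)) {a..b}"
proof -
  \<comment> \<open>With value zero on the null set, a tag in \<open>N\<close> contributes only the
    increment of \<phi>.\<close>
  define h0 where "h0 t = (if t \<in> N then 0 else h t)" for t
  have "(h0 has_integral (\<phi> b - \<phi> a)) (cbox a b)"
    unfolding has_integral
  proof (intro allI impI)
    fix e :: real assume e: "e > 0"
    define e' where "e' = e / (2 * (b - a + 1))"
    have e': "e' > 0" "e' * (b - a) < e / 2" using e ab by (auto simp: e'_def field_simps)
    obtain d where d: "d > 0" and dC: "\<And>C :: (real \<times> real) set. finite C \<Longrightarrow>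
     (\<And>u v. (u, v) \<in> C \<Longrightarrow> u \<le> v \<and> {u..v} \<subseteq> {a..b}) \<Longrightarrow>
     (\<And>u v u' v'. (u, v) \<in> C \<Longrightarrow> (u', v') \<in> C \<Longrightarrow> (u, v) \<noteq> (u', v') \<Longrightarrow> {u<..<v} \<inter> {u'<..<v'} = {}) \<Longrightarrow>
     (\<Sum>(u, v)\<in>C. v - u) < d \<Longrightarrow> (\<Sum>(u, v)\<in>C. norm (\<phi> v - \<phi> u)) < e / 2"
      using absolutely_continuous_onD[OF ac, of "e/2"] e by (metis half_gt_zero)
    have N': "N \<in> lmeasurable" "measure lebesgue N = 0" using N negligible_iff_measure by auto
    obtain G where G: "open G" "N \<subseteq> G" "G - N \<in> lmeasurable" "measure lebesgue (G - N) < d"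
      using sets_lebesgue_outer_open[of N d] N' d by (metis emeasure_eq_measure2 ennreal_less_iff fmeasurableD measure_nonneg)
    have G': "G \<in> lmeasurable" "measure lebesgue G < d"
    proof -
      have "G = (G - N) \<union> N" using G by auto
      then show "G \<in> lmeasurable" using G N' by (metis fmeasurable.Un)
      have "measure lebesgue ((G - N) \<union> N) \<le> measure lebesgue (G - N) + measure lebesgue N"
        using G N' by (intro measure_Un_le) auto
      then show "measure lebesgue G < d" using \<open>G = (G - N) \<union> N\<close> G N' by simp
    qed
    have "\<exists>r>0. (t \<in> N \<longrightarrow> ball t r \<subseteq> G) \<and> (t \<in> {a..b} - N \<longrightarrow> (\<forall>y\<in>{a..b}. \<bar>y - t\<bar> < r \<longrightarrow>
        norm (\<phi> y - \<phi> t - (y - t) *\<^sub>R h t) \<le> e' * \<bar>y - t\<bar>))" for t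
    proof (cases "t \<in> N")
      case True
      then show ?thesis using G by (meson DiffD2 open_contains_ball subsetD)
    next
      case False
      show ?thesis
      proof (cases "t \<in> {a..b}")
        case True
        then show ?thesis using deriv[of t] False e' unfolding vderiv_within_iff by blast
      next
        case f2: False
        then show ?thesis using False by (intro exI[of _ 1]) auto
      qed
    qed
    then obtain r where r: "\<And>t. r t > 0" "\<And>t. t \<in> N \<Longrightarrow> ball t (r t) \<subseteq> G"
      "\<And>t y. t \<in> {a..b} - N \<Longrightarrow> y \<in> {a..b} \<Longrightarrow> \<bar>y - t\<bar> < r t \<Longrightarrow>
        norm (\<phi> y - \<phi> t - (y - t) *\<^sub>R h t) \<le> e' * \<bar>y - t\<bar>" by metis
    define \<gamma> where "\<gamma> t = ball t (r t)" for t
    have "gauge \<gamma>" using r(1) by (auto simp: gauge_def \<gamma>_def)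
    moreover have "norm ((\<Sum>(x,k)\<in>p. measure lborel k *\<^sub>R h0 x) - (\<phi> b - \<phi> a)) < e"
      if p: "p tagged_division_of (cbox a b)" and fine: "\<gamma> fine p" for p
    proof -
      have finp: "finite p" using p by auto
      have Ik: "\<exists>u v. k = {u..v} \<and> u \<le> v \<and> x \<in> {u..v} \<and> {u..v} \<subseteq> {a..b} \<and> {u..v} \<subseteq> ball x (r x)"
        if xk: "(x, k) \<in> p" for x k
      proof -
        obtain u v where "k = cbox u v" using tagged_division_ofD(4)[OF p xk] by blast
        moreover have "x \<in> k" "k \<subseteq> cbox a b" using tagged_division_ofD(2,3)[OF p xk] by auto
        moreover have "k \<subseteq> ball x (r x)" using fine xk by (auto simp: fine_def \<gamma>_def)
        ultimately show ?thesis by (intro exI[of _ u] exI[of _ v]) auto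
      qed
      have tele: "(\<Sum>(x,k)\<in>p. \<phi> (Sup k) - \<phi> (Inf k)) = \<phi> b - \<phi> a"
        using additive_tagged_division_1[OF ab, of p \<phi>] p by simp
      define p1 where "p1 = {(x,k)\<in>p. x \<in> N}"
      define p2 where "p2 = {(x,k)\<in>p. x \<notin> N}"
      have p12: "p = p1 \<union> p2" "p1 \<inter> p2 = {}" "finite p1" "finite p2"
        using finp by (auto simp: p1_def p2_def intro: finite_subset[OF _ finp])
      define T where "T = (\<lambda>(x,k). measure lborel k *\<^sub>R h0 x - (\<phi> (Sup k) - \<phi> (Inf k)))"
      have eq: "(\<Sum>(x,k)\<in>p. measure lborel k *\<^sub>R h0 x) - (\<phi> b - \<phi> a) = sum T p1 + sum T p2"
        unfolding tele[symmetric] sum_subtractf[symmetric] p12(1)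
        by (subst sum.union_disjoint[symmetric]) (use p12 in \<open>auto simp: T_def split_def\<close>)
      have "norm (sum T p2) \<le> (\<Sum>(x,k)\<in>p2. e' * measure lborel k)"
      proof (rule order_trans[OF norm_sum sum_mono], clarify)
        fix x k assume "(x, k) \<in> p2"
        then have xk: "(x, k) \<in> p" "x \<notin> N" by (auto simp: p2_def)
        then obtain u v where uv: "k = {u..v}" "u \<le> v" "x \<in> {u..v}" "{u..v} \<subseteq> {a..b}" "{u..v} \<subseteq> ball x (r x)"
          using Ik by blast
        have x: "x \<in> {a..b} - N" using uv xk by auto
        have "u \<in> {u..v}" "v \<in> {u..v}" using uv(2) by auto
        then have "u \<in> ball x (r x)" "v \<in> ball x (r x)" "u \<in> {a..b}" "v \<in> {a..b}"
          using uv(4,5) by blast+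
        then have "norm (\<phi> u - \<phi> x - (u - x) *\<^sub>R h x) \<le> e' * \<bar>u - x\<bar>" "norm (\<phi> v - \<phi> x - (v - x) *\<^sub>R h x) \<le> e' * \<bar>v - x\<bar>"
          by (intro r(3)[OF x]; simp add: dist_real_def abs_minus_commute)+
        then have "norm ((\<phi> u - \<phi> x - (u - x) *\<^sub>R h x) - (\<phi> v - \<phi> x - (v - x) *\<^sub>R h x)) \<le> e' * \<bar>u - x\<bar> + e' * \<bar>v - x\<bar>"
          by (intro order_trans[OF norm_triangle_ineq4 add_mono])
        also have "(\<phi> u - \<phi> x - (u - x) *\<^sub>R h x) - (\<phi> v - \<phi> x - (v - x) *\<^sub>R h x) = (v - u) *\<^sub>R h x - (\<phi> v - \<phi> u)"
          by (simp add: algebra_simps)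
        also have "e' * \<bar>u - x\<bar> + e' * \<bar>v - x\<bar> = e' * (v - u)" using uv by (auto simp: algebra_simps)
        finally show "norm (T (x, k)) \<le> e' * measure lborel k"
          using uv xk by (simp add: T_def h0_def)
      qed
      also have "\<dots> \<le> (\<Sum>(x,k)\<in>p. e' * measure lborel k)"
        using e' finp p12 by (intro sum_mono2) auto
      also have "\<dots> = e' * (b - a)"
        using additive_content_tagged_division[OF p] ab by (simp add: split_def flip: sum_distrib_left)
      finally have P2: "norm (sum T p2) < e / 2" using e' by simp
      \<comment> \<open>A nondegenerate interval occurs with one tag only, as interiors are
        disjoint, so it can be counted by its endpoints. Degenerate intervals contribute nothing to
        the sum.\<close>
      define C where "C = (\<lambda>(x,k). (Inf k, Sup k)) ` {(x,k)\<in>p1. measure lborel k \<noteq> 0}"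
      have Cfin: "finite C" using p12 by (auto simp: C_def intro!: finite_imageI finite_subset[OF _ p12(3)])
      have P1: "norm (sum T p1) < e / 2"
      proof -
        let ?q = "{(x,k)\<in>p1. measure lborel k \<noteq> 0}"
        have q: "finite ?q" by (rule finite_subset[OF _ p12(3)]) auto
        have disj: "{u<..<v} \<inter> {u'<..<v'} = {}" if "(x, {u..v}) \<in> p" "(x', {u'..v'}) \<in> p" "(x, {u..v}) \<noteq> (x', {u'..v'})"
          for x u v x' u' v'
          using tagged_division_ofD(5)[OF p that] by (simp add: interior_atLeastAtMost_real)
        have inj: "inj_on (\<lambda>(x,k). (Inf k, Sup k)) ?q"
        proof (rule inj_onI, clarify)
          fix x k x' k' assume *: "(x, k) \<in> p1" "(x', k') \<in> p1" "measure lborel k \<noteq> 0" "measure lborel k' \<noteq> 0" "Inf k = Inf k'" "Sup k = Sup k'"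
          then obtain u v u' v' where uv: "k = {u..v}" "u \<le> v" "k' = {u'..v'}" "u' \<le> v'"
            using Ik unfolding p1_def by (metis (no_types, lifting) case_prodD mem_Collect_eq)
          then have "u = u'" "v = v'" "u < v" using * by auto
          then have "{u<..<v} \<inter> {u'<..<v'} \<noteq> {}" by simp
          with disj[of x u v x' u' v'] * uv show "x = x' \<and> k = k'" by (auto simp: p1_def)
        qed
        have "sum T p1 = sum T ?q"
        proof (rule sum.mono_neutral_right)
          show "\<forall>i\<in>p1 - ?q. T i = 0"
          proof
            fix i assume "i \<in> p1 - ?q"
            then obtain x k where i: "i = (x, k)" and *: "(x, k) \<in> p1" "\<not> measure lborel k \<noteq> 0"
              by (cases i) auto
            then obtain u v where uv: "k = {u..v}" "u \<le> v" using Ik unfolding p1_def by blast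
            then have "u = v" using * by auto
            then show "T i = 0" unfolding i using uv by (simp add: T_def)
          qed
        qed (use p12 in auto)
        also have "norm (sum T ?q) \<le> (\<Sum>i\<in>?q. norm (T i))" by (rule norm_sum)
        also have "\<dots> = (\<Sum>(x,k)\<in>?q. norm (\<phi> (Sup k) - \<phi> (Inf k)))"
          by (rule sum.cong) (auto simp: T_def p1_def h0_def norm_minus_commute)
        also have "\<dots> = (\<Sum>(u,v)\<in>C. norm (\<phi> v - \<phi> u))"
          unfolding C_def by (subst sum.reindex[OF inj]) (simp add: split_def)
        also have "\<dots> < e / 2"
        proof (rule dC[OF Cfin])
          show "u \<le> v \<and> {u..v} \<subseteq> {a..b}" if "(u, v) \<in> C" for u v
            using that Ik unfolding C_def p1_def by fastforce
          show "{u<..<v} \<inter> {u'<..<v'} = {}" if c: "(u, v) \<in> C" "(u', v') \<in> C" "(u, v) \<noteq> (u', v')" for u v u' v'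
          proof -
            from c obtain x k x' k' where *: "(x, k) \<in> p" "(x', k') \<in> p" "u = Inf k" "v = Sup k" "u' = Inf k'" "v' = Sup k'"
              unfolding C_def p1_def by auto
            have ends: "l = {Inf l..Sup l}" if "(z, l) \<in> p" for z l
              using Ik[OF that] by (elim exE conjE) simp
            have k: "k = {u..v}" "k' = {u'..v'}" using ends[OF *(1)] ends[OF *(2)] *(3-6) by simp_all
            have "(x, k) \<noteq> (x', k')" using *(3-6) c(3) by auto
            then show ?thesis by (rule disj[of x u v x' u' v', folded k, OF *(1,2)])
          qed
          have "(\<Sum>(u,v)\<in>C. v - u) = (\<Sum>(x,k)\<in>?q. measure lebesgue k)"
            unfolding C_def by (subst sum.reindex[OF inj]) (auto simp: split_def p1_def dest!: Ik intro!: sum.cong)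
          also have "\<dots> = measure lebesgue (\<Union>(x,k)\<in>?q. k)"
          proof -
            have "measure lebesgue (\<Union>i\<in>?q. snd i) = (\<Sum>i\<in>?q. measure lebesgue (snd i))"
            proof (rule measure_negligible_finite_Union_image[OF q])
              show "snd i \<in> lmeasurable" if "i \<in> ?q" for i
                using that Ik unfolding p1_def by force
              show "pairwise (\<lambda>i j. negligible (snd i \<inter> snd j)) ?q"
              proof (rule pairwiseI)
                fix i j assume ij: "i \<in> ?q" "j \<in> ?q" "i \<noteq> j"
                obtain x k x' k' where e: "i = (x, k)" "j = (x', k')" by (cases i, cases j)
                then have *: "(x, k) \<in> p1" "(x', k') \<in> p1" "(x, k) \<noteq> (x', k')" using ij by auto
                then obtain u v u' v' where uv: "k = {u..v}" "k' = {u'..v'}"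
                  using Ik unfolding p1_def by (metis (no_types, lifting) case_prodD mem_Collect_eq)
                then have "{u<..<v} \<inter> {u'<..<v'} = {}" using disj * by (auto simp: p1_def)
                then have "{u..v} \<inter> {u'..v'} \<subseteq> {u,v,u',v'}" by (fastforce simp: less_le)
                then show "negligible (snd i \<inter> snd j)"
                  unfolding e uv snd_conv by (rule negligible_subset[rotated]) (simp add: negligible_finite)
              qed
            qed
            then show ?thesis by (simp add: split_def)
          qed
          also have "\<dots> \<le> measure lebesgue G"
          proof (rule measure_mono_fmeasurable[OF _ _ G'(1)])
            show "(\<Union>(x,k)\<in>?q. k) \<subseteq> G"
            proof (rule UN_least)
              fix i assume "i \<in> ?q"
              then obtain x k where i: "i = (x, k)" "(x, k) \<in> p" "x \<in> N" by (cases i) (auto simp: p1_def)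
              then have "k \<subseteq> ball x (r x)" using Ik[OF i(2)] by auto
              also have "\<dots> \<subseteq> G" using r(2) i(3) .
              finally show "(case i of (x, k) \<Rightarrow> k) \<subseteq> G" using i by simp
            qed
            show "(\<Union>(x,k)\<in>?q. k) \<in> sets lebesgue"
            proof (rule sets.finite_UN[OF q])
              fix i assume "i \<in> ?q"
              then obtain x k where i: "i = (x, k)" "(x, k) \<in> p" by (cases i) (auto simp: p1_def)
              from Ik[OF i(2)] obtain u v where "k = {u..v}" by blast
              then show "(case i of (x, k) \<Rightarrow> k) \<in> sets lebesgue" unfolding i(1) by simp
            qed
          qed
          finally show "(\<Sum>(u,v)\<in>C. v - u) < d" using G' by simp
        qed
        finally show ?thesis .
      qed
      show ?thesis unfolding eq using norm_triangle_ineq[of "sum T p1" "sum T p2"] P1 P2 by linarith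
    qed
    ultimately show "\<exists>\<gamma>. gauge \<gamma> \<and> (\<forall>p. p tagged_division_of cbox a b \<and> \<gamma> fine p \<longrightarrow>
        norm ((\<Sum>(x,k)\<in>p. measure lborel k *\<^sub>R h0 x) - (\<phi> b - \<phi> a)) < e)"
      by (intro exI[of _ \<gamma>] conjI allI impI) auto
  qed
  then have "(h0 has_integral (\<phi> b - \<phi> a)) {a..b}" by simp
  then show ?thesis by (rule has_integral_spike[OF N, rotated]) (simp add: h0_def)
qed

text \<open>The right-hand side of the hypothesis, discounted by \<open>exp (- L * s)\<close>, is
  nonincreasing. It is differentiable because it contains the integral of \<open>w\<close>, while
  \<open>w\<close> is merely continuous.\<close>

lemma gronwall:
  fixes w :: "real \<Rightarrow> real"
  assumes cont: "continuous_on {0..T} w" and L: "L \<ge> 0"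
    and le: "\<And>t. t \<in> {0..T} \<Longrightarrow> w t \<le> A + L * integral {0..t} w"
    and t: "t \<in> {0..T}"
  shows "w t \<le> A * exp (L * t)"
proof -
  define W where "W s = (A + L * integral {0..s} w) * exp (- L * s)" for s
  have "W t \<le> W 0"
  proof (rule DERIV_nonpos_imp_decreasing_open[of 0 t W])
    fix s assume s: "0 < s" "s < t"
    then have sT: "s \<in> {0..T}" using t by auto
    have "at s within {0..T} = at s" using s t by (intro at_within_Icc_at) auto
    then have [derivative_intros]: "((\<lambda>s. integral {0..s} w) has_real_derivative w s) (at s)"
      using integral_has_real_derivative[OF cont sT] by simp
    have "(W has_real_derivative L * (w s - (A + L * integral {0..s} w)) * exp (- L * s)) (at s)"
      unfolding W_def[abs_def] by (auto intro!: derivative_eq_intros simp: algebra_simps)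
    moreover have "L * (w s - (A + L * integral {0..s} w)) * exp (- L * s) \<le> 0"
      using le[OF sT] L by (intro mult_nonpos_nonneg mult_nonneg_nonpos) auto
    ultimately show "\<exists>y. (W has_real_derivative y) (at s) \<and> y \<le> 0" by blast
  next
    have "continuous_on {0..t} w" using cont t by (auto intro: continuous_on_subset)
    then show "continuous_on {0..t} W" unfolding W_def
      by (intro continuous_intros indefinite_integral_continuous_1 integrable_continuous_real)
  qed (use t in auto)
  also have "W 0 = A" by (simp add: W_def)
  finally have "(A + L * integral {0..t} w) * exp (- L * t) * exp (L * t) \<le> A * exp (L * t)"
    unfolding W_def by (intro mult_right_mono) auto
  then have "A + L * integral {0..t} w \<le> A * exp (L * t)"
    by (simp add: mult.assoc flip: exp_add)
  with le[OF t] show ?thesis by linarith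
qed

section \<open>Trajectories\<close>

lemma borel_measurable_lebesgue_on:
  fixes h :: "real \<Rightarrow> 'a::euclidean_space"
  assumes "h \<in> borel_measurable nonneg_borel" "0 \<le> a"
  shows "h \<in> borel_measurable (lebesgue_on {a..b})"
proof -
  have "h \<in> borel_measurable (restrict_space borel {a..b})"
    using assms by (intro measurable_restrict_mono[OF assms(1)]) auto
  then show ?thesis
    unfolding measurable_def by (auto simp: space_restrict_space sets_restrict_space)
qed

lemma bounded_measurable_integrable_on:
  fixes h :: "real \<Rightarrow> 'a::euclidean_space"
  assumes "h \<in> borel_measurable nonneg_borel" "0 \<le> a" "\<And>t. t \<in> {a..b} \<Longrightarrow> norm (h t) \<le> B"
  shows "h integrable_on {a..b}"
  by (rule measurable_bounded_by_integrable_imp_integrable[OF borel_measurable_lebesgue_on[OF assms(1,2)], of "\<lambda>_. B"])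
    (use assms in auto)

lemma nonneg_borel_borel_measurable:
  fixes y :: "real \<Rightarrow> 'a::topological_space"
  assumes "continuous_on {0..} y"
  shows "y \<in> borel_measurable nonneg_borel"
  using assms by (rule borel_measurable_continuous_on_restrict)

locale ode_control =
  fixes U :: "'u::{metric_space,second_countable_topology} set"
    and f :: "real^'n \<Rightarrow> 'u \<Rightarrow> real^'n"
    and g :: "real^'n \<Rightarrow> 'u \<Rightarrow> real"
  assumes problem: "control_problem U f g"
begin

definition lipc :: real where
  "lipc = (SOME L. L \<ge> 0 \<and> (\<forall>y z. \<forall>u\<in>U. norm (f y u - f z u) \<le> L * norm (y - z)))"

definition growc :: real where
  "growc = (SOME a. a > 0 \<and> (\<forall>y. \<forall>u\<in>U. norm (f y u) \<le> a * (1 + norm y)))"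

lemma lipc: "lipc \<ge> 0" "u \<in> U \<Longrightarrow> norm (f y u - f z u) \<le> lipc * norm (y - z)"
proof -
  have "\<exists>L. L \<ge> 0 \<and> (\<forall>y z. \<forall>u\<in>U. norm (f y u - f z u) \<le> L * norm (y - z))"
    using problem unfolding control_problem_def by blast
  from someI_ex[OF this] show "lipc \<ge> 0" "u \<in> U \<Longrightarrow> norm (f y u - f z u) \<le> lipc * norm (y - z)"
    unfolding lipc_def[symmetric] by auto
qed

lemma growc: "growc > 0" "u \<in> U \<Longrightarrow> norm (f y u) \<le> growc * (1 + norm y)"
proof -
  have "\<exists>a. a > 0 \<and> (\<forall>y. \<forall>u\<in>U. norm (f y u) \<le> a * (1 + norm y))"
    using problem unfolding control_problem_def by blast
  from someI_ex[OF this] show "growc > 0" "u \<in> U \<Longrightarrow> norm (f y u) \<le> growc * (1 + norm y)"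
    unfolding growc_def[symmetric] by auto
qed

lemma controls_in: "u \<in> controls U \<Longrightarrow> 0 \<le> t \<Longrightarrow> u t \<in> U"
  unfolding controls_def by (drule measurable_space) (auto simp: space_restrict_space)

lemma const_control: "b \<in> U \<Longrightarrow> (\<lambda>_. b) \<in> controls U"
  unfolding controls_def by (auto simp: space_restrict_space)

lemma controls_nonempty: "controls U \<noteq> {}"
proof -
  obtain b where "b \<in> U" using problem unfolding control_problem_def by blast
  then show ?thesis using const_control by blast
qed

lemma rhs_measurable:
  assumes "u \<in> controls U" "continuous_on {0..} y"
  shows "(\<lambda>t. f (y t) (u t)) \<in> borel_measurable nonneg_borel"
proof -
  have "(\<lambda>(y, u). f y u) \<in> borel \<Otimes>\<^sub>M restrict_space borel U \<rightarrow>\<^sub>M borel"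
    using problem unfolding control_problem_def by blast
  moreover have "(\<lambda>t. (y t, u t)) \<in> nonneg_borel \<rightarrow>\<^sub>M borel \<Otimes>\<^sub>M restrict_space borel U"
    using assms nonneg_borel_borel_measurable unfolding controls_def by (intro measurable_Pair) auto
  ultimately show ?thesis using measurable_compose by force
qed

lemma rhs_bounded:
  assumes "u \<in> controls U" "continuous_on {0..} y" "0 \<le> a"
  shows "\<exists>B. \<forall>t\<in>{a..b}. norm (f (y t) (u t)) \<le> B"
proof -
  have "compact (y ` {a..b})"
    using assms by (intro compact_continuous_image) (auto intro: continuous_on_subset)
  then obtain C where C: "\<And>t. t \<in> {a..b} \<Longrightarrow> norm (y t) \<le> C"
    by (meson compact_imp_bounded bounded_iff imageI)
  have "norm (f (y t) (u t)) \<le> growc * (1 + C)" if "t \<in> {a..b}" for t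
  proof -
    have "norm (f (y t) (u t)) \<le> growc * (1 + norm (y t))"
      using that assms by (intro growc controls_in) auto
    also have "\<dots> \<le> growc * (1 + C)" using C[OF that] growc(1) by (intro mult_left_mono) auto
    finally show ?thesis .
  qed
  then show ?thesis by blast
qed

lemma rhs_integrable:
  assumes "u \<in> controls U" "continuous_on {0..} y" "0 \<le> a"
  shows "(\<lambda>t. f (y t) (u t)) integrable_on {a..b}"
proof -
  obtain B where "\<forall>t\<in>{a..b}. norm (f (y t) (u t)) \<le> B" using rhs_bounded[OF assms] by blast
  then show ?thesis using rhs_measurable[OF assms(1,2)] assms(3)
    by (intro bounded_measurable_integrable_on) auto
qed

text \<open>For controls this is equivalent to \<open>is_solution\<close>, by
  \<open>integral_solution_is_solution\<close> and \<open>is_solution_integral_solution\<close>, but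
  it is free of exceptional null sets and therefore suits the Gronwall and Picard arguments.\<close>

definition integral_solution :: "(real \<Rightarrow> 'u) \<Rightarrow> real^'n \<Rightarrow> (real \<Rightarrow> real^'n) \<Rightarrow> bool" where
  "integral_solution u x y \<longleftrightarrow> continuous_on {0..} y \<and>
     (\<forall>t\<ge>0. y t = x + integral {0..t} (\<lambda>s. f (y s) (u s)))"

lemma integral_solution_diff:
  assumes "integral_solution u x y" "u \<in> controls U" "0 \<le> s" "s \<le> t"
  shows "y t - y s = integral {s..t} (\<lambda>r. f (y r) (u r))"
proof -
  have "integral {0..s} (\<lambda>r. f (y r) (u r)) + integral {s..t} (\<lambda>r. f (y r) (u r)) = integral {0..t} (\<lambda>r. f (y r) (u r))"
    using assms by (intro Henstock_Kurzweil_Integration.integral_combine rhs_integrable)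
      (auto simp: integral_solution_def)
  then show ?thesis using assms by (simp add: integral_solution_def algebra_simps)
qed

text \<open>Gronwall's inequality for the distance of the two states. The case of equal initial
  states gives uniqueness and causality, the case of equal controls gives continuous dependence on
  the initial state.\<close>

lemma integral_solution_comparison:
  assumes y: "integral_solution u x y" and z: "integral_solution v x' z"
    and u: "u \<in> controls U" and v: "v \<in> controls U"
    and eq: "\<And>t. t \<in> {0..<T} \<Longrightarrow> u t = v t" and t: "t \<in> {0..T}"
  shows "norm (y t - z t) \<le> norm (x - x') * exp (lipc * t)"
proof -
  have cy: "continuous_on {0..} y" and cz: "continuous_on {0..} z"
    using y z by (auto simp: integral_solution_def)
  let ?w = "\<lambda>t. norm (y t - z t)"
  have cw: "continuous_on {0..s} ?w" for s
  proof -
    have "continuous_on {0..s} y" "continuous_on {0..s} z"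
      using continuous_on_subset[OF cy, of "{0..s}"] continuous_on_subset[OF cz, of "{0..s}"] by auto
    then show ?thesis by (intro continuous_intros)
  qed
  show ?thesis
  proof (rule gronwall[OF cw lipc(1) _ t, of "norm (x - x')"])
    fix s assume s: "s \<in> {0..T}"
    have iy: "(\<lambda>r. f (y r) (u r)) integrable_on {0..s}" and iz: "(\<lambda>r. f (z r) (v r)) integrable_on {0..s}"
      using u v cy cz by (auto intro: rhs_integrable)
    \<comment> \<open>The controls agree on \<open>{0..<T}\<close>, and the remaining point
      \<open>T\<close> does not affect the integral. Concatenated controls agree in exactly this
      half-open way.\<close>
    have iz': "integral {0..s} (\<lambda>r. f (z r) (v r)) = integral {0..s} (\<lambda>r. f (z r) (u r))"
      by (rule integral_spike[of "{T}"]) (use eq s in auto)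
    have iz2: "(\<lambda>r. f (z r) (u r)) integrable_on {0..s}" using u cz by (auto intro: rhs_integrable)
    have "y s - z s = (x - x') + integral {0..s} (\<lambda>r. f (y r) (u r) - f (z r) (u r))"
      using y z s iz' by (simp add: integral_solution_def Henstock_Kurzweil_Integration.integral_diff[OF iy iz2])
    then have "norm (y s - z s) \<le> norm (x - x') + norm (integral {0..s} (\<lambda>r. f (y r) (u r) - f (z r) (u r)))"
      by (metis norm_triangle_ineq)
    also have "norm (integral {0..s} (\<lambda>r. f (y r) (u r) - f (z r) (u r))) \<le> integral {0..s} (\<lambda>r. lipc * ?w r)"
    proof (rule Henstock_Kurzweil_Integration.integral_norm_bound_integral)
      show "(\<lambda>r. f (y r) (u r) - f (z r) (u r)) integrable_on {0..s}" using iy iz2 by (rule integrable_diff)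
      show "(\<lambda>r. lipc * ?w r) integrable_on {0..s}"
        by (intro integrable_continuous_real continuous_on_mult_left cw)
      show "norm (f (y r) (u r) - f (z r) (u r)) \<le> lipc * ?w r" if "r \<in> {0..s}" for r
        using that u by (intro lipc controls_in) auto
    qed
    finally show "norm (y s - z s) \<le> norm (x - x') + lipc * integral {0..s} ?w" by simp
  qed
qed

lemma integral_solution_is_solution:
  assumes y: "integral_solution u x y" and u: "u \<in> controls U"
  shows "is_solution f u x y"
  unfolding is_solution_def
proof (intro conjI allI impI)
  let ?h = "\<lambda>t. f (y t) (u t)"
  have cy: "continuous_on {0..} y" and eq: "\<And>t. t \<ge> 0 \<Longrightarrow> y t = x + integral {0..t} ?h"
    using y by (auto simp: integral_solution_def)
  show "y 0 = x" using eq[of 0] by simp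
  fix T :: real assume "T \<ge> 0"
  obtain B0 where B0: "\<forall>t\<in>{0..T}. norm (?h t) \<le> B0" using rhs_bounded[OF u cy] by blast
  define B where "B = \<bar>B0\<bar> + 1"
  have B: "B > 0" "\<And>t. t \<in> {0..T} \<Longrightarrow> norm (?h t) \<le> B" using B0 by (force simp: B_def)+
  have lip: "norm (y d - y c) \<le> B * (d - c)" if "c \<le> d" "{c..d} \<subseteq> {0..T}" for c d
  proof -
    have "c \<in> {c..d}" "d \<in> {c..d}" using that by auto
    then have cd: "0 \<le> c" "d \<le> T" using that by auto
    then have "y d - y c = integral {c..d} ?h" by (intro integral_solution_diff[OF y u]) (use that in auto)
    also have "norm \<dots> \<le> integral {c..d} (\<lambda>_. B)"
      using u cy cd B by (intro Henstock_Kurzweil_Integration.integral_norm_bound_integral rhs_integrable) auto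
    also have "\<dots> = B * (d - c)" using that by simp
    finally show ?thesis .
  qed
  show "absolutely_continuous_on {0..T} y"
    unfolding absolutely_continuous_on_def
  proof (intro allI impI)
    fix e :: real assume e: "e > 0"
    show "\<exists>\<delta>>0. \<forall>(n::nat) a b. (\<forall>i<n. a i \<le> b i \<and> {a i..b i} \<subseteq> {0..T}) \<and>
        (\<forall>i<n. \<forall>j<i. {a i<..<b i} \<inter> {a j<..<b j} = {}) \<and> (\<Sum>i<n. b i - a i) < \<delta> \<longrightarrow>
        (\<Sum>i<n. norm (y (b i) - y (a i))) < e"
    proof (intro exI[of _ "e / B"] conjI allI impI)
      show "e / B > 0" using e B by simp
      fix n :: nat and a b :: "nat \<Rightarrow> real"
      assume H: "(\<forall>i<n. a i \<le> b i \<and> {a i..b i} \<subseteq> {0..T}) \<and>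
        (\<forall>i<n. \<forall>j<i. {a i<..<b i} \<inter> {a j<..<b j} = {}) \<and> (\<Sum>i<n. b i - a i) < e / B"
      have "(\<Sum>i<n. norm (y (b i) - y (a i))) \<le> (\<Sum>i<n. B * (b i - a i))"
        using H by (intro sum_mono lip) auto
      also have "\<dots> = B * (\<Sum>i<n. b i - a i)" by (simp add: sum_distrib_left)
      also have "\<dots> < e" using H B by (simp add: field_simps)
      finally show "(\<Sum>i<n. norm (y (b i) - y (a i))) < e" .
    qed
  qed
next
  let ?h = "\<lambda>t. f (y t) (u t)"
  have cy: "continuous_on {0..} y" and eq: "\<And>t. t \<ge> 0 \<Longrightarrow> y t = x + integral {0..t} ?h"
    using y by (auto simp: integral_solution_def)
  \<comment> \<open>Differentiation of the integral is available on bounded intervals. Countably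
    many of them exhaust the half-line, and for \<open>n\<close> beyond \<open>t\<close> the
    derivatives within \<open>{0..n}\<close> and within \<open>{0..}\<close> coincide.\<close>
  have "\<forall>n. \<exists>N. negligible N \<and> (\<forall>t\<in>{0..real n} - N.
    ((\<lambda>t. integral {0..t} ?h) has_vector_derivative ?h t) (at t within {0..real n}))"
    using u cy by (intro allI indefinite_integral_has_vector_derivative_ae rhs_integrable) auto
  from choice[OF this] obtain N where N': "\<forall>n. negligible (N n) \<and> (\<forall>t\<in>{0..real n} - N n.
    ((\<lambda>t. integral {0..t} ?h) has_vector_derivative ?h t) (at t within {0..real n}))" ..
  have N: "negligible (N n)" "t \<in> {0..real n} - N n \<Longrightarrow>
    ((\<lambda>t. integral {0..t} ?h) has_vector_derivative ?h t) (at t within {0..real n})" for n t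
    using N'[THEN spec, of n] by blast+
  have "negligible (\<Union>n. N n)" using N by (intro negligible_countable_Union) auto
  \<comment> \<open>The exceptional set is null for the completed measure, but completion does not
    change which statements hold almost everywhere.\<close>
  then have "AE t in completion lborel. t \<notin> (\<Union>n. N n)"
    by (intro AE_not_in) (simp add: negligible_iff_null_sets)
  then have "AE t in lborel. t \<notin> (\<Union>n. N n)" by (simp only: AE_completion_iff)
  then show "AE t in lborel. 0 \<le> t \<longrightarrow> (y has_vector_derivative ?h t) (at t within {0..})"
  proof (rule AE_mp, intro AE_I2 impI)
    fix t :: real assume t: "t \<notin> (\<Union>n. N n)" "0 \<le> t"
    obtain n where n: "t < real n" using reals_Archimedean2 by blast
    have "((\<lambda>t. integral {0..t} ?h) has_vector_derivative ?h t) (at t within {0..real n})"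
      using N(2)[of t n] t n by auto
    then have "((\<lambda>t. x + integral {0..t} ?h) has_vector_derivative ?h t) (at t within {0..real n})"
      by (auto intro!: derivative_eq_intros)
    then have "(y has_vector_derivative ?h t) (at t within {0..real n})"
      by (rule has_vector_derivative_transform[rotated 2]) (use t n eq in auto)
    moreover have "at t within {0..} = at t within {0..real n}"
      by (rule at_within_nhd[of t "{..<real n}"]) (use n in auto)
    ultimately show "(y has_vector_derivative ?h t) (at t within {0..})" by simp
  qed
qed

lemma is_solution_integral_solution:
  assumes y: "is_solution f u x y"
  shows "integral_solution u x y"
proof -
  let ?h = "\<lambda>t. f (y t) (u t)"
  have ac: "\<And>T. T \<ge> 0 \<Longrightarrow> absolutely_continuous_on {0..T} y" and y0: "y 0 = x"
    and AE: "AE t in lborel. 0 \<le> t \<longrightarrow> (y has_vector_derivative ?h t) (at t within {0..})"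
    using y by (auto simp: is_solution_def)
  from AE obtain N where N: "{t \<in> space lborel. \<not> (0 \<le> t \<longrightarrow> (y has_vector_derivative ?h t) (at t within {0..}))} \<subseteq> N"
    "emeasure lborel N = 0" "N \<in> sets lborel" by (rule AE_E)
  have N0: "negligible N"
    using N by (simp add: negligible_iff_null_sets null_sets_completionI null_setsI)
  have int: "(?h has_integral (y t - y s)) {s..t}" if st: "0 \<le> s" "s \<le> t" for s t
  proof (rule absolutely_continuous_fundamental_theorem[OF st(2) _ N0])
    show "absolutely_continuous_on {s..t} y"
      unfolding absolutely_continuous_on_def
    proof (intro allI impI)
      fix e :: real assume e: "e > 0"
      have "0 \<le> t" using st by simp
      from ac[OF this, unfolded absolutely_continuous_on_def, THEN spec, THEN mp, OF e]
      obtain d where d: "d > 0 \<and> (\<forall>(n::nat) a b. (\<forall>i<n. a i \<le> b i \<and> {a i..b i} \<subseteq> {0..t}) \<and>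
        (\<forall>i<n. \<forall>j<i. {a i<..<b i} \<inter> {a j<..<b j} = {}) \<and> (\<Sum>i<n. b i - a i) < d \<longrightarrow>
        (\<Sum>i<n. norm (y (b i) - y (a i))) < e)" ..
      show "\<exists>\<delta>>0. \<forall>(n::nat) a b. (\<forall>i<n. a i \<le> b i \<and> {a i..b i} \<subseteq> {s..t}) \<and>
        (\<forall>i<n. \<forall>j<i. {a i<..<b i} \<inter> {a j<..<b j} = {}) \<and> (\<Sum>i<n. b i - a i) < \<delta> \<longrightarrow>
        (\<Sum>i<n. norm (y (b i) - y (a i))) < e"
      proof (intro exI[of _ d] conjI allI impI)
        show "d > 0" using d ..
        fix n :: nat and a b :: "nat \<Rightarrow> real"
        assume H: "(\<forall>i<n. a i \<le> b i \<and> {a i..b i} \<subseteq> {s..t}) \<and>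
          (\<forall>i<n. \<forall>j<i. {a i<..<b i} \<inter> {a j<..<b j} = {}) \<and> (\<Sum>i<n. b i - a i) < d"
        have "{s..t} \<subseteq> {0..t}" using st by auto
        then have H1: "\<forall>i<n. a i \<le> b i \<and> {a i..b i} \<subseteq> {0..t}"
          using conjunct1[OF H] order_trans by metis
        show "(\<Sum>i<n. norm (y (b i) - y (a i))) < e"
          by (rule conjunct2[OF d, THEN spec, THEN spec, THEN spec, THEN mp, OF conjI[OF H1 conjunct2[OF H]]])
      qed
    qed
    fix r assume "r \<in> {s..t} - N"
    then have r: "r \<notin> N" "0 \<le> r" using st by auto
    have "(y has_vector_derivative ?h r) (at r within {0..})"
    proof (rule ccontr)
      assume "\<not> ?thesis"
      then have "r \<in> {t \<in> space lborel. \<not> (0 \<le> t \<longrightarrow> (y has_vector_derivative ?h t) (at t within {0..}))}"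
        using r by simp
      then show False using N(1) r by blast
    qed
    then show "(y has_vector_derivative ?h r) (at r within {s..t})"
      by (rule has_vector_derivative_within_subset) (use st in auto)
  qed
  have eq: "y t = x + integral {0..t} ?h" if "t \<ge> 0" for t
    using integral_unique[OF int[of 0 t]] that y0 by simp
  have "continuous_on {0..} y"
    unfolding continuous_on_eq_continuous_within
  proof
    fix t :: real assume t: "t \<in> {0..}"
    have "continuous_on {0..t+1} (\<lambda>t. x + integral {0..t} ?h)"
      using int[of 0 "t+1"] t by (intro continuous_intros indefinite_integral_continuous_1) auto
    then have "continuous_on {0..t+1} y"
      by (rule continuous_on_eq) (use eq in auto)
    then have "continuous (at t within {0..t+1}) y"
      using t by (simp add: continuous_on_eq_continuous_within)
    moreover have "at t within {0..} = at t within {0..t+1}"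
      by (rule at_within_nhd[of t "{..<t+1}"]) auto
    ultimately show "continuous (at t within {0..}) y" by simp
  qed
  then show ?thesis using eq by (simp add: integral_solution_def)
qed

text \<open>The weight \<open>exp (- K t)\<close> makes the Picard operator a contraction on the whole half-line at
  once, and makes solutions of linear growth bounded.\<close>

lemma ex_integral_solution:
  assumes u: "u \<in> controls U"
  shows "\<exists>y. integral_solution u x y"
proof -
  \<comment> \<open>The contraction factor will be \<open>lipc / K\<close>, at most one half; the
    summand 1 keeps \<open>K\<close> positive when \<open>lipc\<close> is zero.\<close>
  define K where "K = 2 * lipc + 1"
  have K: "K > 0" "lipc / K \<le> 1 / 2" using lipc(1) by (auto simp: K_def field_simps)
  have int_exp: "((\<lambda>r. exp (K * r)) has_integral (exp (K * s) - 1) / K) {0..s}" if "s \<ge> 0" for s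
  proof -
    have "((\<lambda>r. exp (K * r)) has_integral (exp (K * s) / K - exp (K * 0) / K)) {0..s}"
      using that K by (intro fundamental_theorem_of_calculus)
        (auto intro!: derivative_eq_intros simp flip: has_real_derivative_iff_has_vector_derivative)
    then show ?thesis by (simp add: diff_divide_distrib)
  qed
  \<comment> \<open>The unknown \<open>z\<close> is the discounted trajectory, and the factor
    \<open>exp (K * r)\<close> restores the state. \<open>P\<close> is the Picard operator in
    discounted form.\<close>
  define h where "h z r = f (exp (K * r) *\<^sub>R apply_bcontfun z r) (u r)" for z :: "real \<Rightarrow>\<^sub>C (real^'n)" and r
  define P where "P z s = exp (- K * s) *\<^sub>R (x + integral {0..s} (h z))" for z s
  have cz: "continuous_on {0..} (\<lambda>r. exp (K * r) *\<^sub>R apply_bcontfun z r)" for z :: "real \<Rightarrow>\<^sub>C (real^'n)"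
    by (intro continuous_intros) auto
  have int_h: "h z integrable_on {0..s}" for z s
    unfolding h_def by (intro rhs_integrable u cz) simp
  have P_bound: "norm (P z s) \<le> norm x + growc * (1 + norm z) / K" if s: "s \<ge> 0" for z s
  proof -
    have "norm (integral {0..s} (h z)) \<le> integral {0..s} (\<lambda>r. growc * (1 + norm z) * exp (K * r))"
    proof (rule Henstock_Kurzweil_Integration.integral_norm_bound_integral[OF int_h])
      show "(\<lambda>r. growc * (1 + norm z) * exp (K * r)) integrable_on {0..s}"
        by (intro integrable_continuous_real continuous_intros)
      fix r assume r: "r \<in> {0..s}"
      have "norm (h z r) \<le> growc * (1 + norm (exp (K * r) *\<^sub>R apply_bcontfun z r))"
        unfolding h_def using r u by (intro growc controls_in) auto
      also have "\<dots> \<le> growc * (exp (K * r) + exp (K * r) * norm z)"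
        using growc(1) r K norm_bounded[of z r] by (intro mult_left_mono add_mono) auto
      finally show "norm (h z r) \<le> growc * (1 + norm z) * exp (K * r)" by (simp add: algebra_simps)
    qed
    also have "\<dots> = growc * (1 + norm z) * ((exp (K * s) - 1) / K)"
      using int_exp[OF s] by (simp add: integral_unique)
    also have "\<dots> \<le> growc * (1 + norm z) * (exp (K * s) / K)"
      using growc(1) K by (intro mult_left_mono divide_right_mono) auto
    finally have *: "norm (integral {0..s} (h z)) \<le> growc * (1 + norm z) / K * exp (K * s)" by simp
    have "norm (P z s) \<le> exp (- K * s) * (norm x + norm (integral {0..s} (h z)))"
      unfolding P_def by (simp add: norm_triangle_ineq)
    also have "\<dots> \<le> exp (- K * s) * (norm x * exp (K * s) + growc * (1 + norm z) / K * exp (K * s))"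
    proof (intro mult_left_mono add_mono *)
      show "norm x \<le> norm x * exp (K * s)" using s K by (simp add: mult_le_cancel_left1)
    qed simp
    also have "\<dots> = norm x + growc * (1 + norm z) / K"
      by (simp add: exp_minus field_simps)
    finally show ?thesis .
  qed
  have contP: "continuous_on UNIV (\<lambda>t. P z (max 0 t))" for z
  proof -
    have c1: "continuous_on {0..} (P z)"
      unfolding continuous_on_eq_continuous_within
    proof
      fix t :: real assume t: "t \<in> {0..}"
      have "continuous_on {0..t+1} (P z)"
        unfolding P_def by (intro continuous_intros indefinite_integral_continuous_1 int_h)
      then have "continuous (at t within {0..t+1}) (P z)"
        using t by (simp add: continuous_on_eq_continuous_within)
      moreover have "at t within {0..} = at t within {0..t+1}"
        by (rule at_within_nhd[of t "{..<t+1}"]) auto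
      ultimately show "continuous (at t within {0..}) (P z)" by simp
    qed
    have "(\<lambda>t. max 0 t) ` UNIV \<subseteq> {0::real..}" by auto
    moreover have "continuous_on UNIV (\<lambda>t::real. max 0 t)" by (intro continuous_intros)
    ultimately show ?thesis using continuous_on_compose2[OF c1] by blast
  qed
  \<comment> \<open>Bounded continuous functions form a complete space on the whole line, so the
    half-line operator is extended by its value at 0.\<close>
  define Q where "Q z = Bcontfun (\<lambda>t. P z (max 0 t))" for z
  have Q: "apply_bcontfun (Q z) t = P z (max 0 t)" for z t
    unfolding Q_def
  proof (subst Bcontfun_inverse)
    have "norm (P z (max 0 t)) \<le> norm x + growc * (1 + norm z) / K" for t
      by (rule P_bound) simp
    then show "(\<lambda>t. P z (max 0 t)) \<in> bcontfun" by (rule bcontfun_normI[OF contP])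
  qed simp
  have "\<exists>!z. Q z = z"
  proof (rule banach_fix_type[of "1/2"])
    show "\<forall>z z'. dist (Q z) (Q z') \<le> 1 / 2 * dist z z'"
    proof (intro allI dist_bound)
      fix z z' and t :: real
      define s where "s = max 0 t"
      have s: "s \<ge> 0" by (simp add: s_def)
      have "P z s - P z' s = exp (- K * s) *\<^sub>R integral {0..s} (\<lambda>r. h z r - h z' r)"
        unfolding P_def by (simp add: Henstock_Kurzweil_Integration.integral_diff[OF int_h int_h] algebra_simps)
      then have "norm (P z s - P z' s) = exp (- K * s) * norm (integral {0..s} (\<lambda>r. h z r - h z' r))" by simp
      also have "norm (integral {0..s} (\<lambda>r. h z r - h z' r)) \<le> integral {0..s} (\<lambda>r. lipc * dist z z' * exp (K * r))"
      proof (rule Henstock_Kurzweil_Integration.integral_norm_bound_integral)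
        show "(\<lambda>r. h z r - h z' r) integrable_on {0..s}" by (intro integrable_diff int_h)
        show "(\<lambda>r. lipc * dist z z' * exp (K * r)) integrable_on {0..s}"
          by (intro integrable_continuous_real continuous_intros)
        fix r assume r: "r \<in> {0..s}"
        have "norm (h z r - h z' r) \<le> lipc * norm (exp (K * r) *\<^sub>R apply_bcontfun z r - exp (K * r) *\<^sub>R apply_bcontfun z' r)"
          unfolding h_def using r u by (intro lipc controls_in) auto
        also have "\<dots> = lipc * (exp (K * r) * dist (apply_bcontfun z r) (apply_bcontfun z' r))"
          by (simp add: dist_norm flip: scaleR_diff_right)
        also have "\<dots> \<le> lipc * (exp (K * r) * dist z z')"
          using lipc(1) by (intro mult_left_mono dist_bounded) auto
        finally show "norm (h z r - h z' r) \<le> lipc * dist z z' * exp (K * r)" by (simp add: algebra_simps)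
      qed
      also have "\<dots> = lipc * dist z z' * ((exp (K * s) - 1) / K)"
        using int_exp[OF s] by (simp add: integral_unique)
      also have "\<dots> \<le> lipc * dist z z' * (exp (K * s) / K)"
        using lipc(1) K by (intro mult_left_mono divide_right_mono) auto
      finally have "norm (P z s - P z' s) \<le> exp (- K * s) * (lipc * dist z z' * (exp (K * s) / K))" by simp
      also have "\<dots> = lipc / K * dist z z'" by (simp add: exp_minus field_simps)
      also have "\<dots> \<le> 1 / 2 * dist z z'" using K by (intro mult_right_mono) auto
      finally show "dist (apply_bcontfun (Q z) t) (apply_bcontfun (Q z') t) \<le> 1 / 2 * dist z z'"
        by (simp add: Q dist_norm s_def)
    qed
  qed auto
  then obtain z where z: "Q z = z" by blast
  have "exp (K * t) *\<^sub>R apply_bcontfun z t = x + integral {0..t} (h z)" if "t \<ge> 0" for t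
  proof -
    have "apply_bcontfun z t = P z t" using Q[of z t] z that by simp
    then show ?thesis by (simp add: P_def exp_minus)
  qed
  then have "integral_solution u x (\<lambda>t. exp (K * t) *\<^sub>R apply_bcontfun z t)"
    unfolding integral_solution_def using cz by (auto simp: h_def[abs_def])
  then show ?thesis by blast
qed

section \<open>Flow properties: uniqueness, causality, shifts and concatenation\<close>

abbreviation traj :: "(real \<Rightarrow> 'u) \<Rightarrow> real^'n \<Rightarrow> real \<Rightarrow> real^'n" where
  "traj \<equiv> trajectory f"

lemma traj_integral_solution:
  assumes u: "u \<in> controls U"
  shows "integral_solution u x (traj u x)"
proof -
  obtain y where "is_solution f u x y"
    using ex_integral_solution[OF u] integral_solution_is_solution[OF _ u] by blast
  then have "is_solution f u x (traj u x)" unfolding trajectory_def by (rule someI[of "is_solution f u x"])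
  then show ?thesis by (rule is_solution_integral_solution)
qed

lemma traj_unique:
  assumes "integral_solution u x y" "u \<in> controls U" "t \<ge> 0"
  shows "traj u x t = y t"
  using integral_solution_comparison[OF traj_integral_solution[OF assms(2), of x] assms(1,2,2), of t t] assms(3)
  by simp

lemma traj_0: "u \<in> controls U \<Longrightarrow> traj u x 0 = x"
  using traj_integral_solution[of u x] by (simp add: integral_solution_def)

lemma traj_continuous: "u \<in> controls U \<Longrightarrow> continuous_on {0..} (traj u x)"
  using traj_integral_solution[of u x] by (simp add: integral_solution_def)

lemma traj_comparison:
  assumes "u \<in> controls U" "v \<in> controls U" "\<And>t. t \<in> {0..<T} \<Longrightarrow> u t = v t" "t \<in> {0..T}"
  shows "norm (traj u x t - traj v x' t) \<le> norm (x - x') * exp (lipc * t)"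
  using assms by (intro integral_solution_comparison[OF traj_integral_solution traj_integral_solution]) auto

lemma traj_causal:
  assumes "u \<in> controls U" "v \<in> controls U" "\<And>t. t \<in> {0..<T} \<Longrightarrow> u t = v t" "t \<in> {0..T}"
  shows "traj u x t = traj v x t"
  using traj_comparison[OF assms, of x x] by simp

lemma traj_continuous_initial:
  assumes u: "u \<in> controls U" and t: "t \<ge> 0"
  shows "continuous_on UNIV (\<lambda>x. traj u x t)"
proof (rule lipschitz_on_continuous_on)
  show "(exp (lipc * t))-lipschitz_on UNIV (\<lambda>x. traj u x t)"
  proof (rule lipschitz_onI)
    show "dist (traj u x t) (traj u x' t) \<le> exp (lipc * t) * dist x x'" for x x'
      using traj_comparison[OF u u, of t t x x'] t by (simp add: dist_norm mult.commute)
  qed simp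
qed

lemma shift_control:
  assumes "u \<in> controls U" "s \<ge> 0"
  shows "(\<lambda>r. u (s + r)) \<in> controls U"
proof -
  have "(\<lambda>r. s + r) \<in> nonneg_borel \<rightarrow>\<^sub>M nonneg_borel"
    using assms by (intro measurable_restrict_space2 measurable_restrict_space1) (auto simp: space_restrict_space)
  from measurable_compose[OF this, of u "restrict_space borel U"] show ?thesis
    using assms by (simp add: controls_def)
qed

lemma traj_shift:
  assumes u: "u \<in> controls U" and s: "s \<ge> 0" and t: "t \<ge> 0"
  shows "traj u x (s + t) = traj (\<lambda>r. u (s + r)) (traj u x s) t"
proof -
  let ?y = "traj u x"
  have c: "continuous_on {0..} ?y" by (rule traj_continuous[OF u])
  have "integral_solution (\<lambda>r. u (s + r)) (?y s) (\<lambda>r. ?y (s + r))"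
    unfolding integral_solution_def
  proof (intro conjI allI impI)
    show "continuous_on {0..} (\<lambda>r. ?y (s + r))"
      by (rule continuous_on_compose2[OF c]) (use s in \<open>auto intro!: continuous_intros\<close>)
    fix r :: real assume r: "r \<ge> 0"
    have "?y (s + r) - ?y s = integral {s..s + r} (\<lambda>r. f (?y r) (u r))"
      using u s r by (intro integral_solution_diff[OF traj_integral_solution]) auto
    also have "\<dots> = integral {0..r} (\<lambda>r. f (?y (s + r)) (u (s + r)))"
      using integral_shift_Icc_real[of 0 r "\<lambda>r. f (?y r) (u r)" s] by (simp add: o_def add.commute)
    finally show "?y (s + r) = ?y s + integral {0..r} (\<lambda>r. f (?y (s + r)) (u (s + r)))"
      by (simp add: algebra_simps)
  qed
  from traj_unique[OF this shift_control[OF u s] t] show ?thesis by simp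
qed

definition concat_control :: "real \<Rightarrow> (real \<Rightarrow> 'u) \<Rightarrow> (real \<Rightarrow> 'u) \<Rightarrow> real \<Rightarrow> 'u" where
  "concat_control s u v t = (if t < s then u t else v (t - s))"

lemma concat_control:
  assumes u: "u \<in> controls U" and v: "v \<in> controls U"
  shows "concat_control s u v \<in> controls U"
proof -
  \<comment> \<open>Both branches must be measurable on the whole half-line, whereas
    \<open>v\<close> is a control on nonnegative times only; \<open>max 0\<close> changes no value
    that is used.\<close>
  have "(\<lambda>t. if t < s then u t else v (max 0 (t - s))) \<in> nonneg_borel \<rightarrow>\<^sub>M restrict_space borel U"
  proof (rule measurable_If)
    show "u \<in> nonneg_borel \<rightarrow>\<^sub>M restrict_space borel U" using u by (simp add: controls_def)
    have "(\<lambda>t. max 0 (t - s)) \<in> nonneg_borel \<rightarrow>\<^sub>M nonneg_borel"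
      by (intro measurable_restrict_space2 measurable_restrict_space1) auto
    then show "(\<lambda>t. v (max 0 (t - s))) \<in> nonneg_borel \<rightarrow>\<^sub>M restrict_space borel U"
      by (rule measurable_compose) (use v in \<open>simp add: controls_def\<close>)
    show "{x \<in> space nonneg_borel. x < s} \<in> sets nonneg_borel"
      unfolding sets_restrict_space
      by (rule image_eqI[of _ _ "{..<s}"]) (simp_all add: space_restrict_space set_eq_iff)
  qed
  also have "(\<lambda>t. if t < s then u t else v (max 0 (t - s))) = concat_control s u v"
    by (rule ext) (simp add: concat_control_def max_def)
  finally show ?thesis by (simp add: controls_def)
qed

lemma traj_concat_before:
  assumes "u \<in> controls U" "v \<in> controls U" "t \<in> {0..s}"
  shows "traj (concat_control s u v) x t = traj u x t"
  using assms by (intro traj_causal[of _ _ s] concat_control) (auto simp: concat_control_def)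

lemma traj_concat_after:
  assumes u: "u \<in> controls U" and v: "v \<in> controls U" and s: "s \<ge> 0" and t: "t \<ge> 0"
  shows "traj (concat_control s u v) x (s + t) = traj v (traj u x s) t"
proof -
  have c: "concat_control s u v \<in> controls U" using u v by (rule concat_control)
  have "traj (concat_control s u v) x (s + t) = traj (\<lambda>r. concat_control s u v (s + r)) (traj (concat_control s u v) x s) t"
    by (rule traj_shift[OF c s t])
  also have "traj (concat_control s u v) x s = traj u x s"
    using u v s by (intro traj_concat_before) auto
  also have "traj (\<lambda>r. concat_control s u v (s + r)) (traj u x s) t = traj v (traj u x s) t"
    by (rule traj_causal[OF shift_control[OF c s] v, of t]) (use t in \<open>auto simp: concat_control_def\<close>)
  finally show ?thesis .
qed

end

section \<open>Tracking a trajectory by extremal aiming\<close>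

text \<open>Comparison with the telescoping differences of 1/k. This bound is what keeps the
  accumulated tracking error finite over infinite time.\<close>

lemma sum_inverse_squares_le: "(\<Sum>i<k. (inverse (real (Suc i)))\<^sup>2) \<le> 2"
proof -
  have "(\<Sum>i<Suc k. (inverse (real (Suc i)))\<^sup>2) \<le> 2 - inverse (real (Suc k))" for k
  proof (induction k)
    case (Suc k)
    have "(inverse (real (Suc (Suc k))))\<^sup>2 \<le> inverse (real (Suc k)) - inverse (real (Suc (Suc k)))"
      by (simp add: field_simps power2_eq_square) (intro divide_left_mono, auto intro!: add_pos_nonneg mult_pos_pos)
    then show ?case using Suc.IH by simp
  qed simp
  from this[of k] have "(\<Sum>i<Suc k. (inverse (real (Suc i)))\<^sup>2) \<le> 2"
    by (rule order_trans) simp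
  then show ?thesis by (rule order_trans[rotated]) simp
qed

locale nonexpansive_control = ode_control U f g
  for U :: "'u::{metric_space,second_countable_topology} set"
    and f :: "real^'n \<Rightarrow> 'u \<Rightarrow> real^'n"
    and g :: "real^'n \<Rightarrow> 'u \<Rightarrow> real" +
  fixes Y :: "(real^'n) set"
  assumes nonexpansive: "compact_nonexpansive U f g Y"
begin

section \<open>Consequences of compactness and of condition (iii)\<close>

lemma compact_Y: "compact Y"
  and traj_in_Y: "x \<in> Y \<Longrightarrow> u \<in> controls U \<Longrightarrow> t \<ge> 0 \<Longrightarrow> traj u x t \<in> Y"
  using nonexpansive unfolding compact_nonexpansive_def by blast+

lemma ex_bound: "\<exists>B. B > 0 \<and> (\<forall>y\<in>Y. \<forall>u\<in>U. norm (f y u) \<le> B) \<and> (\<forall>x\<in>Y. \<forall>z\<in>Y. norm (x - z) \<le> B)"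
proof -
  obtain R where R: "\<And>y. y \<in> Y \<Longrightarrow> norm y \<le> R" using compact_Y by (meson compact_imp_bounded bounded_iff)
  define B where "B = \<bar>growc * (1 + R)\<bar> + 2 * \<bar>R\<bar> + 1"
  have "norm (f y u) \<le> B" if "y \<in> Y" "u \<in> U" for y u
  proof -
    have "norm (f y u) \<le> growc * (1 + norm y)" using that growc by blast
    also have "\<dots> \<le> growc * (1 + R)" using R[OF that(1)] growc(1) by (intro mult_left_mono) auto
    finally show ?thesis by (simp add: B_def)
  qed
  moreover have "norm (x - z) \<le> B" if "x \<in> Y" "z \<in> Y" for x z
    using norm_triangle_ineq4[of x z] R[OF that(1)] R[OF that(2)] by (simp add: B_def)
  moreover have "B > 0" by (simp add: B_def)
  ultimately show ?thesis by blast
qed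

definition size_bd :: real where
  "size_bd = (SOME B. B > 0 \<and> (\<forall>y\<in>Y. \<forall>u\<in>U. norm (f y u) \<le> B) \<and> (\<forall>x\<in>Y. \<forall>z\<in>Y. norm (x - z) \<le> B))"

lemma size_bd: "size_bd > 0" "y \<in> Y \<Longrightarrow> u \<in> U \<Longrightarrow> norm (f y u) \<le> size_bd" "x \<in> Y \<Longrightarrow> z \<in> Y \<Longrightarrow> norm (x - z) \<le> size_bd"
  using someI_ex[OF ex_bound] unfolding size_bd_def[symmetric] by auto

text \<open>The growth bound makes the families bounded, so that the real supremum and infimum in
  condition (iii) have their usual meaning. The infimum may fail to be attained because
  \<open>f\<close> is only Borel in the control, hence the slack \<open>e\<close>.\<close>

lemma nonexpansive_choice:
  assumes a: "a \<in> U" and e: "e > 0"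
  shows "\<exists>b\<in>U. (y1 - y2) \<bullet> (f y1 a - f y2 b) < e"
proof -
  define C where "C = norm (y1 - y2) * (growc * (1 + norm y1) + growc * (1 + norm y2))"
  have C: "\<bar>(y1 - y2) \<bullet> (f y1 a - f y2 b)\<bar> \<le> C" if "a \<in> U" "b \<in> U" for a b
  proof -
    have "\<bar>(y1 - y2) \<bullet> (f y1 a - f y2 b)\<bar> \<le> norm (y1 - y2) * norm (f y1 a - f y2 b)"
      by (rule Cauchy_Schwarz_ineq2)
    also have "norm (f y1 a - f y2 b) \<le> growc * (1 + norm y1) + growc * (1 + norm y2)"
      using norm_triangle_ineq4[of "f y1 a" "f y2 b"] growc(2)[OF that(1), of y1] growc(2)[OF that(2), of y2] by linarith
    finally show ?thesis by (simp add: C_def mult_left_mono)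
  qed
  have bb: "bdd_below ((\<lambda>b. (y1 - y2) \<bullet> (f y1 a - f y2 b)) ` U)" if "a \<in> U" for a
  proof (rule bdd_belowI2)
    fix b assume "b \<in> U"
    from C[OF that this] show "- C \<le> (y1 - y2) \<bullet> (f y1 a - f y2 b)" by linarith
  qed
  have "bdd_above ((\<lambda>a. INF b\<in>U. (y1 - y2) \<bullet> (f y1 a - f y2 b)) ` U)"
  proof (rule bdd_aboveI2)
    fix a' assume a': "a' \<in> U"
    have "(INF b\<in>U. (y1 - y2) \<bullet> (f y1 a' - f y2 b)) \<le> (y1 - y2) \<bullet> (f y1 a' - f y2 a)"
      by (rule cINF_lower[OF bb[OF a'] a])
    also have "\<dots> \<le> C" using C[OF a' a] by simp
    finally show "(INF b\<in>U. (y1 - y2) \<bullet> (f y1 a' - f y2 b)) \<le> C" .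
  qed
  then have "(INF b\<in>U. (y1 - y2) \<bullet> (f y1 a - f y2 b)) \<le> (SUP a\<in>U. INF b\<in>U. (y1 - y2) \<bullet> (f y1 a - f y2 b))"
    by (rule cSUP_upper[OF a])
  also have "\<dots> \<le> 0" using nonexpansive unfolding compact_nonexpansive_def by blast
  finally have "(INF b\<in>U. (y1 - y2) \<bullet> (f y1 a - f y2 b)) < e" using e by simp
  then show ?thesis using cINF_less_iff[OF _ bb[OF a]] a by blast
qed

text \<open>Since \<open>f\<close> need not be continuous in the control, the net is built on
  velocities instead of on \<open>U\<close>. Velocities at the points of a finite net of
  \<open>Y\<close> are rounded to a finite set, one control is kept for each rounded profile, and
  the Lipschitz bound extends the estimate to all of \<open>Y\<close>.\<close>

lemma finite_control_net:
  assumes e: "e > 0"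
  shows "\<exists>V. finite V \<and> V \<subseteq> U \<and> (\<forall>x\<in>Y. \<forall>u\<in>U. \<exists>b\<in>V. norm (f x u - f x b) \<le> e)"
proof -
  \<comment> \<open>Four errors of size \<open>e / 4\<close> arise: moving from \<open>x\<close> to
    the net point and back, and rounding the velocities of the two controls. This radius takes care
    of the two moves.\<close>
  define r where "r = e / (4 * (lipc + 1))"
  have r: "r > 0" using e lipc(1) by (simp add: r_def)
  obtain Z where Z: "finite Z" "Z \<subseteq> Y" "Y \<subseteq> (\<Union>z\<in>Z. ball z r)"
    using compactE_image[OF compact_Y, of Y "\<lambda>z. ball z r"] r by (metis centre_in_ball open_ball UN_I subsetI)
  have "compact (cball (0::real^'n) size_bd)" by (rule compact_cball)
  then obtain P where P: "finite P" "cball (0::real^'n) size_bd \<subseteq> (\<Union>p\<in>P. ball p (e / 4))"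
    using compactE_image[of "cball (0::real^'n) size_bd" UNIV "\<lambda>z. ball z (e/4)"] e
    by (metis (no_types, lifting) UNIV_I UN_I centre_in_ball divide_pos_pos open_ball subsetI zero_less_numeral)
  have "\<exists>p\<in>P. dist p (f z u) < e / 4" if "z \<in> Z" "u \<in> U" for z u
  proof -
    have "f z u \<in> cball 0 size_bd" using size_bd(2) that Z(2) by auto
    then have "f z u \<in> (\<Union>p\<in>P. ball p (e / 4))" using P(2) by blast
    then show ?thesis by (simp only: UN_iff mem_ball)
  qed
  then obtain c where c: "\<And>z u. z \<in> Z \<Longrightarrow> u \<in> U \<Longrightarrow> c z u \<in> P" "\<And>z u. z \<in> Z \<Longrightarrow> u \<in> U \<Longrightarrow> dist (c z u) (f z u) < e / 4"
    by metis
  \<comment> \<open>The rounded velocity profile of \<open>u\<close> over the net;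
    \<open>rep\<close> picks one control for each profile that occurs.\<close>
  define k where "k u = restrict (\<lambda>z. c z u) Z" for u
  have "k ` U \<subseteq> Z \<rightarrow>\<^sub>E P" using c(1) by (auto simp: k_def)
  moreover have "finite (Z \<rightarrow>\<^sub>E P)" using Z(1) P(1) by (intro finite_PiE) auto
  ultimately have fin: "finite (k ` U)" by (rule finite_subset)
  define rep where "rep w = (SOME u. u \<in> U \<and> k u = w)" for w
  have rep: "rep (k u) \<in> U" "k (rep (k u)) = k u" if "u \<in> U" for u
    using someI[of "\<lambda>v. v \<in> U \<and> k v = k u" u] that by (auto simp: rep_def)
  show ?thesis
  proof (intro exI[of _ "rep ` k ` U"] conjI ballI)
    show "finite (rep ` k ` U)" using fin by simp
    show "rep ` k ` U \<subseteq> U" using rep by auto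
    fix x u assume x: "x \<in> Y" and u: "u \<in> U"
    obtain z where z: "z \<in> Z" "dist z x < r" using Z(3) x by auto
    let ?b = "rep (k u)"
    have b: "?b \<in> U" "k ?b = k u" using rep[OF u] by auto
    have "c z ?b = c z u" using b(2) z(1) by (auto simp: k_def dest: fun_cong[of _ _ z])
    then have "dist (f z u) (f z ?b) < e / 4 + e / 4"
      using c(2)[OF z(1) u] c(2)[OF z(1) b(1)] by (intro dist_triangle_less_add[of _ "c z u"]) (auto simp: dist_commute)
    moreover have "norm (f x u - f z u) \<le> e / 4" "norm (f z ?b - f x ?b) \<le> e / 4"
    proof -
      have *: "lipc * norm (x - z) \<le> e / 4" "lipc * norm (z - x) \<le> e / 4"
      proof -
        have "lipc * norm (x - z) \<le> (lipc + 1) * r"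
          using z lipc(1) by (intro mult_mono) (auto simp: dist_norm norm_minus_commute)
        also have "\<dots> = e / 4" using lipc(1) by (simp add: r_def field_simps)
        finally show "lipc * norm (x - z) \<le> e / 4" .
        then show "lipc * norm (z - x) \<le> e / 4" by (simp add: norm_minus_commute)
      qed
      show "norm (f x u - f z u) \<le> e / 4" "norm (f z ?b - f x ?b) \<le> e / 4"
        using lipc(2)[OF u, of x z] lipc(2)[OF b(1), of z x] * by linarith+
    qed
    moreover have "norm (f x u - f x ?b) \<le> norm (f x u - f z u) + norm (f z u - f z ?b) + norm (f z ?b - f x ?b)"
      using norm_triangle_ineq[of "f x u - f z u" "f z u - f z ?b"]
        norm_triangle_ineq[of "f x u - f z u + (f z u - f z ?b)" "f z ?b - f x ?b"] by simp
    ultimately have "norm (f x u - f x ?b) \<le> e" by (simp add: dist_norm)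
    then show "\<exists>b\<in>rep ` k ` U. norm (f x u - f x b) \<le> e" using u by blast
  qed
qed

lemma traj_lipschitz:
  assumes "x \<in> Y" "u \<in> controls U" "0 \<le> s" "s \<le> t"
  shows "norm (traj u x t - traj u x s) \<le> size_bd * (t - s)"
proof -
  have "traj u x t - traj u x s = integral {s..t} (\<lambda>r. f (traj u x r) (u r))"
    using assms by (intro integral_solution_diff[OF traj_integral_solution]) auto
  also have "norm \<dots> \<le> integral {s..t} (\<lambda>_. size_bd)"
    using assms by (intro Henstock_Kurzweil_Integration.integral_norm_bound_integral rhs_integrable traj_continuous)
      (auto intro!: size_bd(2) traj_in_Y controls_in)
  also have "\<dots> = size_bd * (t - s)" using assms by simp
  finally show ?thesis .
qed

text \<open>Collects the second-order terms of one step: \<open>4 * size_bd\<^sup>2\<close> from the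
  square of the relative displacement, and \<open>lipc\<close> times as much from freezing the
  velocities at the starting states.\<close>

definition step_error :: real where "step_error = 4 * size_bd\<^sup>2 * (lipc + 1)"

lemma step_error_nonneg: "step_error \<ge> 0"
  using lipc(1) by (simp add: step_error_def)

text \<open>The control \<open>b\<close> has to beat every \<open>a\<close> at the frozen pair \<open>(x, z)\<close> only, so it may be
  chosen without knowing the control \<open>u\<close> of the other trajectory.\<close>

lemma aiming_step:
  assumes x: "x \<in> Y" and z: "z \<in> Y" and u: "u \<in> controls U" and b: "b \<in> U"
    and aim: "\<And>a. a \<in> U \<Longrightarrow> (x - z) \<bullet> (f x b - f z a) \<le> e"
    and t: "0 \<le> t" "t \<le> h"
  shows "(norm (traj (\<lambda>_. b) x t - traj u z t))\<^sup>2 \<le> (norm (x - z))\<^sup>2 + t * (2 * e + step_error * h)"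
proof -
  let ?X = "traj (\<lambda>_. b) x" and ?Z = "traj u z"
  have bc: "(\<lambda>_. b) \<in> controls U" by (rule const_control[OF b])
  define d where "d s = f (?X s) b - f (?Z s) (u s)" for s
  have iX: "(\<lambda>s. f (?X s) b) integrable_on {0..t}"
    using rhs_integrable[OF bc traj_continuous[OF bc]] by simp
  have iZ: "(\<lambda>s. f (?Z s) (u s)) integrable_on {0..t}"
    by (rule rhs_integrable[OF u traj_continuous[OF u]]) simp
  have id: "d integrable_on {0..t}" unfolding d_def by (rule integrable_diff[OF iX iZ])
  have eq: "?X t - ?Z t = (x - z) + integral {0..t} d"
    using traj_integral_solution[OF bc, of x] traj_integral_solution[OF u, of z] t
    unfolding integral_solution_def d_def
    by (simp add: Henstock_Kurzweil_Integration.integral_diff[OF iX iZ])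
  have "norm (integral {0..t} d) \<le> integral {0..t} (\<lambda>_. 2 * size_bd)"
  proof (rule Henstock_Kurzweil_Integration.integral_norm_bound_integral[OF id])
    fix s assume s: "s \<in> {0..t}"
    have "norm (f (?X s) b) \<le> size_bd" "norm (f (?Z s) (u s)) \<le> size_bd"
      using s x z bc u b by (auto intro!: size_bd(2) traj_in_Y controls_in)
    then show "norm (d s) \<le> 2 * size_bd" unfolding d_def using norm_triangle_ineq4[of "f (?X s) b" "f (?Z s) (u s)"] by linarith
  qed (intro integrable_const_ivl)
  then have n1: "norm (integral {0..t} d) \<le> 2 * size_bd * t" using t by (simp add: mult_ac)
  have "(x - z) \<bullet> integral {0..t} d = integral {0..t} (\<lambda>s. (x - z) \<bullet> d s)"
    using integral_linear[OF id bounded_linear_inner_right[of "x - z"]] by (simp add: o_def)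
  also have "\<dots> \<le> integral {0..t} (\<lambda>_. e + size_bd * (lipc * (2 * size_bd * h)))"
  proof (rule integral_le)
    show "(\<lambda>s. (x - z) \<bullet> d s) integrable_on {0..t}"
      using integrable_linear[OF id bounded_linear_inner_right[of "x - z"]] by (simp add: o_def)
    fix s assume s: "s \<in> {0..t}"
    then have us: "u s \<in> U" using u by (intro controls_in) auto
    have "d s = (f x b - f z (u s)) + ((f (?X s) b - f x b) + (f z (u s) - f (?Z s) (u s)))"
      by (simp add: d_def)
    then have "(x - z) \<bullet> d s = (x - z) \<bullet> (f x b - f z (u s)) + (x - z) \<bullet> ((f (?X s) b - f x b) + (f z (u s) - f (?Z s) (u s)))"
      by (simp only: inner_add_right)
    also have "\<dots> \<le> e + norm (x - z) * norm ((f (?X s) b - f x b) + (f z (u s) - f (?Z s) (u s)))"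
      by (intro add_mono aim us norm_cauchy_schwarz)
    also have "\<dots> \<le> e + size_bd * (lipc * (2 * size_bd * h))"
    proof (intro add_left_mono mult_mono size_bd(3) x z)
      have "norm (?X s - x) \<le> size_bd * s" "norm (z - ?Z s) \<le> size_bd * s"
        using traj_lipschitz[OF x bc, of 0 s] traj_lipschitz[OF z u, of 0 s] s bc u
        by (auto simp: traj_0 norm_minus_commute)
      moreover have "size_bd * s \<le> size_bd * h" using s t size_bd(1) by (intro mult_left_mono) auto
      ultimately have "norm (?X s - x) \<le> size_bd * h" "norm (z - ?Z s) \<le> size_bd * h" by auto
      then have "lipc * norm (?X s - x) \<le> lipc * (size_bd * h)" "lipc * norm (z - ?Z s) \<le> lipc * (size_bd * h)"
        using lipc(1) by (auto intro: mult_left_mono)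
      then have "norm (f (?X s) b - f x b) \<le> lipc * (size_bd * h)" "norm (f z (u s) - f (?Z s) (u s)) \<le> lipc * (size_bd * h)"
        using lipc(2)[OF b, of "?X s" x] lipc(2)[OF us, of z "?Z s"] by linarith+
      then show "norm ((f (?X s) b - f x b) + (f z (u s) - f (?Z s) (u s))) \<le> lipc * (2 * size_bd * h)"
        using norm_triangle_ineq[of "f (?X s) b - f x b" "f z (u s) - f (?Z s) (u s)"] by (simp add: algebra_simps)
    qed (use size_bd(1) in auto)
    finally show "(x - z) \<bullet> d s \<le> e + size_bd * (lipc * (2 * size_bd * h))" .
  qed (intro integrable_const_ivl)
  also have "\<dots> = t * (e + 2 * lipc * size_bd\<^sup>2 * h)" using t by (simp add: power2_eq_square)
  finally have n2: "(x - z) \<bullet> integral {0..t} d \<le> t * (e + 2 * lipc * size_bd\<^sup>2 * h)" .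
  have "(norm (integral {0..t} d))\<^sup>2 \<le> (2 * size_bd * t)\<^sup>2"
    using n1 by (intro power_mono) auto
  also have "\<dots> = t * (4 * size_bd\<^sup>2 * t)" by (simp add: power2_eq_square)
  also have "\<dots> \<le> t * (4 * size_bd\<^sup>2 * h)" using t by (intro mult_left_mono) auto
  finally have n3: "(norm (integral {0..t} d))\<^sup>2 \<le> t * (4 * size_bd\<^sup>2 * h)" .
  have "(norm (?X t - ?Z t))\<^sup>2 = (norm (x - z))\<^sup>2 + 2 * ((x - z) \<bullet> integral {0..t} d) + (norm (integral {0..t} d))\<^sup>2"
    unfolding eq by (simp add: power2_norm_eq_inner inner_add_left inner_add_right inner_commute)
  also have "\<dots> \<le> (norm (x - z))\<^sup>2 + 2 * (t * (e + 2 * lipc * size_bd\<^sup>2 * h)) + t * (4 * size_bd\<^sup>2 * h)"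
    using n2 n3 by linarith
  also have "\<dots> = (norm (x - z))\<^sup>2 + t * (2 * e + step_error * h)"
    by (simp add: step_error_def algebra_simps)
  finally show ?thesis .
qed

end

text \<open>At step \<open>k\<close> only the first \<open>n k\<close> controls of
  \<open>menu k\<close> are on offer. The accuracy is divided by \<open>size_bd\<close> because it
  will be multiplied by a distance of two states, which leaves exactly one step length.\<close>

locale tracking = nonexpansive_control U f g Y
  for U :: "'u::{metric_space,second_countable_topology} set"
    and f :: "real^'n \<Rightarrow> 'u \<Rightarrow> real^'n"
    and g :: "real^'n \<Rightarrow> 'u \<Rightarrow> real"
    and Y :: "(real^'n) set" +
  fixes c :: real and menu :: "nat \<Rightarrow> nat \<Rightarrow> 'u" and n :: "nat \<Rightarrow> nat"
  assumes c_pos: "c > 0" and n_pos: "n k > 0" and menu_in: "menu k i \<in> U"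
    and net: "x \<in> Y \<Longrightarrow> u \<in> U \<Longrightarrow>
      \<exists>i<n k. norm (f x u - f x (menu k i)) \<le> c * inverse (real (Suc k)) / size_bd"
begin

section \<open>The harmonic time grid and the controls coded by digit sequences\<close>

definition step_len :: "nat \<Rightarrow> real" where "step_len k = c * inverse (real (Suc k))"

text \<open>Harmonic numbers tend to infinity, so the grid covers the half-line although the steps
  shrink enough to be square summable.\<close>

definition grid :: "nat \<Rightarrow> real" where "grid k = c * harm k"

lemma step_len_pos: "step_len k > 0"
  using c_pos by (simp add: step_len_def)

lemma grid_0 [simp]: "grid 0 = 0"
  by (simp add: grid_def harm_def)

lemma grid_Suc: "grid (Suc k) = grid k + step_len k"
  by (simp add: grid_def step_len_def harm_Suc algebra_simps)

lemma grid_mono: "i \<le> k \<Longrightarrow> grid i \<le> grid k"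
  unfolding grid_def using c_pos by (intro mult_left_mono harm_mono) auto

lemma grid_nonneg: "grid k \<ge> 0"
  using grid_mono[of 0 k] by simp

lemma grid_unbounded: "\<exists>k. t < grid k"
proof -
  have "eventually (\<lambda>k. harm k > t / c) sequentially"
    using harm_at_top by (rule filterlim_at_top_dense[THEN iffD1, rule_format])
  then obtain k where "harm k > t / c" by (meson eventually_sequentially order_refl)
  then have "t < grid k" using c_pos by (simp add: grid_def field_simps)
  then show ?thesis ..
qed

text \<open>At nonnegative times this is the number of the step in progress; the
  \<open>LEAST\<close> form yields Borel measurability directly.\<close>

definition idx :: "real \<Rightarrow> nat" where "idx t = (LEAST k. t < grid (Suc k))"

lemma idx_less: "t < grid (Suc (idx t))"
proof -
  obtain k where "t < grid k" using grid_unbounded by blast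
  then have "t < grid (Suc k)" using grid_mono[of k "Suc k"] by simp
  then show ?thesis unfolding idx_def by (rule LeastI)
qed

lemma idx_eq:
  assumes "grid k \<le> t" "t < grid (Suc k)"
  shows "idx t = k"
  unfolding idx_def
proof (rule Least_equality)
  show "t < grid (Suc k)" by (rule assms(2))
  fix j assume "t < grid (Suc j)"
  then have "\<not> Suc j \<le> k" using grid_mono[of "Suc j" k] assms by auto
  then show "k \<le> j" by simp
qed

lemma grid_idx_le:
  assumes "t \<ge> 0"
  shows "grid (idx t) \<le> t"
proof (cases "idx t")
  case (Suc j)
  then have "\<not> t < grid (Suc j)" using not_less_Least[of j "\<lambda>k. t < grid (Suc k)"] by (simp add: idx_def)
  then show ?thesis using Suc by simp
qed (use assms in simp)

lemma idx_measurable [measurable]: "idx \<in> borel \<rightarrow>\<^sub>M count_space UNIV"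
  unfolding idx_def by measurable

definition valid :: "(nat \<Rightarrow> nat) \<Rightarrow> bool" where "valid b \<longleftrightarrow> (\<forall>k. b k < n k)"

definition coded_control :: "(nat \<Rightarrow> nat) \<Rightarrow> real \<Rightarrow> 'u" where
  "coded_control b t = menu (idx t) (b (idx t))"

lemma coded_control_in_controls:
  assumes "valid b"
  shows "coded_control b \<in> controls U"
proof -
  have 1: "(\<lambda>k. menu k (b k)) \<in> count_space UNIV \<rightarrow>\<^sub>M restrict_space borel U"
    using assms menu_in by (auto simp: valid_def space_restrict_space)
  have "idx \<in> nonneg_borel \<rightarrow>\<^sub>M count_space UNIV"
    by (rule measurable_restrict_space1) (rule idx_measurable)
  from measurable_compose[OF this 1] show ?thesis
    by (simp add: controls_def coded_control_def[abs_def])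
qed

text \<open>For a valid code this is the state of the coded trajectory at \<open>grid k\<close>. The
  recursion shows that it depends on the first \<open>k\<close> digits only, and later that it is
  measurable in the code.\<close>

primrec node :: "real^'n \<Rightarrow> (nat \<Rightarrow> nat) \<Rightarrow> nat \<Rightarrow> real^'n" where
  "node x b 0 = x"
| "node x b (Suc k) = traj (\<lambda>_. menu k (b k)) (node x b k) (step_len k)"

lemma traj_coded_control:
  assumes b: "valid b"
  shows "s \<in> {0..step_len k} \<Longrightarrow> traj (coded_control b) x (grid k + s) = traj (\<lambda>_. menu k (b k)) (node x b k) s"
proof (induction k arbitrary: s)
  have e: "(\<lambda>_. menu k (b k)) \<in> controls U" for k
    using b menu_in by (intro const_control) (auto simp: valid_def)
  note cb = coded_control_in_controls[OF b]
  have seg: "traj (coded_control b) x (grid k + s) = traj (\<lambda>_. menu k (b k)) (traj (coded_control b) x (grid k)) s"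
    if "s \<in> {0..step_len k}" for k s
  proof -
    have "traj (coded_control b) x (grid k + s) = traj (\<lambda>r. coded_control b (grid k + r)) (traj (coded_control b) x (grid k)) s"
      using that by (intro traj_shift[OF cb] grid_nonneg) auto
    also have "\<dots> = traj (\<lambda>_. menu k (b k)) (traj (coded_control b) x (grid k)) s"
    proof (rule traj_causal[OF shift_control[OF cb grid_nonneg] e _ that])
      fix t assume "t \<in> {0..<step_len k}"
      then have "idx (grid k + t) = k" by (intro idx_eq) (auto simp: grid_Suc)
      then show "coded_control b (grid k + t) = menu k (b k)" by (simp add: coded_control_def)
    qed
    finally show ?thesis .
  qed
  {
    case 0
    then show ?case using seg[of s 0] traj_0[OF cb] by simp
  next
    case (Suc k)
    have "traj (coded_control b) x (grid (Suc k)) = node x b (Suc k)"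
      using Suc.IH[of "step_len k"] step_len_pos[of k] by (simp add: grid_Suc less_imp_le)
    then show ?case using seg[OF Suc.prems] by simp
  }
qed

lemma traj_coded_control_grid: "valid b \<Longrightarrow> traj (coded_control b) x (grid k) = node x b k"
  using traj_coded_control[of b 0 k x] step_len_pos[of k] traj_0[of "\<lambda>_. menu k (b k)" "node x b k"] menu_in[of k "b k"]
  by (simp add: const_control valid_def less_imp_le)

lemma node_in_Y: "valid b \<Longrightarrow> x \<in> Y \<Longrightarrow> node x b k \<in> Y"
  using traj_coded_control_grid[of b x k] traj_in_Y[OF _ coded_control_in_controls grid_nonneg] by metis

lemma traj_coded_control_prefix:
  assumes "valid b" "valid b'" "\<And>i. i < k \<Longrightarrow> b i = b' i" "t \<in> {0..grid k}"
  shows "traj (coded_control b) x t = traj (coded_control b') x t"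
proof (rule traj_causal[OF coded_control_in_controls coded_control_in_controls _ assms(4)])
  fix s assume "s \<in> {0..<grid k}"
  then have "\<not> grid k \<le> grid (idx s)" using grid_idx_le[of s] by auto
  then have "idx s < k" using grid_mono[of k "idx s"] by (meson not_le)
  then show "coded_control b s = coded_control b' s" using assms(3) by (simp add: coded_control_def)
qed (use assms in auto)

lemma node_prefix: "(\<And>i. i < k \<Longrightarrow> b i = b' i) \<Longrightarrow> node x b k = node x b' k"
  by (induction k) auto

text \<open>A minimum over a finite menu is attained, and the least minimising index is a measurable
  selection.\<close>

definition aim :: "nat \<Rightarrow> real^'n \<Rightarrow> real^'n \<Rightarrow> nat" where
  "aim k x z = (LEAST i. i < n k \<and> (\<forall>j\<in>{..<n k}. (x - z) \<bullet> f x (menu k i) \<le> (x - z) \<bullet> f x (menu k j)))"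

lemma aim: "aim k x z < n k" "j < n k \<Longrightarrow> (x - z) \<bullet> f x (menu k (aim k x z)) \<le> (x - z) \<bullet> f x (menu k j)"
proof -
  define h where "h j = (x - z) \<bullet> f x (menu k j)" for j
  have "finite (h ` {..<n k})" "h ` {..<n k} \<noteq> {}" using n_pos by auto
  then have "Min (h ` {..<n k}) \<in> h ` {..<n k}" by (rule Min_in)
  then obtain i where i: "i < n k" "h i = Min (h ` {..<n k})" by auto
  have "i < n k \<and> (\<forall>j\<in>{..<n k}. h i \<le> h j)" using i by simp
  then have "aim k x z < n k \<and> (\<forall>j\<in>{..<n k}. h (aim k x z) \<le> h j)"
    unfolding aim_def h_def by (rule LeastI)
  then show "aim k x z < n k" "j < n k \<Longrightarrow> (x - z) \<bullet> f x (menu k (aim k x z)) \<le> (x - z) \<bullet> f x (menu k j)"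
    by (auto simp: h_def)
qed

text \<open>Condition (iii), with \<open>z\<close> in the first place and \<open>x\<close> in the
  second, supplies a reply \<open>b\<close> to \<open>a\<close> with slack one step length. Some
  menu entry imitates \<open>b\<close> at the cost of another step length. The minimiser does at
  least as well as that entry, since the term with \<open>a\<close> is common to both.\<close>

lemma aim_property:
  assumes x: "x \<in> Y" and z: "z \<in> Y" and a: "a \<in> U"
  shows "(x - z) \<bullet> (f x (menu k (aim k x z)) - f z a) \<le> 2 * step_len k"
proof -
  obtain b where b: "b \<in> U" "(z - x) \<bullet> (f z a - f x b) < step_len k"
    using nonexpansive_choice[OF a step_len_pos] by blast
  obtain i where i: "i < n k" "norm (f x b - f x (menu k i)) \<le> step_len k / size_bd"
    using net[OF x b(1)] by (auto simp: step_len_def)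
  have "(x - z) \<bullet> (f x (menu k i) - f x b) \<le> norm (x - z) * norm (f x (menu k i) - f x b)"
    by (rule norm_cauchy_schwarz)
  also have "\<dots> \<le> size_bd * (step_len k / size_bd)"
    using i(2) size_bd x z by (intro mult_mono) (auto simp: norm_minus_commute)
  also have "\<dots> = step_len k" using size_bd(1) by simp
  finally have 1: "(x - z) \<bullet> (f x (menu k i) - f x b) \<le> step_len k" .
  have 2: "(x - z) \<bullet> (f x b - f z a) < step_len k"
    using b(2) by (simp add: inner_diff_left inner_diff_right algebra_simps)
  show ?thesis using 1 2 aim(2)[OF i(1), of x z] by (simp add: inner_diff_right)
qed

text \<open>The target enters through its grid positions alone. A digit therefore depends on
  finitely many of them, which later makes payoffs continuous in the code of the target.\<close>

primrec tracker_pos :: "real^'n \<Rightarrow> (nat \<Rightarrow> real^'n) \<Rightarrow> nat \<Rightarrow> real^'n" where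
  "tracker_pos x z 0 = x"
| "tracker_pos x z (Suc k) = traj (\<lambda>_. menu k (aim k (tracker_pos x z k) (z k))) (tracker_pos x z k) (step_len k)"

definition tracker_digit :: "real^'n \<Rightarrow> (nat \<Rightarrow> real^'n) \<Rightarrow> nat \<Rightarrow> nat" where
  "tracker_digit x z k = aim k (tracker_pos x z k) (z k)"

lemma valid_tracker_digit: "valid (tracker_digit x z)"
  by (simp add: valid_def tracker_digit_def aim)

lemma node_tracker_digit: "node x (tracker_digit x z) k = tracker_pos x z k"
  by (induction k) (auto simp: tracker_digit_def)

lemma tracker_pos_prefix: "(\<And>i. i < k \<Longrightarrow> z i = z' i) \<Longrightarrow> tracker_pos x z k = tracker_pos x z' k"
  by (induction k) auto

lemma tracker_digit_prefix: "(\<And>i. i \<le> k \<Longrightarrow> z i = z' i) \<Longrightarrow> tracker_digit x z k = tracker_digit x z' k"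
  using tracker_pos_prefix[of k z z' x] by (simp add: tracker_digit_def)

text \<open>Each step raises the squared distance by at most \<open>4 + step_error\<close> times the
  squared step length; the 4 is twice the aiming slack of two step lengths. The squared step lengths
  sum to at most \<open>2 * c\<^sup>2\<close>.\<close>

theorem tracking_bound:
  assumes x: "x \<in> Y" and z0: "z0 \<in> Y" and u: "u \<in> controls U" and t: "t \<ge> 0"
  shows "(norm (traj (coded_control (tracker_digit x (\<lambda>k. traj u z0 (grid k)))) x t - traj u z0 t))\<^sup>2
    \<le> (norm (x - z0))\<^sup>2 + (4 + step_error) * (2 * c\<^sup>2)"
proof -
  define z where "z k = traj u z0 (grid k)" for k
  let ?b = "tracker_digit x z"
  note vb = valid_tracker_digit[of x z]
  have zY: "z k \<in> Y" for k unfolding z_def by (rule traj_in_Y[OF z0 u grid_nonneg])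
  have xY: "node x ?b k \<in> Y" for k by (rule node_in_Y[OF vb x])
  have b_in: "menu k (?b k) \<in> U" for k using vb menu_in by (simp add: valid_def)
  have step: "(norm (traj (coded_control ?b) x (grid k + s) - traj u z0 (grid k + s)))\<^sup>2
      \<le> (norm (node x ?b k - z k))\<^sup>2 + (4 + step_error) * (step_len k)\<^sup>2" if s: "s \<in> {0..step_len k}" for k s
  proof -
    have "traj (coded_control ?b) x (grid k + s) = traj (\<lambda>_. menu k (?b k)) (node x ?b k) s"
      by (rule traj_coded_control[OF vb s])
    moreover have "traj u z0 (grid k + s) = traj (\<lambda>r. u (grid k + r)) (z k) s"
      unfolding z_def using s by (intro traj_shift[OF u grid_nonneg]) auto
    moreover have "(norm (traj (\<lambda>_. menu k (?b k)) (node x ?b k) s - traj (\<lambda>r. u (grid k + r)) (z k) s))\<^sup>2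
      \<le> (norm (node x ?b k - z k))\<^sup>2 + s * (2 * (2 * step_len k) + step_error * step_len k)"
    proof (rule aiming_step[OF xY zY shift_control[OF u grid_nonneg] b_in])
      show "(node x ?b k - z k) \<bullet> (f (node x ?b k) (menu k (?b k)) - f (z k) a) \<le> 2 * step_len k" if "a \<in> U" for a
        using aim_property[OF xY zY that, of k k k] by (simp add: tracker_digit_def node_tracker_digit)
    qed (use s in auto)
    moreover have "s * (2 * (2 * step_len k) + step_error * step_len k) \<le> step_len k * (2 * (2 * step_len k) + step_error * step_len k)"
      using s step_error_nonneg step_len_pos[of k] by (intro mult_right_mono) auto
    moreover have "step_len k * (2 * (2 * step_len k) + step_error * step_len k) = (4 + step_error) * (step_len k)\<^sup>2"
      by (simp add: power2_eq_square algebra_simps)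
    ultimately show ?thesis by simp
  qed
  have nodes: "(norm (node x ?b k - z k))\<^sup>2 \<le> (norm (x - z0))\<^sup>2 + (4 + step_error) * (\<Sum>i<k. (step_len i)\<^sup>2)" for k
  proof (induction k)
    case 0
    then show ?case using traj_0[OF u] by (simp add: z_def)
  next
    case (Suc k)
    have "(norm (node x ?b (Suc k) - z (Suc k)))\<^sup>2 \<le> (norm (node x ?b k - z k))\<^sup>2 + (4 + step_error) * (step_len k)\<^sup>2"
      using step[of "step_len k" k] step_len_pos[of k] traj_coded_control_grid[OF vb, of x "Suc k"]
      by (simp add: z_def grid_Suc less_imp_le)
    also note Suc.IH
    finally show ?case by (simp add: algebra_simps)
  qed
  have sq: "(\<Sum>i<k. (step_len i)\<^sup>2) \<le> 2 * c\<^sup>2" for k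
  proof -
    have "(\<Sum>i<k. (step_len i)\<^sup>2) = c\<^sup>2 * (\<Sum>i<k. (inverse (real (Suc i)))\<^sup>2)"
      by (simp add: step_len_def power_mult_distrib sum_distrib_left)
    also have "\<dots> \<le> c\<^sup>2 * 2" by (intro mult_left_mono sum_inverse_squares_le) auto
    finally show ?thesis by simp
  qed
  \<comment> \<open>The time \<open>t\<close> falls inside step \<open>k\<close>: the
    \<open>k\<close> completed steps and the unfinished one together give the sum below
    \<open>Suc k\<close>.\<close>
  define k where "k = idx t"
  have k: "t - grid k \<in> {0..step_len k}" "t = grid k + (t - grid k)"
    using idx_less[of t] grid_idx_le[OF t] by (auto simp: k_def grid_Suc)
  have "(norm (traj (coded_control ?b) x t - traj u z0 t))\<^sup>2 \<le> (norm (node x ?b k - z k))\<^sup>2 + (4 + step_error) * (step_len k)\<^sup>2"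
    using step[OF k(1)] by simp
  also have "\<dots> \<le> (norm (x - z0))\<^sup>2 + (4 + step_error) * (\<Sum>i<Suc k. (step_len i)\<^sup>2)"
    using nodes[of k] by (simp add: algebra_simps)
  also have "\<dots> \<le> (norm (x - z0))\<^sup>2 + (4 + step_error) * (2 * c\<^sup>2)"
    using step_error_nonneg by (intro add_left_mono mult_left_mono sq) auto
  finally show ?thesis by (simp add: z_def[abs_def])
qed

corollary tracking_distance:
  assumes "x \<in> Y" "z0 \<in> Y" "u \<in> controls U" "t \<ge> 0" "(4 + step_error) * (2 * c\<^sup>2) \<le> d\<^sup>2" "d \<ge> 0"
  shows "norm (traj (coded_control (tracker_digit x (\<lambda>k. traj u z0 (grid k)))) x t - traj u z0 t) \<le> norm (x - z0) + d"
proof (rule power2_le_imp_le)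
  have "(norm (traj (coded_control (tracker_digit x (\<lambda>k. traj u z0 (grid k)))) x t - traj u z0 t))\<^sup>2 \<le> (norm (x - z0))\<^sup>2 + d\<^sup>2"
    using tracking_bound[OF assms(1-4)] assms(5) by linarith
  also have "\<dots> \<le> (norm (x - z0) + d)\<^sup>2" using assms(6) by (simp add: power2_sum)
  finally show "(norm (traj (coded_control (tracker_digit x (\<lambda>k. traj u z0 (grid k)))) x t - traj u z0 t))\<^sup>2
    \<le> (norm (x - z0) + d)\<^sup>2" .
qed (use assms in simp)

end

context nonexpansive_control
begin

lemma ex_tracking:
  assumes d: "d > 0"
  shows "\<exists>c menu n. tracking U f g Y c menu n \<and> (4 + step_error) * (2 * c\<^sup>2) \<le> d\<^sup>2"
proof -
  \<comment> \<open>With \<open>q = 4 + step_error\<close>, the quantity to be bounded equals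
    \<open>2 / q\<close> times \<open>d\<^sup>2\<close>, and \<open>q\<close> is at least 4.\<close>
  define c where "c = d / (4 + step_error)"
  have c: "c > 0" "(4 + step_error) * (2 * c\<^sup>2) \<le> d\<^sup>2"
  proof -
    show "c > 0" using d step_error_nonneg by (simp add: c_def)
    have "q * (2 * (d / q)\<^sup>2) = 2 / q * d\<^sup>2" if "q > 0" for q
      using that by (simp add: power2_eq_square)
    then have "(4 + step_error) * (2 * c\<^sup>2) = 2 / (4 + step_error) * d\<^sup>2"
      using step_error_nonneg unfolding c_def by simp
    also have "\<dots> \<le> 1 * d\<^sup>2" using step_error_nonneg by (intro mult_right_mono) auto
    finally show "(4 + step_error) * (2 * c\<^sup>2) \<le> d\<^sup>2" by simp
  qed
  obtain u0 where u0: "u0 \<in> U" using problem unfolding control_problem_def by blast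
  have "\<exists>(e :: nat \<Rightarrow> 'u) (m :: nat). m > 0 \<and> (\<forall>i. e i \<in> U) \<and> (\<forall>x\<in>Y. \<forall>u\<in>U. \<exists>i<m. norm (f x u - f x (e i)) \<le> c * inverse (real (Suc k)) / size_bd)"
    for k :: nat
  proof -
    have "c * inverse (real (Suc k)) / size_bd > 0" using c size_bd(1) by simp
    from finite_control_net[OF this] obtain V where V: "finite V" "V \<subseteq> U"
      "\<forall>x\<in>Y. \<forall>u\<in>U. \<exists>b\<in>V. norm (f x u - f x b) \<le> c * inverse (real (Suc k)) / size_bd" by blast
    \<comment> \<open>Adding \<open>u0\<close> keeps the menu nonempty even if the net is empty, as
      it may be for empty \<open>Y\<close>.\<close>
    obtain e where e: "bij_betw e {0..<card (insert u0 V)} (insert u0 V)"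
      using ex_bij_betw_nat_finite[of "insert u0 V"] V(1) by auto
    then have im: "e ` {0..<card (insert u0 V)} = insert u0 V" by (simp add: bij_betw_def)
    show ?thesis
    proof (rule exI[of _ "\<lambda>i. if i < card (insert u0 V) then e i else u0"], rule exI[of _ "card (insert u0 V)"], intro conjI allI impI ballI)
      show "card (insert u0 V) > 0" using V(1) by (simp add: card_gt_0_iff)
      show "(if i < card (insert u0 V) then e i else u0) \<in> U" for i
        using im V(2) u0 by auto
      fix x u assume "x \<in> Y" "u \<in> U"
      then obtain b where b: "b \<in> V" "norm (f x u - f x b) \<le> c * inverse (real (Suc k)) / size_bd" using V(3) by blast
      then have "b \<in> e ` {0..<card (insert u0 V)}" using im by simp
      then show "\<exists>i<card (insert u0 V). norm (f x u - f x (if i < card (insert u0 V) then e i else u0)) \<le> c * inverse (real (Suc k)) / size_bd"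
        using b(2) by force
    qed
  qed
  then have "\<forall>k. \<exists>p :: (nat \<Rightarrow> 'u) \<times> nat. snd p > 0 \<and> (\<forall>i. fst p i \<in> U) \<and>
      (\<forall>x\<in>Y. \<forall>u\<in>U. \<exists>i<snd p. norm (f x u - f x (fst p i)) \<le> c * inverse (real (Suc k)) / size_bd)"
    by (simp add: split_paired_Ex)
  from choice[OF this] obtain p :: "nat \<Rightarrow> (nat \<Rightarrow> 'u) \<times> nat" where p: "\<forall>k. snd (p k) > 0 \<and> (\<forall>i. fst (p k) i \<in> U) \<and>
      (\<forall>x\<in>Y. \<forall>u\<in>U. \<exists>i<snd (p k). norm (f x u - f x (fst (p k) i)) \<le> c * inverse (real (Suc k)) / size_bd)" ..
  have "tracking U f g Y c (\<lambda>k. fst (p k)) (\<lambda>k. snd (p k))"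
    by unfold_locales (use p c in auto)
  then show ?thesis using c(2) by blast
qed

text \<open>The error is uniform in time, in contrast to \<open>traj_comparison\<close>, whose
  factor grows exponentially. The price is that \<open>v\<close> differs from
  \<open>u\<close>.\<close>

corollary shadowing:
  assumes "x \<in> Y" "z \<in> Y" "u \<in> controls U" "d > 0"
  shows "\<exists>v\<in>controls U. \<forall>t\<ge>0. norm (traj v x t - traj u z t) \<le> norm (x - z) + d"
proof -
  obtain c menu n where T: "tracking U f g Y c menu n" "(4 + step_error) * (2 * c\<^sup>2) \<le> d\<^sup>2"
    using ex_tracking[OF assms(4)] by blast
  interpret tracking U f g Y c menu n by (rule T(1))
  show ?thesis
    using tracking_distance[OF assms(1-3) _ T(2)] coded_control_in_controls[OF valid_tracker_digit] assms(4)
    by (meson less_imp_le)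
qed

end

section \<open>Evaluations and total variation\<close>

text \<open>A function with values in [0, 1] is, up to 1/m, the mean of the indicators of its level
  sets at k/m. Each indicator contributes at most \<open>d\<close>, and so does their mean.\<close>

lemma integral_diff_le_unit:
  fixes h :: "'a \<Rightarrow> real"
  assumes M: "prob_space M" and N: "prob_space N" and sets: "sets M = sets N"
    and h: "h \<in> borel_measurable M" and bound: "\<And>x. x \<in> space M \<Longrightarrow> 0 \<le> h x \<and> h x \<le> 1"
    and d: "\<And>Q. Q \<in> sets M \<Longrightarrow> \<bar>measure M Q - measure N Q\<bar> \<le> d"
  shows "\<bar>(\<integral>x. h x \<partial>M) - (\<integral>x. h x \<partial>N)\<bar> \<le> d"
proof -
  interpret M: prob_space M by (rule M)
  interpret N: prob_space N by (rule N)
  have sp: "space M = space N" using sets by (rule sets_eq_imp_space_eq)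
  have hN: "h \<in> borel_measurable N" using h measurable_cong_sets[OF sets refl] by blast
  have ih: "integrable M h" "integrable N h"
    using bound sp h hN by (auto intro!: M.integrable_const_bound[of _ 1] N.integrable_const_bound[of _ 1])
  have *: "\<bar>(\<integral>x. h x \<partial>M) - (\<integral>x. h x \<partial>N)\<bar> \<le> d + 2 / real m" if m: "m > 0" for m :: nat
  proof -
    define A where "A k = {x \<in> space M. real k \<le> real m * h x}" for k
    have A: "A k \<in> sets M" for k unfolding A_def using h by measurable
    define s where "s x = (\<Sum>k\<in>{1..m}. indicator (A k) x / real m)" for x
    have sh: "s x \<le> h x \<and> h x \<le> s x + 1 / real m" if x: "x \<in> space M" for x
    proof -
      define q where "q = real m * h x"
      have q: "0 \<le> q" "q \<le> real m" using bound[OF x] m by (auto simp: q_def mult_le_cancel_left1)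
      have nm: "nat \<lfloor>q\<rfloor> \<le> m" using q by linarith
      \<comment> \<open>The number of levels reached at \<open>x\<close> is the floor of
        \<open>q\<close>.\<close>
      have "(\<Sum>k\<in>{1..m}. indicator (A k) x) = (\<Sum>k\<in>{1..m}. of_bool (k \<in> {1..nat \<lfloor>q\<rfloor>}) :: real)"
        using q x by (intro sum.cong) (auto simp: A_def q_def[symmetric] indicator_def le_nat_floor le_nat_iff le_floor_iff)
      also have "\<dots> = real (card ({1..m} \<inter> {1..nat \<lfloor>q\<rfloor>}))"
        by (simp only: sum_of_bool_eq finite_atLeastAtMost Collect_mem_eq)
      also have "{1..m} \<inter> {1..nat \<lfloor>q\<rfloor>} = {1..nat \<lfloor>q\<rfloor>}" using nm by auto
      finally have "(\<Sum>k\<in>{1..m}. indicator (A k) x) = real (nat \<lfloor>q\<rfloor>)" by simp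
      then have "real m * s x = real (nat \<lfloor>q\<rfloor>)" using m by (simp add: s_def flip: sum_divide_distrib)
      moreover have "real (nat \<lfloor>q\<rfloor>) \<le> q" "q \<le> real (nat \<lfloor>q\<rfloor>) + 1" using q by linarith+
      ultimately have "real m * s x \<le> real m * h x" "real m * h x \<le> real m * (s x + 1 / real m)"
        using m by (auto simp: q_def algebra_simps)
      then show ?thesis using m by simp
    qed
    have ints: "integrable M s" "integrable N s"
      unfolding s_def using A sets
      by (auto intro!: Bochner_Integration.integrable_sum integrable_real_indicator simp: M.emeasure_finite N.emeasure_finite less_top[symmetric])
    have sM: "(\<integral>x. s x \<partial>M) = (\<Sum>k\<in>{1..m}. measure M (A k) / real m)"
      unfolding s_def using A by (subst Bochner_Integration.integral_sum) (auto intro!: integrable_real_indicator simp: less_top[symmetric])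
    have sN: "(\<integral>x. s x \<partial>N) = (\<Sum>k\<in>{1..m}. measure N (A k) / real m)"
      unfolding s_def using A sets by (subst Bochner_Integration.integral_sum) (auto intro!: integrable_real_indicator simp: less_top[symmetric])
    have "\<bar>(\<integral>x. s x \<partial>M) - (\<integral>x. s x \<partial>N)\<bar> = \<bar>\<Sum>k\<in>{1..m}. (measure M (A k) - measure N (A k)) / real m\<bar>"
      unfolding sM sN by (simp add: sum_subtractf diff_divide_distrib)
    also have "\<dots> \<le> (\<Sum>k\<in>{1..m}. d / real m)"
      by (rule order_trans[OF sum_abs sum_mono]) (use d[OF A] m in \<open>simp add: divide_right_mono\<close>)
    also have "\<dots> = d" using m by simp
    finally have 1: "\<bar>(\<integral>x. s x \<partial>M) - (\<integral>x. s x \<partial>N)\<bar> \<le> d" .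
    have 2: "(\<integral>x. s x \<partial>M) \<le> (\<integral>x. h x \<partial>M)" "(\<integral>x. s x \<partial>N) \<le> (\<integral>x. h x \<partial>N)"
      using sh sp by (auto intro!: integral_mono ints ih)
    have "(\<integral>x. h x \<partial>M) \<le> (\<integral>x. s x + 1 / real m \<partial>M)" "(\<integral>x. h x \<partial>N) \<le> (\<integral>x. s x + 1 / real m \<partial>N)"
      using sh sp by (auto intro!: integral_mono ints ih)
    then have 3: "(\<integral>x. h x \<partial>M) \<le> (\<integral>x. s x \<partial>M) + 1 / real m" "(\<integral>x. h x \<partial>N) \<le> (\<integral>x. s x \<partial>N) + 1 / real m"
      using ints by (simp_all add: M.prob_space N.prob_space)
    have "2 / real m = 1 / real m + 1 / real m" by simp
    then show ?thesis using 1 2 3 by linarith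
  qed
  show ?thesis
  proof (rule field_le_epsilon)
    fix e :: real assume e: "e > 0"
    obtain m :: nat where m: "2 / e < real m" using reals_Archimedean2 by blast
    moreover have "0 < 2 / e" using e by simp
    ultimately have "0 < real m" by linarith
    then have "m > 0" "2 / real m \<le> e" using m e by (auto simp: field_simps)
    then show "\<bar>(\<integral>x. h x \<partial>M) - (\<integral>x. h x \<partial>N)\<bar> \<le> d + e" using *[of m] by linarith
  qed
qed

lemma integral_diff_le:
  fixes h :: "'a \<Rightarrow> real"
  assumes M: "prob_space M" and N: "prob_space N" and sets: "sets M = sets N"
    and h: "h \<in> borel_measurable M" and bound: "\<And>x. \<bar>h x\<bar> \<le> B" and B: "B > 0"
    and d: "\<And>Q. Q \<in> sets M \<Longrightarrow> \<bar>measure M Q - measure N Q\<bar> \<le> d"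
  shows "\<bar>(\<integral>x. h x \<partial>M) - (\<integral>x. h x \<partial>N)\<bar> \<le> 2 * B * d"
proof -
  interpret M: prob_space M by (rule M)
  interpret N: prob_space N by (rule N)
  have hN: "h \<in> borel_measurable N" using h measurable_cong_sets[OF sets refl] by blast
  have ih: "integrable M h" "integrable N h"
    using bound h hN by (auto intro!: M.integrable_const_bound[of _ B] N.integrable_const_bound[of _ B])
  define k where "k x = (h x + B) / (2 * B)" for x
  have "0 \<le> k x \<and> k x \<le> 1" for x
    using bound[of x] B by (auto simp: k_def field_simps abs_le_iff)
  then have "\<bar>(\<integral>x. k x \<partial>M) - (\<integral>x. k x \<partial>N)\<bar> \<le> d"
    by (intro integral_diff_le_unit[OF M N sets _ _ d]) (use h in \<open>auto simp: k_def\<close>)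
  moreover have "(\<integral>x. k x \<partial>M) = ((\<integral>x. h x \<partial>M) + B) / (2 * B)" "(\<integral>x. k x \<partial>N) = ((\<integral>x. h x \<partial>N) + B) / (2 * B)"
    unfolding k_def using ih by (simp_all add: M.prob_space N.prob_space)
  ultimately have "\<bar>(\<integral>x. h x \<partial>M) - (\<integral>x. h x \<partial>N)\<bar> / (2 * B) \<le> d"
    using B by (simp flip: diff_divide_distrib)
  then show ?thesis using B by (simp add: field_simps)
qed

section \<open>Integration against an evaluation\<close>

lemma evaluationsD:
  assumes "\<theta> \<in> evaluations"
  shows "prob_space \<theta>" "sets \<theta> = sets nonneg_borel" "space \<theta> = {0..}"
    "(\<lambda>t. t) \<in> borel_measurable \<theta>"
proof -
  show 1: "prob_space \<theta>" "sets \<theta> = sets nonneg_borel" using assms by (auto simp: evaluations_def)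
  show "space \<theta> = {0..}" using sets_eq_imp_space_eq[OF 1(2)] by (simp add: space_restrict_space)
  have "(\<lambda>t::real. t) \<in> borel_measurable nonneg_borel" by (rule measurable_restrict_space1) simp
  then show "(\<lambda>t. t) \<in> borel_measurable \<theta>" using measurable_cong_sets[OF 1(2) refl] by blast
qed

lemma evaluation_measurable:
  assumes "\<theta> \<in> evaluations" "h \<in> borel_measurable borel"
  shows "h \<in> borel_measurable \<theta>"
  using measurable_compose[OF evaluationsD(4)[OF assms(1)] assms(2)] .

lemma evaluation_integrable:
  fixes h :: "real \<Rightarrow> real"
  assumes "\<theta> \<in> evaluations" "h \<in> borel_measurable borel" "\<And>t. \<bar>h t\<bar> \<le> B"
  shows "integrable \<theta> h"
proof -
  interpret prob_space \<theta> by (rule evaluationsD(1)[OF assms(1)])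
  show ?thesis using assms(3) by (intro integrable_const_bound[of _ B] evaluation_measurable[OF assms(1,2)]) auto
qed

lemma evaluation_integral_le:
  fixes h k :: "real \<Rightarrow> real"
  assumes "\<theta> \<in> evaluations" "h \<in> borel_measurable borel" "\<And>t. \<bar>h t\<bar> \<le> B"
    "k \<in> borel_measurable borel" "\<And>t. \<bar>k t\<bar> \<le> B" "\<And>t. t \<ge> 0 \<Longrightarrow> h t \<le> k t + e"
  shows "(\<integral>t. h t \<partial>\<theta>) \<le> (\<integral>t. k t \<partial>\<theta>) + e"
proof -
  interpret prob_space \<theta> by (rule evaluationsD(1)[OF assms(1)])
  have ik: "integrable \<theta> k" by (rule evaluation_integrable[OF assms(1,4,5)])
  have "(\<integral>t. h t \<partial>\<theta>) \<le> (\<integral>t. k t + e \<partial>\<theta>)"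
    using assms evaluationsD(3)[OF assms(1)] ik
    by (intro integral_mono evaluation_integrable[OF assms(1,2,3)]) auto
  also have "\<dots> = (\<integral>t. k t \<partial>\<theta>) + e" using ik by (simp add: prob_space)
  finally show ?thesis .
qed

lemma evaluation_integral_abs_le:
  fixes h :: "real \<Rightarrow> real"
  assumes "\<theta> \<in> evaluations" "h \<in> borel_measurable borel" "\<And>t. \<bar>h t\<bar> \<le> B"
  shows "\<bar>\<integral>t. h t \<partial>\<theta>\<bar> \<le> B"
proof -
  interpret prob_space \<theta> by (rule evaluationsD(1)[OF assms(1)])
  have ih: "integrable \<theta> h" by (rule evaluation_integrable[OF assms])
  have "\<bar>\<integral>t. h t \<partial>\<theta>\<bar> \<le> (\<integral>t. \<bar>h t\<bar> \<partial>\<theta>)" by (rule integral_abs_bound)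
  also have "\<dots> \<le> (\<integral>t. B \<partial>\<theta>)" using assms(3) ih by (intro integral_mono) auto
  also have "\<dots> = B" by (simp add: prob_space)
  finally show ?thesis .
qed

lemma TV_upper:
  assumes th: "\<theta> \<in> evaluations" and Q: "Q \<in> sets nonneg_borel"
  shows "\<bar>measure \<theta> Q - measure \<theta> ((\<lambda>t. t + s) ` Q)\<bar> \<le> TV s \<theta>"
proof -
  interpret prob_space \<theta> by (rule evaluationsD(1)[OF th])
  have "bdd_above ((\<lambda>Q. \<bar>prob Q - prob ((\<lambda>t. t + s) ` Q)\<bar>) ` sets nonneg_borel)"
  proof (rule bdd_aboveI2)
    fix Q show "\<bar>prob Q - prob ((\<lambda>t. t + s) ` Q)\<bar> \<le> 1"
      using prob_le_1[of Q] prob_le_1[of "(\<lambda>t. t + s) ` Q"] measure_nonneg[of \<theta> Q]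
        measure_nonneg[of \<theta> "(\<lambda>t. t + s) ` Q"] unfolding abs_le_iff by linarith
  qed
  then show ?thesis unfolding TV_def using Q by (rule cSUP_upper[rotated])
qed

lemma TV_le:
  assumes "\<And>Q. Q \<in> sets nonneg_borel \<Longrightarrow> \<bar>measure \<theta> Q - measure \<theta> ((\<lambda>t. t + s) ` Q)\<bar> \<le> d"
  shows "TV s \<theta> \<le> d"
  unfolding TV_def using assms by (intro cSUP_least) auto

text \<open>The pointwise form of the bound on the supremum of the total variations;
  \<open>slow_of_SUP\<close> derives it from the fact that these variations are at most 1.\<close>

definition slow :: "real measure \<Rightarrow> real \<Rightarrow> real \<Rightarrow> bool" where
  "slow \<theta> \<eta> S \<longleftrightarrow> (\<forall>s\<in>{0..S}. TV s \<theta> \<le> \<eta>)"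

lemma slow_of_SUP:
  assumes th: "\<theta> \<in> evaluations" and le: "(SUP s\<in>{0..S}. TV s \<theta>) \<le> \<eta>"
  shows "slow \<theta> \<eta> S"
  unfolding slow_def
proof
  interpret prob_space \<theta> by (rule evaluationsD(1)[OF th])
  fix s assume s: "s \<in> {0..S}"
  have "bdd_above ((\<lambda>s. TV s \<theta>) ` {0..S})"
  proof (rule bdd_aboveI2, rule TV_le)
    fix s Q show "\<bar>prob Q - prob ((\<lambda>t. t + s) ` Q)\<bar> \<le> 1"
      using prob_le_1[of Q] prob_le_1[of "(\<lambda>t. t + s) ` Q"] measure_nonneg[of \<theta> Q]
        measure_nonneg[of \<theta> "(\<lambda>t. t + s) ` Q"] unfolding abs_le_iff by linarith
  qed
  from cSUP_upper[OF s this] le show "TV s \<theta> \<le> \<eta>" by simp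
qed

lemma slow_mono: "slow \<theta> \<eta> S \<Longrightarrow> \<eta> \<le> \<eta>' \<Longrightarrow> S' \<le> S \<Longrightarrow> slow \<theta> \<eta>' S'"
  unfolding slow_def by (meson atLeastAtMost_iff order_trans)

text \<open>Turns thresholds found point by point into common ones on a finite net, by the smallest
  \<eta> and the largest horizon.\<close>

lemma slow_finite:
  assumes "finite Z" and "\<And>z. z \<in> Z \<Longrightarrow> \<exists>\<eta>>0. \<exists>S>0. \<forall>\<theta>\<in>evaluations. slow \<theta> \<eta> S \<longrightarrow> Q z \<theta>"
  shows "\<exists>\<eta>>0. \<exists>S>0. \<forall>\<theta>\<in>evaluations. slow \<theta> \<eta> S \<longrightarrow> (\<forall>z\<in>Z. Q z \<theta>)"
  using assms
proof (induction Z rule: finite_induct)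
  case empty
  show ?case by (intro exI[of _ 1] conjI) auto
next
  case (insert z Z)
  obtain \<eta>1 S1 where 1: "\<eta>1 > 0" "S1 > 0" "\<forall>\<theta>\<in>evaluations. slow \<theta> \<eta>1 S1 \<longrightarrow> (\<forall>z\<in>Z. Q z \<theta>)"
    using insert by (metis insertI2)
  obtain \<eta>2 S2 where 2: "\<eta>2 > 0" "S2 > 0" "\<forall>\<theta>\<in>evaluations. slow \<theta> \<eta>2 S2 \<longrightarrow> Q z \<theta>"
    using insert.prems by (metis insertI1)
  show ?case
  proof (intro exI conjI ballI impI)
    show "min \<eta>1 \<eta>2 > 0" "max S1 S2 > 0" using 1 2 by auto
    fix \<theta> w assume "\<theta> \<in> evaluations" "slow \<theta> (min \<eta>1 \<eta>2) (max S1 S2)" "w \<in> insert z Z"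
    moreover from this have "slow \<theta> \<eta>1 S1" "slow \<theta> \<eta>2 S2" by (auto elim: slow_mono)
    ultimately show "Q w \<theta>" using 1(3) 2(3) by blast
  qed
qed

text \<open>Let \<open>Q1\<close> be the set of times that the shift sends into \<open>Q\<close>.
  Its translate is only the part of \<open>Q\<close> beyond \<open>s\<close>, which costs one
  \<eta>. The part before \<open>s\<close> has mass at most \<eta>, by the total variation bound on
  the whole half-line. The law of the shifted time is thus within \<open>2 * \<eta>\<close> of
  \<theta>, and \<open>integral_diff_le\<close> multiplies this by \<open>2 * B\<close>.\<close>

lemma TV_shift:
  fixes h :: "real \<Rightarrow> real"
  assumes th: "\<theta> \<in> evaluations" and s: "s \<ge> 0" and tv: "TV s \<theta> \<le> \<eta>"
    and h: "h \<in> borel_measurable borel" and B: "B > 0" "\<And>t. \<bar>h t\<bar> \<le> B"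
  shows "\<bar>(\<integral>t. h (t + s) \<partial>\<theta>) - (\<integral>t. h t \<partial>\<theta>)\<bar> \<le> 4 * B * \<eta>"
proof -
  interpret prob_space \<theta> by (rule evaluationsD(1)[OF th])
  note sp = evaluationsD(3)[OF th] and st = evaluationsD(2)[OF th]
  have ms: "(\<lambda>t. t + s) \<in> \<theta> \<rightarrow>\<^sub>M nonneg_borel"
    using s evaluationsD(4)[OF th] sp by (intro measurable_restrict_space2) auto
  define M where "M = distr \<theta> nonneg_borel (\<lambda>t. t + s)"
  have M: "prob_space M" unfolding M_def by (rule prob_space_distr[OF ms])
  have setsM: "sets M = sets \<theta>" by (simp add: M_def st)
  have diff: "\<bar>measure M Q - measure \<theta> Q\<bar> \<le> 2 * \<eta>" if Q: "Q \<in> sets M" for Q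
  proof -
    have Q': "Q \<in> sets nonneg_borel" using Q setsM st by simp
    define Q1 where "Q1 = (\<lambda>t. t + s) -` Q \<inter> space \<theta>"
    have Q1: "Q1 \<in> sets nonneg_borel" using measurable_sets[OF ms Q'] by (simp add: Q1_def st)
    have mM: "measure M Q = prob Q1" unfolding M_def Q1_def by (rule measure_distr[OF ms Q'])
    have Qsub: "Q \<subseteq> {0..}" using Q' by (auto simp: sets_restrict_space)
    have im: "(\<lambda>t. t + s) ` Q1 = Q \<inter> {s..}"
    proof (intro set_eqI iffI)
      fix t assume "t \<in> Q \<inter> {s..}"
      then have "t - s \<in> Q1" by (auto simp: Q1_def sp)
      then show "t \<in> (\<lambda>t. t + s) ` Q1" by (intro image_eqI[of _ _ "t - s"]) auto
    qed (auto simp: Q1_def sp)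
    have imU: "(\<lambda>t. t + s) ` {0..} = {s..}" by (intro set_eqI) (auto intro!: image_eqI[of _ _ "_ - s"])
    have t1: "\<bar>prob Q1 - prob (Q \<inter> {s..})\<bar> \<le> \<eta>" using TV_upper[OF th Q1, of s] tv by (simp add: im)
    have "{0..} \<in> sets nonneg_borel" by (metis sets.top sp st sets_eq_imp_space_eq)
    from TV_upper[OF th this, of s] have "\<bar>prob {0..} - prob {s..}\<bar> \<le> \<eta>" using tv by (simp add: imU)
    then have t2: "1 - prob {s..} \<le> \<eta>" using prob_space sp by auto
    have sS: "{s..} \<in> sets \<theta>" unfolding st sets_restrict_space using s by (intro image_eqI[of _ _ "{s..}"]) auto
    have QS: "Q \<in> sets \<theta>" using Q setsM by simp
    have "prob Q = prob (Q \<inter> {s..}) + prob (Q - {s..})"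
      using finite_measure_Union[of "Q \<inter> {s..}" "Q - {s..}"] sS QS by (simp add: Int_Diff_Un Int_Diff_disjoint sets.Int sets.Diff)
    moreover have "prob (Q - {s..}) \<le> prob (space \<theta> - {s..})"
      using Qsub sp by (intro finite_measure_mono sets.compl_sets[OF sS]) auto
    moreover have "prob (space \<theta> - {s..}) = 1 - prob {s..}" by (rule prob_compl[OF sS])
    moreover have "prob (Q - {s..}) \<ge> 0" by simp
    ultimately show ?thesis using t1 t2 mM unfolding abs_le_iff by linarith
  qed
  have hM: "h \<in> borel_measurable M"
    using evaluation_measurable[OF th h] measurable_cong_sets[OF setsM refl] by blast
  have "\<bar>(\<integral>x. h x \<partial>M) - (\<integral>x. h x \<partial>\<theta>)\<bar> \<le> 2 * B * (2 * \<eta>)"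
    by (rule integral_diff_le[OF M _ setsM hM B(2) B(1) diff]) (rule prob_space_axioms)
  moreover have "(\<integral>x. h x \<partial>M) = (\<integral>t. h (t + s) \<partial>\<theta>)"
    unfolding M_def by (rule integral_distr[OF ms]) (rule measurable_restrict_space1[OF h])
  ultimately show ?thesis by simp
qed

section \<open>The general limit value\<close>

lemma evaluations_nonempty: "evaluations \<noteq> {}"
proof -
  have "return nonneg_borel 0 \<in> evaluations"
    by (auto simp: evaluations_def space_restrict_space intro: prob_space_return)
  then show ?thesis by blast
qed

lemma evaluation_tail:
  assumes th: "\<theta> \<in> evaluations" and e: "e > 0"
  shows "\<exists>S>0. measure \<theta> {S<..} \<le> e"
proof -
  interpret prob_space \<theta> by (rule evaluationsD(1)[OF th])
  have sets: "{real k<..} \<in> sets \<theta>" for k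
    unfolding evaluationsD(2)[OF th] sets_restrict_space by (intro image_eqI[of _ _ "{real k<..}"]) auto
  have "(\<lambda>k. prob {real k<..}) \<longlonglongrightarrow> prob (\<Inter>k. {real k<..})"
    using sets by (intro finite_Lim_measure_decseq) (auto simp: decseq_def)
  also have "(\<Inter>k. {real k<..}) = {}"
    by (auto simp: set_eq_iff not_less) (meson reals_Archimedean2 less_imp_le)
  finally have "(\<lambda>k. prob {real k<..}) \<longlonglongrightarrow> 0" by simp
  then have "eventually (\<lambda>k. prob {real k<..} < e) sequentially" using e by (rule order_tendstoD(2))
  then obtain K where K: "\<And>k. k \<ge> K \<Longrightarrow> prob {real k<..} < e" unfolding eventually_sequentially by blast
  show ?thesis using K[of "Suc K"] by (intro exI[of _ "real (Suc K)"]) auto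
qed

context nonexpansive_control
begin

section \<open>Costs along trajectories and the value functions built from them\<close>

abbreviation G :: "real^'n \<Rightarrow> real" where "G \<equiv> state_cost U g"

lemma G_eq:
  assumes u: "u \<in> U"
  shows "g y u = G y"
proof -
  have "\<forall>y. \<forall>u\<in>U. \<forall>v\<in>U. g y u = g y v"
    using nonexpansive unfolding compact_nonexpansive_def by blast
  then have eq: "\<forall>v\<in>U. g y v = g y u" using u by blast
  show ?thesis unfolding state_cost_def
  proof (rule the_equality[symmetric])
    show "r = g y u" if "\<forall>v\<in>U. g y v = r" for r using that u by simp
  qed (rule eq)
qed

lemma ex_G_bound: "\<exists>B. B > 0 \<and> (\<forall>y. \<bar>G y\<bar> \<le> B)"
proof -
  obtain u where u: "u \<in> U" using problem unfolding control_problem_def by blast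
  obtain C where C: "\<forall>y. \<forall>u\<in>U. \<bar>g y u\<bar> \<le> C" using problem unfolding control_problem_def by blast
  have "\<bar>G y\<bar> \<le> \<bar>C\<bar> + 1" for y
    using C[rule_format, OF u, of y] unfolding G_eq[OF u] by linarith
  then show ?thesis by (intro exI[of _ "\<bar>C\<bar> + 1"]) auto
qed

definition cost_sup :: real where "cost_sup = (SOME B. B > 0 \<and> (\<forall>y. \<bar>G y\<bar> \<le> B))"

lemma cost_sup: "cost_sup > 0" "\<bar>G y\<bar> \<le> cost_sup"
  using someI_ex[OF ex_G_bound] unfolding cost_sup_def[symmetric] by auto

lemma G_continuous: "continuous_on Y G"
  using nonexpansive unfolding compact_nonexpansive_def by blast

lemma G_uniform:
  assumes "e > 0"
  shows "\<exists>d>0. \<forall>x\<in>Y. \<forall>z\<in>Y. norm (x - z) \<le> d \<longrightarrow> \<bar>G x - G z\<bar> \<le> e"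
proof -
  obtain d where d: "d > 0" "\<And>x z. x \<in> Y \<Longrightarrow> z \<in> Y \<Longrightarrow> dist z x < d \<Longrightarrow> dist (G z) (G x) < e"
    using compact_uniformly_continuous[OF G_continuous compact_Y] assms
    unfolding uniformly_continuous_on_def by metis
  have "\<bar>G x - G z\<bar> \<le> e" if "x \<in> Y" "z \<in> Y" "norm (x - z) \<le> d / 2" for x z
    using d(2)[OF that(2,1)] that(3) d(1) by (simp add: dist_norm)
  then show ?thesis using d(1) by (intro exI[of _ "d / 2"]) auto
qed

text \<open>Trajectories are unspecified at negative times; freezing the time at 0 gives a
  continuous function on the whole line.\<close>

definition cost :: "(real \<Rightarrow> 'u) \<Rightarrow> real^'n \<Rightarrow> real \<Rightarrow> real" where
  "cost u x t = G (traj u x (max 0 t))"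

lemma cost_bound: "\<bar>cost u x t\<bar> \<le> cost_sup"
  by (simp add: cost_def cost_sup)

lemma cost_continuous:
  assumes x: "x \<in> Y" and u: "u \<in> controls U"
  shows "continuous_on UNIV (cost u x)"
proof -
  have 1: "continuous_on UNIV (\<lambda>t. traj u x (max 0 t))"
  proof -
    have "(\<lambda>t. max 0 t) ` UNIV \<subseteq> {0::real..}" by auto
    moreover have "continuous_on UNIV (\<lambda>t::real. max 0 t)" by (intro continuous_intros)
    ultimately show ?thesis using continuous_on_compose2[OF traj_continuous[OF u]] by blast
  qed
  have 2: "(\<lambda>t. traj u x (max 0 t)) ` UNIV \<subseteq> Y" using traj_in_Y[OF x u] by auto
  show ?thesis
    unfolding cost_def[abs_def] by (rule continuous_on_compose2[OF G_continuous 1 2])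
qed

lemma cost_measurable: "x \<in> Y \<Longrightarrow> u \<in> controls U \<Longrightarrow> cost u x \<in> borel_measurable borel"
  by (intro borel_measurable_continuous_onI cost_continuous)

lemma cost_measurable_shift:
  assumes "x \<in> Y" "u \<in> controls U"
  shows "(\<lambda>t. cost u x (t + s)) \<in> borel_measurable borel"
  by (rule measurable_compose[OF _ cost_measurable[OF assms]]) simp

lemma cost_shift:
  assumes "u \<in> controls U" "s \<ge> 0" "t \<ge> 0"
  shows "cost u x (t + s) = cost (\<lambda>r. u (s + r)) (traj u x s) t"
  using assms traj_shift[OF assms, of x] by (simp add: cost_def add.commute)

definition mean_cost :: "real measure \<Rightarrow> (real \<Rightarrow> 'u) \<Rightarrow> real^'n \<Rightarrow> real" where
  "mean_cost \<theta> u x = (\<integral>t. cost u x t \<partial>\<theta>)"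

definition val :: "real measure \<Rightarrow> real^'n \<Rightarrow> real" where
  "val \<theta> x = (INF u\<in>controls U. mean_cost \<theta> u x)"

definition tail_val :: "real measure \<Rightarrow> real^'n \<Rightarrow> real" where
  "tail_val \<theta> x = (INF s\<in>{0..}. INF u\<in>controls U. \<integral>t. cost u x (t + s) \<partial>\<theta>)"

definition limval :: "real^'n \<Rightarrow> real" where
  "limval x = (SUP \<theta>\<in>evaluations. tail_val \<theta> x)"

lemma payoff_eq_mean_cost:
  assumes th: "\<theta> \<in> evaluations" and u: "u \<in> controls U"
  shows "payoff f g \<theta> x u = mean_cost \<theta> u x"
  unfolding payoff_def mean_cost_def
  by (rule Bochner_Integration.integral_cong[OF refl])
    (use controls_in[OF u] evaluationsD(3)[OF th] in \<open>auto simp: cost_def G_eq\<close>)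

lemma value_fun_eq: "\<theta> \<in> evaluations \<Longrightarrow> value_fun U f g \<theta> x = val \<theta> x"
  unfolding value_fun_def val_def by (intro INF_cong refl payoff_eq_mean_cost)

lemma limval_eq:
  "limval x = (SUP \<theta>\<in>evaluations. INF s\<in>{0..}. INF u\<in>controls U. \<integral>t. G (traj u x (t + s)) \<partial>\<theta>)"
  unfolding limval_def tail_val_def
proof (intro SUP_cong INF_cong refl Bochner_Integration.integral_cong)
  fix \<theta> s u t assume "\<theta> \<in> evaluations" "s \<in> {0::real..}" "t \<in> space \<theta>"
  then show "cost u x (t + s) = G (traj u x (t + s))"
    using evaluationsD(3) by (auto simp: cost_def)
qed

lemma mean_cost_abs_le: "\<theta> \<in> evaluations \<Longrightarrow> x \<in> Y \<Longrightarrow> u \<in> controls U \<Longrightarrow> \<bar>mean_cost \<theta> u x\<bar> \<le> cost_sup"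
  unfolding mean_cost_def by (intro evaluation_integral_abs_le cost_measurable cost_bound)

lemma tail_abs_le:
  "\<theta> \<in> evaluations \<Longrightarrow> x \<in> Y \<Longrightarrow> u \<in> controls U \<Longrightarrow> \<bar>\<integral>t. cost u x (t + s) \<partial>\<theta>\<bar> \<le> cost_sup"
  by (intro evaluation_integral_abs_le cost_measurable_shift cost_bound)

lemma val_le: 
  assumes "\<theta> \<in> evaluations" "x \<in> Y" "u \<in> controls U"
  shows "val \<theta> x \<le> mean_cost \<theta> u x"
  unfolding val_def
proof (rule cINF_lower[OF _ assms(3)], rule bdd_belowI2)
  show "- cost_sup \<le> mean_cost \<theta> v x" if "v \<in> controls U" for v using mean_cost_abs_le[OF assms(1,2) that] by linarith
qed

lemma val_greatest: "(\<And>u. u \<in> controls U \<Longrightarrow> m \<le> mean_cost \<theta> u x) \<Longrightarrow> m \<le> val \<theta> x"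
  unfolding val_def using controls_nonempty by (rule cINF_greatest)

lemma val_approx:
  assumes "\<theta> \<in> evaluations" "x \<in> Y" "e > 0"
  shows "\<exists>u\<in>controls U. mean_cost \<theta> u x < val \<theta> x + e"
proof (rule ccontr)
  assume "\<not> ?thesis"
  then have "val \<theta> x + e \<le> val \<theta> x" by (intro val_greatest) (auto simp: not_less)
  then show False using assms(3) by simp
qed

lemma tail_inner_bdd:
  assumes "\<theta> \<in> evaluations" "x \<in> Y"
  shows "bdd_below ((\<lambda>u. \<integral>t. cost u x (t + s) \<partial>\<theta>) ` controls U)"
proof (rule bdd_belowI2)
  show "- cost_sup \<le> (\<integral>t. cost v x (t + s) \<partial>\<theta>)" if "v \<in> controls U" for v
    using tail_abs_le[OF assms that, of s] by linarith
qed

lemma tail_inner_ge: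
  assumes "\<theta> \<in> evaluations" "x \<in> Y"
  shows "- cost_sup \<le> (INF u\<in>controls U. \<integral>t. cost u x (t + s) \<partial>\<theta>)"
proof (rule cINF_greatest[OF controls_nonempty])
  show "- cost_sup \<le> (\<integral>t. cost v x (t + s) \<partial>\<theta>)" if "v \<in> controls U" for v
    using tail_abs_le[OF assms that, of s] by linarith
qed

lemma tail_val_le:
  assumes "\<theta> \<in> evaluations" "x \<in> Y" "u \<in> controls U" "s \<ge> 0"
  shows "tail_val \<theta> x \<le> (\<integral>t. cost u x (t + s) \<partial>\<theta>)"
proof -
  have "tail_val \<theta> x \<le> (INF u\<in>controls U. \<integral>t. cost u x (t + s) \<partial>\<theta>)"
    unfolding tail_val_def using assms(4)
    by (intro cINF_lower bdd_belowI2[of _ "- cost_sup"] tail_inner_ge[OF assms(1,2)]) auto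
  also have "\<dots> \<le> (\<integral>t. cost u x (t + s) \<partial>\<theta>)"
    by (rule cINF_lower[OF tail_inner_bdd[OF assms(1,2)] assms(3)])
  finally show ?thesis .
qed

lemma tail_val_greatest:
  assumes "\<And>s u. s \<ge> 0 \<Longrightarrow> u \<in> controls U \<Longrightarrow> m \<le> (\<integral>t. cost u x (t + s) \<partial>\<theta>)"
  shows "m \<le> tail_val \<theta> x"
  unfolding tail_val_def using controls_nonempty assms by (intro cINF_greatest) auto

lemma tail_val_upper:
  assumes "\<theta> \<in> evaluations" "x \<in> Y"
  shows "tail_val \<theta> x \<le> cost_sup"
proof -
  obtain u where u: "u \<in> controls U" using controls_nonempty by blast
  from tail_val_le[OF assms u, of 0] tail_abs_le[OF assms u, of 0] show ?thesis by simp
qed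

lemma limval_ge:
  assumes "\<theta> \<in> evaluations" "x \<in> Y"
  shows "tail_val \<theta> x \<le> limval x"
  unfolding limval_def
  by (rule cSUP_upper[OF assms(1)]) (intro bdd_aboveI2[of _ _ cost_sup] tail_val_upper assms)

lemma limval_least: "(\<And>\<theta>. \<theta> \<in> evaluations \<Longrightarrow> tail_val \<theta> x \<le> m) \<Longrightarrow> limval x \<le> m"
  unfolding limval_def using evaluations_nonempty by (rule cSUP_least)

lemma limval_approx:
  assumes "e > 0"
  shows "\<exists>\<theta>\<in>evaluations. limval x - e < tail_val \<theta> x"
proof (rule ccontr)
  assume "\<not> ?thesis"
  then have "limval x \<le> limval x - e" by (intro limval_least) (auto simp: not_less)
  then show False using assms by simp
qed

lemma cost_shadowing:
  assumes e: "e > 0"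
  shows "\<exists>d>0. \<forall>x\<in>Y. \<forall>z\<in>Y. norm (x - z) \<le> d \<longrightarrow>
    (\<forall>u\<in>controls U. \<exists>v\<in>controls U. \<forall>t\<ge>0. \<bar>cost v x t - cost u z t\<bar> \<le> e)"
proof -
  obtain d where d: "d > 0" "\<And>x z. x \<in> Y \<Longrightarrow> z \<in> Y \<Longrightarrow> norm (x - z) \<le> d \<Longrightarrow> \<bar>G x - G z\<bar> \<le> e"
    using G_uniform[OF e] by blast
  show ?thesis
  \<comment> \<open>One half of \<open>d\<close> is left for the initial distance, the other for the
    tracking error.\<close>
  proof (intro exI[of _ "d / 2"] conjI ballI impI)
    fix x z u assume x: "x \<in> Y" and z: "z \<in> Y" and n: "norm (x - z) \<le> d / 2" and u: "u \<in> controls U"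
    obtain v where v: "v \<in> controls U" "\<And>t. t \<ge> 0 \<Longrightarrow> norm (traj v x t - traj u z t) \<le> norm (x - z) + d / 2"
      using shadowing[OF x z u, of "d / 2"] d(1) by auto
    have "\<bar>cost v x t - cost u z t\<bar> \<le> e" if t: "t \<ge> 0" for t
      unfolding cost_def using v(2)[OF t] n t by (intro d(2) traj_in_Y x z u v(1)) auto
    then show "\<exists>v\<in>controls U. \<forall>t\<ge>0. \<bar>cost v x t - cost u z t\<bar> \<le> e" using v(1) by blast
  qed (use d in simp)
qed

text \<open>The modulus does not depend on \<theta>, because a shadowing control reproduces the cost
  up to \<open>e\<close> at all times simultaneously.\<close>

lemma equicontinuity:
  assumes e: "e > 0"
  shows "\<exists>d>0. \<forall>x\<in>Y. \<forall>z\<in>Y. norm (x - z) \<le> d \<longrightarrow>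
    (\<forall>\<theta>\<in>evaluations. val \<theta> x \<le> val \<theta> z + e) \<and> limval x \<le> limval z + e"
proof -
  obtain d where d: "d > 0" "\<forall>x\<in>Y. \<forall>z\<in>Y. norm (x - z) \<le> d \<longrightarrow>
    (\<forall>u\<in>controls U. \<exists>v\<in>controls U. \<forall>t\<ge>0. \<bar>cost v x t - cost u z t\<bar> \<le> e)"
    using cost_shadowing[OF e] by blast
  show ?thesis
  proof (intro exI[of _ d] conjI ballI impI)
    fix x z assume x: "x \<in> Y" and z: "z \<in> Y" and n: "norm (x - z) \<le> d"
    have sh: "\<exists>v\<in>controls U. \<forall>t\<ge>0. \<bar>cost v x t - cost u z t\<bar> \<le> e" if "u \<in> controls U" for u
      using d(2) x z n that by blast
    {
      fix \<theta> assume th: "\<theta> \<in> evaluations"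
      have "val \<theta> x - e \<le> val \<theta> z"
      proof (rule val_greatest)
        fix u assume u: "u \<in> controls U"
        obtain v where v: "v \<in> controls U" "\<forall>t\<ge>0. \<bar>cost v x t - cost u z t\<bar> \<le> e" using sh[OF u] by blast
        have "val \<theta> x \<le> mean_cost \<theta> v x" by (rule val_le[OF th x v(1)])
        also have "\<dots> \<le> mean_cost \<theta> u z + e"
          unfolding mean_cost_def
        proof (rule evaluation_integral_le[OF th cost_measurable[OF x v(1)] cost_bound cost_measurable[OF z u] cost_bound])
          fix t :: real assume "t \<ge> 0"
          then have "\<bar>cost v x t - cost u z t\<bar> \<le> e" using v(2) by blast
          then show "cost v x t \<le> cost u z t + e" by linarith
        qed
        finally show "val \<theta> x - e \<le> mean_cost \<theta> u z" by simp
      qed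
      then show "val \<theta> x \<le> val \<theta> z + e" by simp
    }
    show "limval x \<le> limval z + e"
    proof (rule limval_least)
      fix \<theta> assume th: "\<theta> \<in> evaluations"
      have "tail_val \<theta> x - e \<le> tail_val \<theta> z"
      proof (rule tail_val_greatest)
        fix s u assume s: "s \<ge> (0::real)" and u: "u \<in> controls U"
        obtain v where v: "v \<in> controls U" "\<forall>t\<ge>0. \<bar>cost v x t - cost u z t\<bar> \<le> e" using sh[OF u] by blast
        have "tail_val \<theta> x \<le> (\<integral>t. cost v x (t + s) \<partial>\<theta>)" by (rule tail_val_le[OF th x v(1) s])
        also have "\<dots> \<le> (\<integral>t. cost u z (t + s) \<partial>\<theta>) + e"
        proof (rule evaluation_integral_le[OF th cost_measurable_shift[OF x v(1)] cost_bound cost_measurable_shift[OF z u] cost_bound])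
          fix t :: real assume "t \<ge> 0"
          then have "t + s \<ge> 0" using s by simp
          then have "\<bar>cost v x (t + s) - cost u z (t + s)\<bar> \<le> e" using v(2) by blast
          then show "cost v x (t + s) \<le> cost u z (t + s) + e" by linarith
        qed
        finally show "tail_val \<theta> x - e \<le> (\<integral>t. cost u z (t + s) \<partial>\<theta>)" by simp
      qed
      then show "tail_val \<theta> x \<le> limval z + e" using limval_ge[OF th z] by linarith
    qed
  qed (rule d(1))
qed

text \<open>The cost at t + s is integrated over \<theta> in t and over \<nu> in s. For fixed t,
  integration over \<nu> gives at least \<open>tail_val \<nu> x\<close>. For fixed s up to
  \<open>S\<close>, integration over \<theta> gives nearly the mean cost, as \<theta> hardly feels
  the shift. Fubini's theorem compares the two.\<close>

lemma value_lower_bound: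
  assumes x: "x \<in> Y" and nu: "\<nu> \<in> evaluations" and e: "e > 0"
  shows "\<exists>\<eta>>0. \<exists>S>0. \<forall>\<theta>\<in>evaluations. slow \<theta> \<eta> S \<longrightarrow> tail_val \<nu> x \<le> val \<theta> x + e"
proof -
  interpret N: prob_space \<nu> by (rule evaluationsD(1)[OF nu])
  \<comment> \<open>\<open>TV_shift\<close> loses \<open>4 * cost_sup * \<eta>\<close>, half of
    \<open>e\<close>. The other half pays for shifts beyond \<open>S\<close>, where the integrals
    may differ by \<open>2 * cost_sup\<close>.\<close>
  define \<eta> where "\<eta> = e / (8 * cost_sup)"
  have \<eta>: "\<eta> > 0" "4 * cost_sup * \<eta> = e / 2" using e cost_sup(1) by (auto simp: \<eta>_def)
  have "e / (4 * cost_sup) > 0" using e cost_sup(1) by simp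
  then obtain S where S: "S > 0" "measure \<nu> {S<..} \<le> e / (4 * cost_sup)"
    using evaluation_tail[OF nu] by blast
  have tail: "2 * cost_sup * measure \<nu> {S<..} \<le> e / 2"
    using S(2) cost_sup(1) by (simp add: field_simps)
  have sS: "{S<..} \<in> sets \<nu>"
    unfolding evaluationsD(2)[OF nu] sets_restrict_space using S by (intro image_eqI[of _ _ "{S<..}"]) auto
  have "\<forall>\<theta>\<in>evaluations. slow \<theta> \<eta> S \<longrightarrow> tail_val \<nu> x \<le> val \<theta> x + e"
  proof (intro ballI impI)
    fix \<theta> assume th: "\<theta> \<in> evaluations" and slow: "slow \<theta> \<eta> S"
    interpret T: prob_space \<theta> by (rule evaluationsD(1)[OF th])
    interpret P: pair_prob_space \<theta> \<nu> by unfold_locales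
    have "tail_val \<nu> x - e \<le> val \<theta> x"
    proof (rule val_greatest)
      fix u assume u: "u \<in> controls U"
      let ?h = "cost u x"
      note hm = cost_measurable[OF x u]
      have pm: "(\<lambda>(t, s). ?h (t + s)) \<in> borel_measurable (\<theta> \<Otimes>\<^sub>M \<nu>)"
      proof -
        have "(\<lambda>p. fst p + snd p) \<in> borel_measurable (\<theta> \<Otimes>\<^sub>M \<nu>)"
          by (intro borel_measurable_add measurable_compose[OF measurable_fst evaluationsD(4)[OF th]]
              measurable_compose[OF measurable_snd evaluationsD(4)[OF nu]])
        from measurable_compose[OF this hm] show ?thesis by (simp add: split_def)
      qed
      have pint: "integrable (\<theta> \<Otimes>\<^sub>M \<nu>) (\<lambda>(t, s). ?h (t + s))"
        using pm cost_bound by (intro P.integrable_const_bound[of _ cost_sup]) (auto simp: split_def)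
      have swap: "(\<integral>s. (\<integral>t. ?h (t + s) \<partial>\<theta>) \<partial>\<nu>) = (\<integral>t. (\<integral>s. ?h (t + s) \<partial>\<nu>) \<partial>\<theta>)"
        using P.Fubini_integral[OF pint] by simp
      have i1: "integrable \<theta> (\<lambda>t. \<integral>s. ?h (t + s) \<partial>\<nu>)"
        using P.integrable_fst[OF pint] .
      have i2: "integrable \<nu> (\<lambda>s. \<integral>t. ?h (t + s) \<partial>\<theta>)"
        using P.integrable_snd[OF pint] .
      have "tail_val \<nu> x = (\<integral>t. tail_val \<nu> x \<partial>\<theta>)" by (simp add: T.prob_space)
      also have "\<dots> \<le> (\<integral>t. (\<integral>s. ?h (t + s) \<partial>\<nu>) \<partial>\<theta>)"
      proof (intro integral_mono i1)
        fix t assume "t \<in> space \<theta>"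
        then show "tail_val \<nu> x \<le> (\<integral>s. ?h (t + s) \<partial>\<nu>)"
          using tail_val_le[OF nu x u, of t] evaluationsD(3)[OF th] by (simp add: add.commute)
      qed simp
      also have "\<dots> = (\<integral>s. (\<integral>t. ?h (t + s) \<partial>\<theta>) \<partial>\<nu>)" by (rule swap[symmetric])
      also have "\<dots> \<le> (\<integral>s. mean_cost \<theta> u x + e / 2 + 2 * cost_sup * indicator {S<..} s \<partial>\<nu>)"
      proof (intro integral_mono i2)
        show "integrable \<nu> (\<lambda>s. mean_cost \<theta> u x + e / 2 + 2 * cost_sup * indicator {S<..} s)"
          using sS by (intro Bochner_Integration.integrable_add integrable_mult_right integrable_real_indicator)
            (auto simp: less_top[symmetric])
        fix s assume s: "s \<in> space \<nu>"
        show "(\<integral>t. ?h (t + s) \<partial>\<theta>) \<le> mean_cost \<theta> u x + e / 2 + 2 * cost_sup * indicator {S<..} s"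
        proof (cases "s \<le> S")
          case True
          then have "TV s \<theta> \<le> \<eta>" using slow s evaluationsD(3)[OF nu] by (auto simp: slow_def)
          from TV_shift[OF th _ this hm cost_sup(1) cost_bound] s evaluationsD(3)[OF nu]
          have "\<bar>(\<integral>t. ?h (t + s) \<partial>\<theta>) - mean_cost \<theta> u x\<bar> \<le> e / 2" by (auto simp: mean_cost_def \<eta>(2))
          then have "(\<integral>t. ?h (t + s) \<partial>\<theta>) \<le> mean_cost \<theta> u x + e / 2" by linarith
          then show ?thesis using True by (simp add: indicator_def)
        next
          case False
          then show ?thesis using tail_abs_le[OF th x u, of s] mean_cost_abs_le[OF th x u] e by (auto simp: indicator_def)
        qed
      qed
      also have "\<dots> = mean_cost \<theta> u x + e / 2 + 2 * cost_sup * measure \<nu> {S<..}"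
        using sS by (subst Bochner_Integration.integral_add) (auto simp: N.prob_space less_top[symmetric])
      finally show "tail_val \<nu> x - e \<le> mean_cost \<theta> u x" using tail by linarith
    qed
    then show "tail_val \<nu> x \<le> val \<theta> x + e" by simp
  qed
  then show ?thesis using \<eta>(1) S(1) by blast
qed

text \<open>Shifting time by \<open>s\<close> deletes the phase governed by \<open>u\<close>, so for
  slow \<theta> moving first to another state is almost free.\<close>

lemma mean_cost_concat_le:
  assumes x: "x \<in> Y" and th: "\<theta> \<in> evaluations" and s: "s \<ge> 0" and tv: "TV s \<theta> \<le> \<eta>"
    and u: "u \<in> controls U" and v: "v \<in> controls U"
  shows "mean_cost \<theta> (concat_control s u v) x \<le> mean_cost \<theta> v (traj u x s) + 4 * cost_sup * \<eta>"
proof -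
  let ?w = "concat_control s u v"
  have w: "?w \<in> controls U" by (rule concat_control[OF u v])
  have "\<bar>(\<integral>t. cost ?w x (t + s) \<partial>\<theta>) - mean_cost \<theta> ?w x\<bar> \<le> 4 * cost_sup * \<eta>"
    unfolding mean_cost_def by (rule TV_shift[OF th s tv cost_measurable[OF x w] cost_sup(1) cost_bound])
  moreover have "(\<integral>t. cost ?w x (t + s) \<partial>\<theta>) = mean_cost \<theta> v (traj u x s)"
    unfolding mean_cost_def
  proof (rule Bochner_Integration.integral_cong[OF refl])
    fix t assume "t \<in> space \<theta>"
    then have "t \<ge> 0" using evaluationsD(3)[OF th] by simp
    then show "cost ?w x (t + s) = cost v (traj u x s) t"
      using traj_concat_after[OF u v s, of t x] s by (simp add: cost_def add.commute)
  qed
  ultimately show ?thesis by linarith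
qed

text \<open>The reachable set need not be closed. Its closure is compact and is covered by balls
  around points of the set itself, so the finitely many centres come with controls and times that
  reach them.\<close>

lemma finite_reach:
  assumes x: "x \<in> Y" and d: "d > 0"
  shows "\<exists>F. finite F \<and> F \<subseteq> controls U \<times> {0..} \<and> (\<forall>u\<in>controls U. \<forall>s\<ge>0.
    \<exists>(v, r)\<in>F. norm (traj u x s - traj v x r) \<le> d)"
proof -
  define R where "R = (\<lambda>(u, s). traj u x s) ` (controls U \<times> {0..})"
  have "R \<subseteq> Y" using traj_in_Y[OF x] by (auto simp: R_def)
  then have "compact (closure R)"
    using bounded_subset[OF compact_imp_bounded[OF compact_Y]] by (simp add: compact_closure)
  moreover have "closure R \<subseteq> (\<Union>z\<in>R. ball z d)"
    using d by (force simp: closure_approachable dist_commute)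
  ultimately obtain C where C: "C \<subseteq> R" "finite C" "closure R \<subseteq> (\<Union>z\<in>C. ball z d)"
    using compactE_image[of "closure R" R "\<lambda>z. ball z d"] by auto
  from finite_subset_image[OF C(2) C(1)[unfolded R_def]] obtain F where
    F: "F \<subseteq> controls U \<times> {0..}" "finite F" "C = (\<lambda>(u, s). traj u x s) ` F" by blast
  show ?thesis
  proof (intro exI[of _ F] conjI ballI allI impI F)
    fix u s assume "u \<in> controls U" "s \<ge> (0::real)"
    then have "traj u x s \<in> R" by (auto simp: R_def)
    then have "traj u x s \<in> (\<Union>z\<in>C. ball z d)" using C(3) closure_subset by blast
    then obtain v r where "(v, r) \<in> F" "dist (traj v x r) (traj u x s) < d" unfolding F(3) by auto
    then show "\<exists>(v, r)\<in>F. norm (traj u x s - traj v x r) \<le> d"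
      by (intro bexI[of _ "(v, r)"]) (auto simp: dist_norm norm_minus_commute)
  qed
qed

text \<open>A tail starting at time s is a mean cost from the state at s, hence at least the value
  there. That state may be reached late, but it is near one of finitely many states reached within
  bounded times, to which moving is almost free. So the value at \<open>x\<close> nearly bounds from
  below every tail integral of \<theta>, that is, it is at most
  \<open>tail_val \<theta> x + e\<close>.\<close>

lemma value_upper_bound:
  assumes x: "x \<in> Y" and e: "e > 0"
  shows "\<exists>\<eta>>0. \<exists>S>0. \<forall>\<theta>\<in>evaluations. slow \<theta> \<eta> S \<longrightarrow> val \<theta> x \<le> limval x + e"
proof -
  have e3: "e / 3 > 0" using e by simp
  obtain d where d: "d > 0" "\<And>y z \<theta>. y \<in> Y \<Longrightarrow> z \<in> Y \<Longrightarrow> norm (y - z) \<le> d \<Longrightarrow> \<theta> \<in> evaluations \<Longrightarrow>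
    val \<theta> y \<le> val \<theta> z + e / 3" using equicontinuity[OF e3] by blast
  obtain F where F': "finite F \<and> F \<subseteq> controls U \<times> {0..} \<and> (\<forall>u\<in>controls U. \<forall>s\<ge>0.
    \<exists>(v, r)\<in>F. norm (traj u x s - traj v x r) \<le> d)"
    using finite_reach[OF x d(1)] ..
  then have F: "finite F" "F \<subseteq> controls U \<times> {0..}"
    "\<forall>u\<in>controls U. \<forall>s\<ge>0. \<exists>(v, r)\<in>F. norm (traj u x s - traj v x r) \<le> d" by simp_all
  define \<eta> where "\<eta> = e / (12 * cost_sup)"
  have \<eta>: "\<eta> > 0" "4 * cost_sup * \<eta> = e / 3" using e cost_sup(1) by (auto simp: \<eta>_def)
  have "\<exists>\<eta>>0. \<exists>S>0. \<forall>\<theta>\<in>evaluations. slow \<theta> \<eta> S \<longrightarrow>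
      (\<forall>p\<in>F. val \<theta> x \<le> val \<theta> (traj (fst p) x (snd p)) + e / 3)"
  proof (rule slow_finite[OF F(1)])
    fix p assume p: "p \<in> F"
    obtain v r where vr: "p = (v, r)" by (cases p)
    have v: "v \<in> controls U" "r \<ge> 0" using p F(2) vr by auto
    \<comment> \<open>The horizon \<open>r + 1\<close> is positive even when \<open>r\<close> is
      zero.\<close>
    have "\<forall>\<theta>\<in>evaluations. slow \<theta> \<eta> (r + 1) \<longrightarrow> val \<theta> x \<le> val \<theta> (traj (fst p) x (snd p)) + e / 3"
    proof (intro ballI impI)
      fix \<theta> assume th: "\<theta> \<in> evaluations" and slow: "slow \<theta> \<eta> (r + 1)"
      have tv: "TV r \<theta> \<le> \<eta>" using slow v by (auto simp: slow_def)
      have "val \<theta> x - e / 3 \<le> val \<theta> (traj v x r)"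
      proof (rule val_greatest)
        fix w assume w: "w \<in> controls U"
        have "val \<theta> x \<le> mean_cost \<theta> (concat_control r v w) x"
          by (intro val_le th x concat_control v w)
        also have "\<dots> \<le> mean_cost \<theta> w (traj v x r) + e / 3"
          using mean_cost_concat_le[OF x th v(2) tv v(1) w] by (simp add: \<eta>(2))
        finally show "val \<theta> x - e / 3 \<le> mean_cost \<theta> w (traj v x r)" by simp
      qed
      then show "val \<theta> x \<le> val \<theta> (traj (fst p) x (snd p)) + e / 3" by (simp add: vr)
    qed
    moreover have "r + 1 > 0" using v by simp
    ultimately show "\<exists>\<eta>>0. \<exists>S>0. \<forall>\<theta>\<in>evaluations. slow \<theta> \<eta> S \<longrightarrow> val \<theta> x \<le> val \<theta> (traj (fst p) x (snd p)) + e / 3"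
      using \<eta>(1) by blast
  qed
  then obtain \<eta>' S where ES: "\<eta>' > 0" "S > 0" "\<And>\<theta> p. \<theta> \<in> evaluations \<Longrightarrow> slow \<theta> \<eta>' S \<Longrightarrow> p \<in> F \<Longrightarrow>
      val \<theta> x \<le> val \<theta> (traj (fst p) x (snd p)) + e / 3" by blast
  have "\<forall>\<theta>\<in>evaluations. slow \<theta> \<eta>' S \<longrightarrow> val \<theta> x \<le> limval x + e"
  proof (intro ballI impI)
    fix \<theta> assume th: "\<theta> \<in> evaluations" and slow: "slow \<theta> \<eta>' S"
    have "val \<theta> x - e \<le> tail_val \<theta> x"
    proof (rule tail_val_greatest)
      fix s u assume s: "s \<ge> (0::real)" and u: "u \<in> controls U"
      obtain v r where vr: "(v, r) \<in> F" "norm (traj u x s - traj v x r) \<le> d" using F(3)[rule_format, OF u s] by blast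
      then have v: "v \<in> controls U" "r \<ge> 0" using F(2) by auto
      have zY: "traj u x s \<in> Y" "traj v x r \<in> Y" by (intro traj_in_Y x u s v)+
      have us: "(\<lambda>r. u (s + r)) \<in> controls U" by (rule shift_control[OF u s])
      have "val \<theta> x \<le> val \<theta> (traj v x r) + e / 3" using ES(3)[OF th slow vr(1)] by simp
      also have "val \<theta> (traj v x r) \<le> val \<theta> (traj u x s) + e / 3"
        using vr(2) by (intro d(2) zY th) (simp add: norm_minus_commute)
      also have "val \<theta> (traj u x s) \<le> mean_cost \<theta> (\<lambda>r. u (s + r)) (traj u x s)"
        by (rule val_le[OF th zY(1) us])
      also have "\<dots> = (\<integral>t. cost u x (t + s) \<partial>\<theta>)"
        unfolding mean_cost_def by (rule Bochner_Integration.integral_cong[OF refl])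
          (use cost_shift[OF u s] evaluationsD(3)[OF th] in simp)
      finally show "val \<theta> x - e \<le> (\<integral>t. cost u x (t + s) \<partial>\<theta>)" using e by simp
    qed
    then show "val \<theta> x \<le> limval x + e" using limval_ge[OF th x] by linarith
  qed
  then show ?thesis using ES(1,2) by blast
qed

lemma finite_net_Y:
  assumes "d > 0"
  shows "\<exists>Z. finite Z \<and> Z \<subseteq> Y \<and> (\<forall>x\<in>Y. \<exists>z\<in>Z. norm (x - z) \<le> d)"
proof -
  have "Y \<subseteq> (\<Union>z\<in>Y. ball z d)" using assms by auto
  then obtain Z where Z: "Z \<subseteq> Y" "finite Z" "Y \<subseteq> (\<Union>z\<in>Z. ball z d)"
    using compactE_image[OF compact_Y, of Y "\<lambda>z. ball z d"] by auto
  then show ?thesis by (intro exI[of _ Z]) (force simp: dist_norm norm_minus_commute)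
qed

text \<open>Both bounds are made uniform on a finite net and carried to \<open>Y\<close> by
  equicontinuity. Each net point has its own almost maximising \<nu>, so the lower bound costs
  \<open>e / 2\<close> there; two moves of \<open>e / 4\<close> complete \<open>e\<close>.\<close>

theorem limit_value:
  assumes e: "e > 0"
  shows "\<exists>\<eta>>0. \<exists>S>0. \<forall>\<theta>\<in>evaluations. slow \<theta> \<eta> S \<longrightarrow> (\<forall>x\<in>Y. \<bar>val \<theta> x - limval x\<bar> \<le> e)"
proof -
  have e4: "e / 4 > 0" using e by simp
  obtain d where d: "d > 0" "\<And>y z. y \<in> Y \<Longrightarrow> z \<in> Y \<Longrightarrow> norm (y - z) \<le> d \<Longrightarrow>
    (\<forall>\<theta>\<in>evaluations. val \<theta> y \<le> val \<theta> z + e / 4) \<and> limval y \<le> limval z + e / 4"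
    using equicontinuity[OF e4] by blast
  obtain Z where Z: "finite Z" "Z \<subseteq> Y" "\<forall>x\<in>Y. \<exists>z\<in>Z. norm (x - z) \<le> d" using finite_net_Y[OF d(1)] by blast
  have up: "\<exists>\<eta>>0. \<exists>S>0. \<forall>\<theta>\<in>evaluations. slow \<theta> \<eta> S \<longrightarrow> (\<forall>z\<in>Z. val \<theta> z \<le> limval z + e / 4)"
    using value_upper_bound[OF _ e4] Z(2) by (intro slow_finite[OF Z(1)]) blast
  have lo: "\<exists>\<eta>>0. \<exists>S>0. \<forall>\<theta>\<in>evaluations. slow \<theta> \<eta> S \<longrightarrow> (\<forall>z\<in>Z. limval z \<le> val \<theta> z + e / 2)"
  proof (rule slow_finite[OF Z(1)])
    fix z assume "z \<in> Z"
    then have z: "z \<in> Y" using Z(2) by auto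
    obtain \<nu> where nu: "\<nu> \<in> evaluations" "limval z - e / 4 < tail_val \<nu> z" using limval_approx[OF e4] by blast
    obtain \<eta> S where 1: "\<eta> > 0" "S > 0" "\<And>\<theta>. \<theta> \<in> evaluations \<Longrightarrow> slow \<theta> \<eta> S \<Longrightarrow> tail_val \<nu> z \<le> val \<theta> z + e / 4"
      using value_lower_bound[OF z nu(1) e4] by blast
    have "limval z \<le> val \<theta> z + e / 2" if "\<theta> \<in> evaluations" "slow \<theta> \<eta> S" for \<theta>
      using 1(3)[OF that] nu(2) by linarith
    then show "\<exists>\<eta>>0. \<exists>S>0. \<forall>\<theta>\<in>evaluations. slow \<theta> \<eta> S \<longrightarrow> limval z \<le> val \<theta> z + e / 2"
      using 1(1,2) by blast
  qed
  obtain \<eta>1 S1 where 1: "\<eta>1 > 0" "S1 > 0" "\<And>\<theta>. \<theta> \<in> evaluations \<Longrightarrow> slow \<theta> \<eta>1 S1 \<Longrightarrow> \<forall>z\<in>Z. val \<theta> z \<le> limval z + e / 4"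
    using up by blast
  obtain \<eta>2 S2 where 2: "\<eta>2 > 0" "S2 > 0" "\<And>\<theta>. \<theta> \<in> evaluations \<Longrightarrow> slow \<theta> \<eta>2 S2 \<Longrightarrow> \<forall>z\<in>Z. limval z \<le> val \<theta> z + e / 2"
    using lo by blast
  have "\<forall>\<theta>\<in>evaluations. slow \<theta> (min \<eta>1 \<eta>2) (max S1 S2) \<longrightarrow> (\<forall>x\<in>Y. \<bar>val \<theta> x - limval x\<bar> \<le> e)"
  proof (intro ballI impI)
    fix \<theta> x assume th: "\<theta> \<in> evaluations" and sl: "slow \<theta> (min \<eta>1 \<eta>2) (max S1 S2)" and x: "x \<in> Y"
    have "slow \<theta> \<eta>1 S1" "slow \<theta> \<eta>2 S2" using sl by (auto elim: slow_mono)
    note a = 1(3)[OF th this(1)] and b = 2(3)[OF th this(2)]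
    obtain z where z: "z \<in> Z" "norm (x - z) \<le> d" using Z(3) x by blast
    then have zY: "z \<in> Y" and n: "norm (z - x) \<le> d" using Z(2) by (auto simp: norm_minus_commute)
    have "val \<theta> x \<le> val \<theta> z + e / 4" "limval x \<le> limval z + e / 4"
      "val \<theta> z \<le> val \<theta> x + e / 4" "limval z \<le> limval x + e / 4"
      using d(2)[OF x zY z(2)] d(2)[OF zY x n] th by auto
    moreover have "val \<theta> z \<le> limval z + e / 4" "limval z \<le> val \<theta> z + e / 2" using a b z(1) by auto
    ultimately show "\<bar>val \<theta> x - limval x\<bar> \<le> e" unfolding abs_le_iff using e by linarith
  qed
  moreover have "min \<eta>1 \<eta>2 > 0" "max S1 S2 > 0" using 1 2 by auto
  ultimately show ?thesis by blast
qed

end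

section \<open>Random codes\<close>

text \<open>Base 4 with the digits 0 and 1 only: codes form a Cantor set, and the gaps make the
  digits locally constant near every code.\<close>

definition bits_real :: "(nat \<Rightarrow> bool) \<Rightarrow> real" where
  "bits_real b = (\<Sum>k. of_bool (b k) / 4 ^ Suc k)"

text \<open>Rounds to the nearest integer. The tail of a code is at most 1/3, less than 1/2, so
  rounding drops exactly the tail, and the remainder modulo 4 is the wanted digit.\<close>

definition real_bit :: "nat \<Rightarrow> real \<Rightarrow> bool" where
  "real_bit k x \<longleftrightarrow> \<lfloor>4 ^ Suc k * x + 1 / 2\<rfloor> mod 4 = 1"

text \<open>The points at which the floor in \<open>real_bit\<close> jumps for some
  \<open>k\<close>.\<close>

definition bit_cuts :: "real set" where
  "bit_cuts = (\<Union>k. \<Union>z::int. {(of_int z - 1 / 2) / 4 ^ Suc k})"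

lemma bits_summable: "summable (\<lambda>k. of_bool (b k) / 4 ^ Suc k :: real)"
proof (rule summable_comparison_test)
  show "\<exists>N. \<forall>k\<ge>N. norm (of_bool (b k) / 4 ^ Suc k :: real) \<le> (1 / 4) ^ Suc k"
    by (intro exI[of _ 0]) (auto simp: power_divide)
  show "summable (\<lambda>k. (1 / 4 :: real) ^ Suc k)"
    by (subst summable_Suc_iff) (rule summable_geometric, simp)
qed

lemma bits_real_nonneg: "bits_real b \<ge> 0"
  unfolding bits_real_def by (intro suminf_nonneg bits_summable) auto

lemma bits_real_le: "bits_real b \<le> 1 / 3"
proof -
  have g: "(\<lambda>k. (1 / 4 :: real) ^ Suc k) sums (1 / 3)"
    using sums_mult[OF geometric_sums[of "1 / 4 :: real"], of "1 / 4"] by simp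
  have "bits_real b \<le> (\<Sum>k. (1 / 4 :: real) ^ Suc k)"
    unfolding bits_real_def by (intro suminf_le bits_summable sums_summable[OF g]) (auto simp: power_divide)
  then show ?thesis using sums_unique[OF g] by simp
qed

lemma bits_real_Suc: "4 * bits_real b = of_bool (b 0) + bits_real (\<lambda>k. b (Suc k))"
proof -
  have "bits_real b = of_bool (b 0) / 4 + (\<Sum>k. of_bool (b (Suc k)) / 4 ^ Suc (Suc k))"
    unfolding bits_real_def using suminf_split_head[OF bits_summable[of b]] by simp
  also have "(\<Sum>k. of_bool (b (Suc k)) / 4 ^ Suc (Suc k)) = bits_real (\<lambda>k. b (Suc k)) / 4"
    unfolding bits_real_def using suminf_divide[OF bits_summable[of "\<lambda>k. b (Suc k)"], of 4] by (simp add: field_simps)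
  finally show ?thesis by simp
qed

lemma bits_real_expand: "\<exists>q::int. 4 ^ k * bits_real b = of_int q + bits_real (\<lambda>j. b (j + k))"
proof (induction k)
  case 0
  show ?case by (intro exI[of _ 0]) simp
next
  case (Suc k)
  then obtain q :: int where q: "4 ^ k * bits_real b = of_int q + bits_real (\<lambda>j. b (j + k))" by blast
  have "4 ^ Suc k * bits_real b = 4 * of_int q + 4 * bits_real (\<lambda>j. b (j + k))" using q by simp
  also have "\<dots> = of_int (4 * q + of_bool (b k)) + bits_real (\<lambda>j. b (j + Suc k))"
    by (subst bits_real_Suc) simp
  finally show ?case by blast
qed

lemma bits_real_floor:
  "\<exists>q::int. 4 ^ Suc k * bits_real b = of_int (4 * q + of_bool (b k)) + bits_real (\<lambda>j. b (j + Suc k))"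
proof -
  obtain q :: int where q: "4 ^ k * bits_real b = of_int q + bits_real (\<lambda>j. b (j + k))"
    using bits_real_expand by blast
  have "4 ^ Suc k * bits_real b = 4 * of_int q + 4 * bits_real (\<lambda>j. b (j + k))" using q by simp
  also have "\<dots> = of_int (4 * q + of_bool (b k)) + bits_real (\<lambda>j. b (j + Suc k))"
    by (subst bits_real_Suc) simp
  finally show ?thesis by blast
qed

lemma real_bit_bits_real: "real_bit k (bits_real b) \<longleftrightarrow> b k"
proof -
  obtain q :: int where q: "4 ^ Suc k * bits_real b = of_int (4 * q + of_bool (b k)) + bits_real (\<lambda>j. b (j + Suc k))"
    using bits_real_floor by blast
  define t where "t = bits_real (\<lambda>j. b (j + Suc k))"
  have t: "0 \<le> t" "t \<le> 1 / 3" unfolding t_def by (rule bits_real_nonneg, rule bits_real_le)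
  have "\<lfloor>of_int w + t + 1 / 2\<rfloor> = w" for w :: int
    using t by (intro floor_unique) linarith+
  then have "\<lfloor>4 ^ Suc k * bits_real b + 1 / 2\<rfloor> = 4 * q + of_bool (b k)"
    unfolding q t_def by blast
  then have "real_bit k (bits_real b) \<longleftrightarrow> (4 * q + of_bool (b k)) mod 4 = 1"
    unfolding real_bit_def by (simp only:)
  then show ?thesis by (cases "b k") (simp_all add: mod_add_left_eq)
qed

text \<open>The tail of an expansion is at most one third of the next digit, so codes stay away from the
  points where a rounded digit jumps.\<close>

lemma bits_real_far_from_cut: "\<bar>bits_real b - (of_int z - 1 / 2) / 4 ^ Suc k\<bar> \<ge> 1 / (6 * 4 ^ Suc k)"
proof -
  obtain q :: int where q: "4 ^ Suc k * bits_real b = of_int (4 * q + of_bool (b k)) + bits_real (\<lambda>j. b (j + Suc k))"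
    using bits_real_floor by blast
  define t where "t = bits_real (\<lambda>j. b (j + Suc k))"
  define w where "w = 4 * q + of_bool (b k)"
  have t: "0 \<le> t" "t \<le> 1 / 3" unfolding t_def by (rule bits_real_nonneg, rule bits_real_le)
  have "1 / 6 \<le> \<bar>of_int w + t - (of_int z - 1 / 2)\<bar>"
  proof (cases "w \<ge> z")
    case True
    then have "(of_int w :: real) \<ge> of_int z" by simp
    then show ?thesis using t by linarith
  next
    case False
    then have "(of_int w :: real) \<le> of_int z - 1" by linarith
    then show ?thesis using t by linarith
  qed
  also have "of_int w + t - (of_int z - 1 / 2) = 4 ^ Suc k * (bits_real b - (of_int z - 1 / 2) / 4 ^ Suc k)"
  proof -
    have "p * (v - A / p) = p * v - A" if "p \<noteq> 0" for p v A :: real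
      using that by (simp add: right_diff_distrib)
    then show ?thesis using q unfolding t_def[symmetric] w_def[symmetric] by simp
  qed
  finally have "1 / 6 \<le> 4 ^ Suc k * \<bar>bits_real b - (of_int z - 1 / 2) / 4 ^ Suc k\<bar>"
    by (simp add: abs_mult)
  then show ?thesis by (simp add: field_simps)
qed

lemma bit_cuts_countable: "countable bit_cuts"
  unfolding bit_cuts_def by (intro countable_UN) auto

lemma real_bit_locally_constant:
  assumes "x \<notin> bit_cuts"
  shows "eventually (\<lambda>y. real_bit k y = real_bit k x) (at x)"
proof -
  define h where "h y = 4 ^ Suc k * y + 1 / 2" for y :: real
  have tend: "(h \<longlongrightarrow> h x) (at x)" unfolding h_def by (intro tendsto_intros)
  have "h x \<noteq> of_int \<lfloor>h x\<rfloor>"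
  proof
    assume "h x = of_int \<lfloor>h x\<rfloor>"
    then have "x = (of_int \<lfloor>h x\<rfloor> - 1 / 2) / 4 ^ Suc k" by (simp add: h_def field_simps)
    then show False using assms unfolding bit_cuts_def by blast
  qed
  then have "of_int \<lfloor>h x\<rfloor> < h x" "h x < of_int \<lfloor>h x\<rfloor> + 1"
    by linarith+
  then have "eventually (\<lambda>y. of_int \<lfloor>h x\<rfloor> < h y) (at x)" "eventually (\<lambda>y. h y < of_int \<lfloor>h x\<rfloor> + 1) (at x)"
    using order_tendstoD[OF tend] by auto
  then show ?thesis
  proof eventually_elim
    case (elim y)
    then have "\<lfloor>h y\<rfloor> = \<lfloor>h x\<rfloor>" by (intro floor_unique) auto
    then show ?case by (simp add: real_bit_def h_def)
  qed
qed

lemma real_bit_measurable [measurable]: "real_bit k \<in> borel \<rightarrow>\<^sub>M count_space UNIV"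
  unfolding real_bit_def[abs_def] by measurable

text \<open>The bit at the position of the pair (m, l) states that digit \<open>m\<close> equals
  \<open>l\<close>. The alternative \<open>l = B m\<close> makes the search end for every real, also
  for one that codes nothing.\<close>

definition real_digit :: "(nat \<Rightarrow> nat) \<Rightarrow> real \<Rightarrow> nat \<Rightarrow> nat" where
  "real_digit B x m = (LEAST l. l = B m \<or> real_bit (prod_encode (m, l)) x)"

definition digits_real :: "(nat \<Rightarrow> nat) \<Rightarrow> real" where
  "digits_real c = bits_real (\<lambda>k. c (fst (prod_decode k)) = snd (prod_decode k))"

lemma real_digit_le: "real_digit B x m \<le> B m"
  unfolding real_digit_def by (rule Least_le) simp

lemma real_digit_digits_real:
  assumes "c m \<le> B m"
  shows "real_digit B (digits_real c) m = c m"
  unfolding real_digit_def digits_real_def real_bit_bits_real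
  by (rule Least_equality) (use assms in auto)

lemma real_digit_measurable [measurable]: "(\<lambda>x. real_digit B x m) \<in> borel \<rightarrow>\<^sub>M count_space UNIV"
  unfolding real_digit_def by measurable

lemma real_digit_locally_constant:
  assumes "x \<notin> bit_cuts"
  shows "eventually (\<lambda>y. real_digit B y m = real_digit B x m) (at x)"
proof -
  have "eventually (\<lambda>y. \<forall>l\<in>{..B m}. real_bit (prod_encode (m, l)) y = real_bit (prod_encode (m, l)) x) (at x)"
    by (intro eventually_ball_finite ballI real_bit_locally_constant assms) simp
  then show ?thesis
  proof eventually_elim
    case (elim y)
    define P where "P z l \<longleftrightarrow> l = B m \<or> real_bit (prod_encode (m, l)) z" for z l
    have le: "(LEAST l. P z l) \<le> B m" for z by (rule Least_le) (simp add: P_def)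
    have P: "P z (LEAST l. P z l)" for z by (rule LeastI[of _ "B m"]) (simp add: P_def)
    have eq: "P y l = P x l" if "l \<le> B m" for l using elim that by (auto simp: P_def)
    have "(LEAST l. P y l) = (LEAST l. P x l)"
      using P eq le by (intro antisym Least_le) blast+
    then show ?case by (simp add: real_digit_def P_def)
  qed
qed

text \<open>On the compact product of the finite sets of digits at most \<open>B m\<close> this is
  continuity for the product topology, stated in its uniform form.\<close>

definition prefix_continuous :: "(nat \<Rightarrow> nat) \<Rightarrow> ((nat \<Rightarrow> nat) \<Rightarrow> real) \<Rightarrow> bool" where
  "prefix_continuous B \<Phi> \<longleftrightarrow> (\<forall>e>0. \<exists>n. \<forall>c c'. (\<forall>m. c m \<le> B m) \<longrightarrow> (\<forall>m. c' m \<le> B m) \<longrightarrow>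
     (\<forall>m<n. c m = c' m) \<longrightarrow> \<bar>\<Phi> c - \<Phi> c'\<bar> \<le> e)"

lemma prefix_continuous_isCont:
  assumes \<Phi>: "prefix_continuous B \<Phi>" and x: "x \<notin> bit_cuts"
  shows "isCont (\<lambda>y. \<Phi> (real_digit B y)) x"
  unfolding isCont_def
proof (rule tendstoI)
  fix e :: real assume "e > 0"
  then have "e / 2 > 0" by simp
  then obtain n where n: "\<And>c c'. (\<forall>m. c m \<le> B m) \<Longrightarrow> (\<forall>m. c' m \<le> B m) \<Longrightarrow> (\<forall>m<n. c m = c' m) \<Longrightarrow> \<bar>\<Phi> c - \<Phi> c'\<bar> \<le> e / 2"
    using \<Phi> unfolding prefix_continuous_def by blast
  have "eventually (\<lambda>y. \<forall>m\<in>{..<n}. real_digit B y m = real_digit B x m) (at x)"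
    by (intro eventually_ball_finite ballI real_digit_locally_constant x) simp
  then show "eventually (\<lambda>y. dist (\<Phi> (real_digit B y)) (\<Phi> (real_digit B x)) < e) (at x)"
  proof eventually_elim
    case (elim y)
    have "\<bar>\<Phi> (real_digit B y) - \<Phi> (real_digit B x)\<bar> \<le> e / 2"
      by (rule n) (use elim real_digit_le in auto)
    then show ?case using \<open>e > 0\<close> by (simp add: dist_real_def)
  qed
qed

lemma prefix_continuous_measurable:
  assumes "prefix_continuous B \<Phi>"
  shows "(\<lambda>x. \<Phi> (real_digit B x)) \<in> borel_measurable borel"
  by (rule borel_measurable_continuous_countable_exceptions[OF bit_cuts_countable])
    (auto intro!: continuous_at_imp_continuous_on prefix_continuous_isCont[OF assms])

text \<open>The uniform laws on the codes of batch \<open>N\<close> live on a bounded interval, so a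
  subsequence converges weakly. Decoding is discontinuous at most on \<open>bit_cuts\<close>, so the
  main point is that the limit law gives these cuts no mass.\<close>

theorem code_compactness:
  fixes c :: "nat \<Rightarrow> nat \<Rightarrow> nat \<Rightarrow> nat" and r B :: "nat \<Rightarrow> nat"
  assumes c: "\<And>N i m. c N i m \<le> B m" and r: "\<And>N. r N > 0"
  shows "\<exists>M \<phi>. strict_mono \<phi> \<and> real_distribution M \<and>
    (\<forall>\<Phi> C. prefix_continuous B \<Phi> \<longrightarrow> (\<forall>c. \<bar>\<Phi> c\<bar> \<le> C) \<longrightarrow>
      (\<lambda>N. (\<Sum>i<r (\<phi> N). \<Phi> (c (\<phi> N) i)) / real (r (\<phi> N))) \<longlonglongrightarrow> (\<integral>x. \<Phi> (real_digit B x) \<partial>M))"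
proof -
  define \<mu> where "\<mu> N = distr (measure_pmf (pmf_of_set {..<r N})) borel (\<lambda>i. digits_real (c N i))" for N
  have ne: "{..<r N} \<noteq> {}" for N using r[of N] by auto
  have meas: "(\<lambda>i. digits_real (c N i)) \<in> measure_pmf (pmf_of_set {..<r N}) \<rightarrow>\<^sub>M borel" for N by simp
  have rd: "real_distribution (\<mu> N)" for N
    unfolding \<mu>_def real_distribution_def real_distribution_axioms_def
    using measure_pmf.prob_space_distr[OF meas] by simp
  have int: "(\<integral>x. h x \<partial>\<mu> N) = (\<Sum>i<r N. h (digits_real (c N i))) / real (r N)"
    if "h \<in> borel_measurable borel" for h :: "real \<Rightarrow> real" and N
    unfolding \<mu>_def using that ne by (subst integral_distr[OF meas]) (auto simp: integral_pmf_of_set)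
  have "tight \<mu>"
    unfolding tight_def
  proof (intro conjI allI impI rd)
    fix e :: real assume e: "e > 0"
    have "measure (\<mu> N) {-1<..1} > 1 - e" for N
    proof -
      have "(\<lambda>i. digits_real (c N i)) -` {-1<..1} = UNIV"
        using bits_real_nonneg bits_real_le by (force simp: digits_real_def intro: less_le_trans[of _ 0] order_trans[of _ "1/3"])
      then have "measure (\<mu> N) {-1<..1} = 1"
        unfolding \<mu>_def by (subst measure_distr[OF meas]) auto
      then show ?thesis using e by simp
    qed
    then show "\<exists>a b. a < b \<and> (\<forall>N. 1 - e < measure (\<mu> N) {a<..b})"
      by (intro exI[of _ "-1"] exI[of _ 1]) simp
  qed
  from tight_imp_convergent_subsubsequence[OF this, of id] obtain \<phi> M where
    \<phi>: "strict_mono \<phi>" and M: "real_distribution M" and conv: "weak_conv_m (\<mu> \<circ> \<phi>) M"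
    by (auto simp: strict_mono_def)
  interpret M: real_distribution M by (rule M)
  have rd': "real_distribution ((\<mu> \<circ> \<phi>) N)" for N using rd by simp
  have point: "emeasure M {(of_int z - 1 / 2) / 4 ^ Suc k} = 0" for z :: int and k :: nat
  proof -
    define a where "a = (of_int z - 1 / 2 :: real) / 4 ^ Suc k"
    define d where "d = (1 :: real) / (6 * 4 ^ Suc k)"
    have d: "d > 0" by (simp add: d_def)
    \<comment> \<open>A tent with peak 1 at the cut and half-width equal to the gap around it. It
      vanishes at all codes, so its integral against the limit law is zero, and it dominates the
      indicator of the cut.\<close>
    define h where "h y = max 0 (1 - \<bar>y - a\<bar> / d)" for y
    have cont: "isCont h y" for y unfolding h_def by (intro continuous_intros) (use d in auto)
    have hb: "norm (h y) \<le> 1" for y using d by (auto simp: h_def)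
    have hm: "h \<in> borel_measurable borel"
      using cont by (intro borel_measurable_continuous_onI continuous_at_imp_continuous_on) auto
    have "h (digits_real (c N i)) = 0" for N i
    proof -
      have "\<bar>digits_real (c N i) - a\<bar> \<ge> d"
        unfolding digits_real_def a_def d_def by (rule bits_real_far_from_cut)
      then show ?thesis using d by (simp add: h_def)
    qed
    then have "(\<lambda>N. \<integral>y. h y \<partial>((\<mu> \<circ> \<phi>) N)) = (\<lambda>_. 0)" using int[OF hm] by (simp add: fun_eq_iff)
    moreover have "(\<lambda>N. \<integral>y. h y \<partial>((\<mu> \<circ> \<phi>) N)) \<longlonglongrightarrow> (\<integral>y. h y \<partial>M)"
      by (rule weak_conv_imp_integral_bdd_continuous_conv[OF rd' M conv cont hb])
    ultimately have h0: "(\<integral>y. h y \<partial>M) = 0" using LIMSEQ_unique tendsto_const by metis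
    have "measure M {a} = (\<integral>y. indicator {a} y \<partial>M)" by simp
    also have "\<dots> \<le> (\<integral>y. h y \<partial>M)"
    proof (rule integral_mono)
      show "integrable M (indicator {a} :: real \<Rightarrow> real)" by (intro integrable_real_indicator) (auto simp: less_top[symmetric])
      show "integrable M h" using hm hb by (intro M.integrable_const_bound[of _ 1]) auto
      show "indicator {a} y \<le> h y" for y using d by (auto simp: h_def indicator_def)
    qed
    finally have "measure M {a} = 0" using h0 measure_nonneg[of M "{a}"] by linarith
    then show ?thesis unfolding a_def[symmetric] by (simp add: M.emeasure_eq_measure)
  qed
  have "bit_cuts \<in> null_sets M"
    unfolding bit_cuts_def using point by (intro null_sets_UN' countableI_type) (auto intro!: null_setsI)
  then have cuts: "emeasure M A = 0" if "A \<subseteq> bit_cuts" for A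
    using emeasure_mono[OF that, of M] by (auto simp: null_sets_def)
  have "(\<lambda>N. (\<Sum>i<r (\<phi> N). \<Phi> (c (\<phi> N) i)) / real (r (\<phi> N))) \<longlonglongrightarrow> (\<integral>x. \<Phi> (real_digit B x) \<partial>M)"
    if \<Phi>: "prefix_continuous B \<Phi>" and C: "\<forall>c. \<bar>\<Phi> c\<bar> \<le> C" for \<Phi> C
  proof -
    have digits: "real_digit B (digits_real (c N i)) = c N i" for N i
      by (rule ext) (rule real_digit_digits_real, rule c)
    have "(\<lambda>N. \<integral>x. \<Phi> (real_digit B x) \<partial>((\<mu> \<circ> \<phi>) N)) \<longlonglongrightarrow> (\<integral>x. \<Phi> (real_digit B x) \<partial>M)"
    proof (rule weak_conv_imp_bdd_ae_continuous_conv[OF rd' M conv])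
      show "emeasure M {x. \<not> isCont (\<lambda>x. \<Phi> (real_digit B x)) x} = 0"
        by (rule cuts) (use prefix_continuous_isCont[OF \<Phi>] in blast)
      show "norm (\<Phi> (real_digit B x)) \<le> C" for x using C by simp
    qed (rule prefix_continuous_measurable[OF \<Phi>])
    then show ?thesis by (simp add: int[OF prefix_continuous_measurable[OF \<Phi>]] digits)
  qed
  then show ?thesis using \<phi> M by blast
qed

section \<open>Uniform evaluations\<close>

text \<open>The image under \<open>max 0\<close>, which is the identity on [0, T], moves the measure
  from the line to the half-line required of an evaluation.\<close>

definition uniform_evaluation :: "real \<Rightarrow> real measure" where
  "uniform_evaluation T =
     distr (density lborel (\<lambda>t. ennreal (indicator {0..T} t / T))) nonneg_borel (\<lambda>t. max 0 t)"

lemma max_0_measurable: "(\<lambda>t. max 0 t) \<in> borel \<rightarrow>\<^sub>M nonneg_borel"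
  by (intro measurable_restrict_space2) auto

lemma uniform_evaluation:
  assumes T: "T > 0"
  shows "uniform_evaluation T \<in> evaluations"
    and "h \<in> borel_measurable borel \<Longrightarrow>
      (\<integral>t. h t \<partial>uniform_evaluation T) = (LINT t:{0..T}|lborel. h t) / T"
proof -
  let ?D = "density lborel (\<lambda>t. ennreal (indicator {0..T} t / T))"
  have m: "(\<lambda>t. max 0 t) \<in> ?D \<rightarrow>\<^sub>M nonneg_borel" using max_0_measurable by simp
  have "(\<integral>\<^sup>+t. ennreal (indicator {0..T} t / T) \<partial>lborel) = (\<integral>\<^sup>+t. ennreal (1 / T) * indicator {0..T} t \<partial>lborel)"
    by (intro nn_integral_cong) (auto simp: indicator_def)
  also have "\<dots> = ennreal (1 / T) * ennreal T"
    using T by (subst nn_integral_cmult_indicator) auto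
  also have "\<dots> = 1" using T by (simp flip: ennreal_mult)
  finally have "prob_space ?D" by (intro prob_spaceI) (simp add: emeasure_density)
  then have "prob_space (uniform_evaluation T)"
    unfolding uniform_evaluation_def by (rule prob_space.prob_space_distr[OF _ m])
  then show "uniform_evaluation T \<in> evaluations" by (simp add: evaluations_def uniform_evaluation_def)
  assume h: "h \<in> borel_measurable borel"
  have "(\<integral>t. h t \<partial>uniform_evaluation T) = (\<integral>t. h (max 0 t) \<partial>?D)"
    unfolding uniform_evaluation_def by (rule integral_distr[OF m]) (rule measurable_restrict_space1[OF h])
  also have "\<dots> = (\<integral>t. (indicator {0..T} t / T) *\<^sub>R h (max 0 t) \<partial>lborel)"
    using T h by (intro integral_density) auto
  also have "\<dots> = (\<integral>t. (indicator {0..T} t *\<^sub>R h t) / T \<partial>lborel)"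
    by (intro Bochner_Integration.integral_cong) (auto simp: indicator_def max_def)
  also have "\<dots> = (LINT t:{0..T}|lborel. h t) / T"
    by (simp add: set_lebesgue_integral_def)
  finally show "(\<integral>t. h t \<partial>uniform_evaluation T) = (LINT t:{0..T}|lborel. h t) / T" .
qed

lemma uniform_evaluation_measure:
  assumes T: "T > 0" and Q: "Q \<in> sets nonneg_borel"
  shows "measure (uniform_evaluation T) Q = measure lborel (Q \<inter> {0..T}) / T"
proof -
  note ev = uniform_evaluation(1)[OF T]
  have Qb: "Q \<in> sets borel" using Q by (subst (asm) sets_restrict_space_iff) auto
  have "measure (uniform_evaluation T) Q = (\<integral>t. indicator Q t \<partial>uniform_evaluation T)"
    using Q evaluationsD(2)[OF ev] by simp
  also have "\<dots> = (LINT t:{0..T}|lborel. indicator Q t) / T"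
    using Qb by (intro uniform_evaluation(2)[OF T]) auto
  also have "(LINT t:{0..T}|lborel. indicator Q t) = (\<integral>t. indicator (Q \<inter> {0..T}) t \<partial>lborel)"
    unfolding set_lebesgue_integral_def by (intro Bochner_Integration.integral_cong) (auto simp: indicator_def)
  also have "\<dots> = measure lborel (Q \<inter> {0..T})" using Qb by simp
  finally show ?thesis .
qed

text \<open>Within [0, T] the translate of \<open>Q\<close> by \<open>s\<close> is the translate of
  the part of \<open>Q\<close> in [0, T - s]. That part misses at most an interval of length
  \<open>s\<close>.\<close>

lemma uniform_evaluation_TV:
  assumes T: "T > 0" and s: "s \<ge> 0"
  shows "TV s (uniform_evaluation T) \<le> s / T"
proof (rule TV_le)
  fix Q assume Q: "Q \<in> sets nonneg_borel"
  have Qb: "Q \<in> sets borel" "Q \<subseteq> {0..}" using Q by (subst (asm) sets_restrict_space_iff; auto)+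
  define A where "A = Q \<inter> {0..T}"
  define A' where "A' = Q \<inter> {0..T - s}"
  have im_eq: "(\<lambda>t. t + s) ` Q = (\<lambda>t. t - s) -` Q"
    by (auto intro!: image_eqI[of _ _ "_ - s"])
  have "(\<lambda>t. t - s) -` Q \<inter> space borel \<in> sets borel" using Qb(1) by (intro measurable_sets[of _ borel borel]) auto
  then have imb: "(\<lambda>t. t + s) ` Q \<in> sets borel" by (simp add: im_eq)
  have imQ: "(\<lambda>t. t + s) ` Q \<in> sets nonneg_borel"
    using imb Qb(2) s by (subst sets_restrict_space_iff) auto
  have "(\<lambda>t. t + s) ` Q \<inter> {0..T} = (+) s ` A'"
    unfolding A'_def using Qb(2) s by (auto simp: add.commute image_iff)
  moreover have "measure lborel ((+) s ` A') = measure lborel A'"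
  proof -
    have "(+) s ` A' \<in> sets borel"
      using imb calculation by (metis borel_closed closed_atLeastAtMost sets.Int)
    moreover have "A' \<in> sets borel" using Qb(1) by (simp add: A'_def)
    ultimately show ?thesis using measure_translation[of s A'] by (simp add: measure_completion)
  qed
  ultimately have m: "measure (uniform_evaluation T) ((\<lambda>t. t + s) ` Q) = measure lborel A' / T"
    using uniform_evaluation_measure[OF T imQ] by simp
  have Icc: "{a..b} \<in> fmeasurable lborel" for a b :: real
    using emeasure_compact_finite[of "{a..b}"] by (intro fmeasurableI) auto
  have fA: "A \<in> fmeasurable lborel" "A' \<in> fmeasurable lborel"
  proof -
    have "{a..b} \<inter> Q \<in> fmeasurable lborel" for a b :: real
      using Qb(1) by (intro fmeasurable_Int_fmeasurable Icc) auto
    then show "A \<in> fmeasurable lborel" "A' \<in> fmeasurable lborel"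
      unfolding A_def A'_def by (simp_all add: Int_commute)
  qed
  have "A' \<subseteq> A" using s by (auto simp: A_def A'_def)
  then have le: "measure lborel A' \<le> measure lborel A" using fA by (intro measure_mono_fmeasurable) (auto dest: fmeasurableD)
  have "A \<subseteq> A' \<union> {T - s..T}" by (auto simp: A_def A'_def)
  then have "measure lborel A \<le> measure lborel (A' \<union> {T - s..T})"
    using fA Icc by (intro measure_mono_fmeasurable fmeasurable.Un) (auto dest: fmeasurableD)
  also have "\<dots> \<le> measure lborel A' + measure lborel {T - s..T}"
    using fA Icc by (intro measure_Un_le) (auto dest: fmeasurableD)
  also have "measure lborel {T - s..T} = s" using s by simp
  finally have "\<bar>measure lborel A - measure lborel A'\<bar> \<le> s" using le by simp
  then have "\<bar>measure lborel A - measure lborel A'\<bar> / T \<le> s / T" using T by (intro divide_right_mono) auto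
  then show "\<bar>measure (uniform_evaluation T) Q - measure (uniform_evaluation T) ((\<lambda>t. t + s) ` Q)\<bar> \<le> s / T"
    unfolding m uniform_evaluation_measure[OF T Q] A_def[symmetric] using T
    by (simp add: abs_divide flip: diff_divide_distrib)
qed

text \<open>With T = N + 1, the squared number of points at spacing 1/T spans exactly the length T.
  Replacing [t, t + T] by [0, T] exchanges two pieces of length \<open>t\<close>, which costs
  \<open>2 * B * t\<close> before division by T.\<close>

lemma riemann_average:
  fixes h :: "real \<Rightarrow> real"
  assumes cont: "continuous_on UNIV h" and T: "T = real (Suc N)" and B: "\<And>t. \<bar>h t\<bar> \<le> B"
    and osc: "\<And>a b. 0 \<le> a \<Longrightarrow> a \<le> b \<Longrightarrow> b \<le> a + 1 / T \<Longrightarrow> h a \<le> h b + e" and t: "t \<ge> 0"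
  shows "(\<Sum>i<(Suc N)\<^sup>2. h (real i / T + t)) / real ((Suc N)\<^sup>2) \<le> integral {0..T} h / T + e + 2 * B * t / T"
proof -
  have Tpos: "T > 0" using T by simp
  have ih: "h integrable_on {a..b}" for a b
    using cont by (intro integrable_continuous_real continuous_on_subset[OF cont]) auto
  have steps: "(\<Sum>i<m. (h (real i / T + t) - e) / T) \<le> integral {t..t + real m / T} h" for m
  proof (induction m)
    case (Suc m)
    have "integral {t..t + real m / T} h + integral {t + real m / T..t + real (Suc m) / T} h = integral {t..t + real (Suc m) / T} h"
      using Tpos by (intro Henstock_Kurzweil_Integration.integral_combine ih) (auto simp: field_simps)
    moreover have "(h (real m / T + t) - e) / T \<le> integral {t + real m / T..t + real (Suc m) / T} h"
    proof -
      have "integral {t + real m / T..t + real (Suc m) / T} (\<lambda>_. h (real m / T + t) - e) \<le> integral {t + real m / T..t + real (Suc m) / T} h"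
      proof (rule integral_le[OF _ ih])
        fix r assume r: "r \<in> {t + real m / T..t + real (Suc m) / T}"
        then have "h (real m / T + t) \<le> h r + e"
          using t Tpos by (intro osc) (auto simp: field_simps)
        then show "h (real m / T + t) - e \<le> h r" by simp
      qed (intro integrable_const_ivl)
      also have "integral {t + real m / T..t + real (Suc m) / T} (\<lambda>_. h (real m / T + t) - e) = (h (real m / T + t) - e) / T"
        using Tpos by (simp add: add_divide_distrib)
      finally show ?thesis .
    qed
    ultimately show ?case using Suc.IH by simp
  qed simp
  define r where "r = (Suc N)\<^sup>2"
  have "real r = T * T" unfolding r_def T power2_eq_square by (simp only: of_nat_mult)
  then have r: "real r / T = T" "real r = T * T" "r > 0" using Tpos by (auto simp: r_def)
  have "(\<Sum>i<r. h (real i / T + t)) / T - T * e = (\<Sum>i<r. (h (real i / T + t) - e) / T)"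
    using r Tpos by (simp add: sum_subtractf sum_divide_distrib[symmetric] diff_divide_distrib)
  also have "\<dots> \<le> integral {t..t + T} h" using steps[of r] by (simp add: r)
  also have "\<dots> \<le> integral {0..T} h + 2 * B * t"
  proof -
    have "integral {0..t} h + integral {t..t + T} h = integral {0..t + T} h"
      using t Tpos by (intro Henstock_Kurzweil_Integration.integral_combine ih) auto
    moreover have "integral {0..T} h + integral {T..t + T} h = integral {0..t + T} h"
      using t Tpos by (intro Henstock_Kurzweil_Integration.integral_combine ih) auto
    moreover have "integral {T..t + T} h \<le> integral {T..t + T} (\<lambda>_. B)" 
      using B by (intro integral_le ih integrable_const_ivl) (simp add: abs_le_iff)
    moreover have "integral {0..t} (\<lambda>_. - B) \<le> integral {0..t} h"
    proof (intro integral_le ih integrable_const_ivl)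
      show "- B \<le> h r" for r using B[of r] by linarith
    qed
    moreover have "integral {T..t + T} (\<lambda>_. B) = B * t" "integral {0..t} (\<lambda>_. - B) = - (B * t)"
      using t by simp_all
    ultimately show ?thesis by linarith
  qed
  finally have "(\<Sum>i<r. h (real i / T + t)) / T \<le> integral {0..T} h + T * e + 2 * B * t" by simp
  then have "(\<Sum>i<r. h (real i / T + t)) / T / T \<le> (integral {0..T} h + T * e + 2 * B * t) / T"
    using Tpos by (intro divide_right_mono) auto
  also have "(\<Sum>i<r. h (real i / T + t)) / T / T = (\<Sum>i<r. h (real i / T + t)) / real r"
    by (simp add: r)
  also have "(integral {0..T} h + T * e + 2 * B * t) / T = integral {0..T} h / T + e + 2 * B * t / T"
    using Tpos by (simp add: add_divide_distrib)
  finally show ?thesis by (simp add: r_def)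
qed

lemma standard_borel_real:
  assumes "sets M = sets (borel :: real measure)"
  shows "standard_borel M"
  unfolding standard_borel_def
proof (intro exI[of _ euclidean] conjI)
  show "completely_metrizable_space (euclidean :: real topology)" by (rule completely_metrizable_space_euclidean)
  obtain D :: "real set" where D: "countable D" "\<And>X. open X \<Longrightarrow> X \<noteq> {} \<Longrightarrow> \<exists>d\<in>D. d \<in> X"
    using countable_dense_exists by blast
  have "closure D = UNIV"
    using D(2) by (auto simp: closure_iff_nhds_not_empty) (metis IntI empty_iff subsetD)
  then show "separable_space (euclidean :: real topology)"
    unfolding separable_space_def using D(1) by (intro exI[of _ D]) simp
  show "topspace euclidean = space M" using sets_eq_imp_space_eq[OF assms] by simp
  show "sets M = sigma_sets (topspace euclidean) {G. openin euclidean G}"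
    unfolding assms by (simp add: borel_def)
qed

context nonexpansive_control
begin

text \<open>The bound does not depend on the time \<open>s\<close> at which the target position is
  visited; this keeps the approach phase short for every random starting position.\<close>

lemma reach_in_bounded_time:
  assumes x: "x \<in> Y" and d: "d > 0"
  shows "\<exists>S>0. \<forall>u\<in>controls U. \<forall>s\<ge>0. \<exists>v\<in>controls U. \<exists>r\<in>{0..S}. norm (traj v x r - traj u x s) \<le> d"
proof -
  obtain F where F': "finite F \<and> F \<subseteq> controls U \<times> {0..} \<and> (\<forall>u\<in>controls U. \<forall>s\<ge>0.
    \<exists>(v, r)\<in>F. norm (traj u x s - traj v x r) \<le> d)"
    using finite_reach[OF x d] ..
  define S where "S = (\<Sum>p\<in>F. snd p) + 1"
  have nn: "0 \<le> snd p" if "p \<in> F" for p using F' that by auto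
  have le: "snd p \<le> S" if "p \<in> F" for p
    using member_le_sum[OF that, of snd] F' nn by (auto simp: S_def)
  have "S > 0" using sum_nonneg[of F snd] nn by (simp add: S_def add_nonneg_pos)
  moreover have "\<exists>v\<in>controls U. \<exists>r\<in>{0..S}. norm (traj v x r - traj u x s) \<le> d"
    if "u \<in> controls U" "s \<ge> 0" for u s
  proof -
    have "\<exists>(v, r)\<in>F. norm (traj u x s - traj v x r) \<le> d" using F' that by blast
    then obtain v r where "(v, r) \<in> F" "norm (traj u x s - traj v x r) \<le> d" by blast
    then show ?thesis using F' le[of "(v, r)"] by (intro bexI[of _ v] bexI[of _ r]) (auto simp: norm_minus_commute)
  qed
  ultimately show ?thesis by blast
qed

text \<open>The uniform evaluation on [0, T] varies slowly once T exceeds S / \<eta>, so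
  \<open>limit_value\<close> applies with a threshold common to all states.\<close>

lemma near_optimal_average:
  assumes e: "e > 0"
  shows "\<exists>T0. \<forall>T>T0. T > 0 \<longrightarrow> (\<forall>x\<in>Y. \<exists>u\<in>controls U. integral {0..T} (cost u x) / T \<le> limval x + e)"
proof -
  have e2: "e / 2 > 0" using e by simp
  obtain \<eta> S where ES: "\<eta> > 0" "S > 0" "\<And>\<theta>. \<theta> \<in> evaluations \<Longrightarrow> slow \<theta> \<eta> S \<Longrightarrow> (\<forall>x\<in>Y. \<bar>val \<theta> x - limval x\<bar> \<le> e / 2)"
    using limit_value[OF e2] by blast
  have "\<exists>u\<in>controls U. integral {0..T} (cost u x) / T \<le> limval x + e"
    if T: "T > S / \<eta>" "T > 0" and x: "x \<in> Y" for T x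
  proof -
    note ev = uniform_evaluation(1)[OF T(2)]
    have "slow (uniform_evaluation T) \<eta> S"
      unfolding slow_def
    proof
      fix s assume s: "s \<in> {0..S}"
      have "TV s (uniform_evaluation T) \<le> s / T" using s T(2) by (intro uniform_evaluation_TV) auto
      also have "\<dots> \<le> S / T" using s T(2) by (intro divide_right_mono) auto
      also have "\<dots> \<le> \<eta>" using T ES(1) by (simp add: field_simps)
      finally show "TV s (uniform_evaluation T) \<le> \<eta>" .
    qed
    then have "\<bar>val (uniform_evaluation T) x - limval x\<bar> \<le> e / 2" using ES(3)[OF ev] x by blast
    then have "val (uniform_evaluation T) x \<le> limval x + e / 2" by linarith
    moreover obtain u where u: "u \<in> controls U" "mean_cost (uniform_evaluation T) u x < val (uniform_evaluation T) x + e / 2"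
      using val_approx[OF ev x e2] by blast
    moreover have "mean_cost (uniform_evaluation T) u x = integral {0..T} (cost u x) / T"
    proof -
      have "set_integrable lborel {0..T} (cost u x)"
        by (intro borel_integrable_atLeastAtMost' continuous_on_subset[OF cost_continuous[OF x u(1)]]) auto
      then show ?thesis
        unfolding mean_cost_def uniform_evaluation(2)[OF T(2) cost_measurable[OF x u(1)]]
        by (simp add: set_borel_integral_eq_integral)
    qed
    ultimately show ?thesis by (intro bexI[of _ u]) auto
  qed
  then show ?thesis by blast
qed

end

section \<open>Randomised tracking\<close>

context tracking
begin

section \<open>Measurability of the tracker in state, code and time\<close>

lemma const_traj_measurable: "(\<lambda>x. traj (\<lambda>_. menu k i) x s) \<in> borel_measurable borel" if "s \<ge> 0"
  using traj_continuous_initial[OF const_control[OF menu_in] that] by (rule borel_measurable_continuous_onI)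

lemma rhs_state_measurable: "(\<lambda>x. f x (menu k i)) \<in> borel_measurable borel"
proof (rule borel_measurable_continuous_onI, rule lipschitz_on_continuous_on)
  show "lipc-lipschitz_on UNIV (\<lambda>x. f x (menu k i))"
    by (rule lipschitz_onI) (use lipc menu_in in \<open>auto simp: dist_norm\<close>)
qed

text \<open>A digit takes countably many values, and for each menu entry the end of the step is
  continuous in the starting state; regularity in the control never enters.\<close>

lemma step_measurable:
  assumes X: "X \<in> borel_measurable M" and D: "D \<in> M \<rightarrow>\<^sub>M count_space UNIV"
  shows "(\<lambda>p. traj (\<lambda>_. menu k (D p)) (X p) (step_len k)) \<in> borel_measurable M"
  using step_len_pos[of k]
  by (intro measurable_compose_countable[OF _ D, where f = "\<lambda>i p. traj (\<lambda>_. menu k i) (X p) (step_len k)"]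
      measurable_compose[OF X const_traj_measurable]) simp

lemma aim_measurable:
  assumes X: "X \<in> borel_measurable M" and Z: "Z \<in> borel_measurable M"
  shows "(\<lambda>p. aim k (X p) (Z p)) \<in> M \<rightarrow>\<^sub>M count_space UNIV"
proof -
  define A where "A i p = (X p - Z p) \<bullet> f (X p) (menu k i)" for i p
  have [measurable]: "A i \<in> borel_measurable M" for i
    unfolding A_def by (intro borel_measurable_inner borel_measurable_diff X Z measurable_compose[OF X rhs_state_measurable])
  have "(\<lambda>p. LEAST i. i < n k \<and> (\<forall>j\<in>{..<n k}. A i p \<le> A j p)) \<in> M \<rightarrow>\<^sub>M count_space UNIV"
    by measurable
  then show ?thesis unfolding aim_def A_def .
qed

lemma node_measurable:
  assumes "\<And>i. (\<lambda>p. D p i) \<in> M \<rightarrow>\<^sub>M count_space UNIV"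
  shows "(\<lambda>p. node x (D p) k) \<in> borel_measurable M"
proof (induction k)
  case (Suc k)
  show ?case unfolding node.simps by (rule step_measurable[OF Suc assms])
qed simp

lemma tracker_pos_measurable:
  assumes X: "X \<in> borel_measurable M" and Z: "\<And>k. (\<lambda>p. Z p k) \<in> borel_measurable M"
  shows "(\<lambda>p. tracker_pos (X p) (Z p) k) \<in> borel_measurable M"
proof (induction k)
  case (Suc k)
  show ?case unfolding tracker_pos.simps by (rule step_measurable[OF Suc aim_measurable[OF Suc Z]])
qed (simp add: X)

lemma tracker_digit_measurable:
  assumes X: "X \<in> borel_measurable M" and Z: "\<And>k. (\<lambda>p. Z p k) \<in> borel_measurable M"
  shows "(\<lambda>p. tracker_digit (X p) (Z p) k) \<in> M \<rightarrow>\<^sub>M count_space UNIV"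
  unfolding tracker_digit_def by (intro aim_measurable tracker_pos_measurable X Z)

lemma coded_control_measurable:
  assumes D: "\<And>k. (\<lambda>p. D p k) \<in> M \<rightarrow>\<^sub>M count_space UNIV" and t: "\<tau> \<in> borel_measurable M"
  shows "(\<lambda>p. coded_control (D p) (\<tau> p)) \<in> M \<rightarrow>\<^sub>M restrict_space borel U"
proof -
  have e: "menu k \<in> count_space UNIV \<rightarrow>\<^sub>M restrict_space borel U" for k
    using menu_in by (auto simp: space_restrict_space)
  have "(\<lambda>p. menu k (D p k)) \<in> M \<rightarrow>\<^sub>M restrict_space borel U" for k
    by (rule measurable_compose[OF D e])
  from measurable_compose_countable[where f = "\<lambda>k p. menu k (D p k)", OF this measurable_compose[OF t idx_measurable]]
  show ?thesis by (simp add: coded_control_def)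
qed

end

locale random_tracking = tracking U f g Y c menu n
  for U :: "'u::{metric_space,second_countable_topology} set"
    and f :: "real^'n \<Rightarrow> 'u \<Rightarrow> real^'n"
    and g :: "real^'n \<Rightarrow> 'u \<Rightarrow> real"
    and Y :: "(real^'n) set" and c menu n +
  fixes net_point :: "nat \<Rightarrow> real^'n" and \<delta> :: real
  assumes net_point: "net_point j \<in> Y" and cover: "y \<in> Y \<Longrightarrow> \<exists>j. norm (y - net_point j) \<le> \<delta>"
    and \<delta>_pos: "\<delta> > 0" and c_small: "(4 + step_error) * (2 * c\<^sup>2) \<le> \<delta>\<^sup>2"
begin

definition cell :: "real^'n \<Rightarrow> nat" where "cell y = (LEAST j. norm (y - net_point j) \<le> \<delta>)"

text \<open>One code carries a digit sequence for every net point \<open>net_point j\<close>.\<close>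

definition net_digits :: "(nat \<Rightarrow> nat) \<Rightarrow> nat \<Rightarrow> nat \<Rightarrow> nat" where
  "net_digits w j i = w (prod_encode (j, i))"

text \<open>Digits of valid codes are strictly below the menu size, whereas
  \<open>real_digit\<close> has an inclusive bound.\<close>

definition code_bound :: "nat \<Rightarrow> nat" where
  "code_bound m = n (snd (prod_decode m)) - 1"

text \<open>A code can hold only countably many digit sequences, so an arbitrary state
  \<open>y\<close> tracks the coded trajectory that starts from the net point of its cell.\<close>

definition follow :: "(nat \<Rightarrow> nat) \<Rightarrow> real^'n \<Rightarrow> real \<Rightarrow> 'u" where
  "follow w y = coded_control (tracker_digit y (node (net_point (cell y)) (net_digits w (cell y))))"

lemma cell: "y \<in> Y \<Longrightarrow> norm (y - net_point (cell y)) \<le> \<delta>"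
  unfolding cell_def by (rule LeastI_ex) (rule cover)

text \<open>Holds for every \<open>w\<close>, valid or not, because the digits of the tracker come
  from \<open>aim\<close>.\<close>

lemma follow_in_controls: "follow w y \<in> controls U"
  unfolding follow_def by (intro coded_control_in_controls valid_tracker_digit)

lemma follow_tracks:
  assumes w: "valid (net_digits w (cell y))" and y: "y \<in> Y" and t: "t \<ge> 0"
  shows "norm (traj (follow w y) y t - traj (coded_control (net_digits w (cell y))) (net_point (cell y)) t) \<le> 2 * \<delta>"
proof -
  let ?b = "net_digits w (cell y)" and ?z = "net_point (cell y)"
  have "node ?z ?b = (\<lambda>k. traj (coded_control ?b) ?z (grid k))" using traj_coded_control_grid[OF w] by (simp add: fun_eq_iff)
  then have "norm (traj (follow w y) y t - traj (coded_control ?b) ?z t) \<le> norm (y - ?z) + \<delta>"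
    unfolding follow_def using tracking_distance[OF y net_point coded_control_in_controls[OF w] t c_small] \<delta>_pos by simp
  then show ?thesis using cell[OF y] by simp
qed

text \<open>Up to a time \<open>A\<close> the trajectory is determined by finitely many digits of
  the code, and \<theta> has little mass beyond \<open>A\<close>.\<close>

lemma mean_cost_follow_prefix_continuous:
  assumes th: "\<theta> \<in> evaluations" and y: "y \<in> Y"
  shows "prefix_continuous B (\<lambda>w. mean_cost \<theta> (follow w y) y)"
  unfolding prefix_continuous_def
proof (intro allI impI)
  fix e :: real assume e: "e > 0"
  interpret prob_space \<theta> by (rule evaluationsD(1)[OF th])
  have "e / (2 * cost_sup) > 0" using e cost_sup(1) by simp
  from evaluation_tail[OF th this] obtain A where A: "A > 0" "prob {A<..} \<le> e / (2 * cost_sup)" by blast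
  have tail: "2 * cost_sup * prob {A<..} \<le> e" using A(2) cost_sup(1) by (simp add: field_simps)
  have sA: "{A<..} \<in> sets \<theta>"
    unfolding evaluationsD(2)[OF th] sets_restrict_space using A by (intro image_eqI[of _ _ "{A<..}"]) auto
  obtain k where k: "A < grid k" using grid_unbounded by blast
  \<comment> \<open>Past all positions at which the code stores the first digits for the cell of
    \<open>y\<close>. As \<open>y\<close> is fixed, one cell suffices.\<close>
  define m where "m = Suc (Max ((\<lambda>i. prod_encode (cell y, i)) ` {..k}))"
  show "\<exists>m. \<forall>w w' :: nat \<Rightarrow> nat. (\<forall>i. w i \<le> B i) \<longrightarrow> (\<forall>i. w' i \<le> B i) \<longrightarrow> (\<forall>i<m. w i = w' i) \<longrightarrow>
      \<bar>mean_cost \<theta> (follow w y) y - mean_cost \<theta> (follow w' y) y\<bar> \<le> e"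
  proof (intro exI[of _ m] allI impI)
    fix w w' :: "nat \<Rightarrow> nat" assume eq: "\<forall>i<m. w i = w' i"
    have digits_eq: "net_digits w (cell y) i = net_digits w' (cell y) i" if "i \<le> k" for i
      using that eq by (auto simp: net_digits_def m_def less_Suc_eq_le intro!: Max_ge)
    have "tracker_digit y (node (net_point (cell y)) (net_digits w (cell y))) i = tracker_digit y (node (net_point (cell y)) (net_digits w' (cell y))) i" if "i < k" for i
      using that digits_eq by (intro tracker_digit_prefix node_prefix) auto
    then have traj_eq: "traj (follow w y) y t = traj (follow w' y) y t" if "t \<in> {0..grid k}" for t
      unfolding follow_def using that by (intro traj_coded_control_prefix[of _ _ k] valid_tracker_digit)
    have less: "mean_cost \<theta> (follow v y) y \<le> mean_cost \<theta> (follow v' y) y + e"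
      if te: "\<And>t. t \<in> {0..grid k} \<Longrightarrow> traj (follow v y) y t = traj (follow v' y) y t" for v v'
    proof -
      have int: "integrable \<theta> (cost (follow v y) y)" for v
        by (rule evaluation_integrable[OF th cost_measurable[OF y follow_in_controls] cost_bound])
      have iA: "integrable \<theta> (\<lambda>t. 2 * cost_sup * indicator {A<..} t :: real)"
        using sA by (intro integrable_mult_right integrable_real_indicator) (auto simp: less_top[symmetric])
      have "mean_cost \<theta> (follow v y) y \<le> (\<integral>t. cost (follow v' y) y t + 2 * cost_sup * indicator {A<..} t \<partial>\<theta>)"
        unfolding mean_cost_def
      proof (intro integral_mono int Bochner_Integration.integrable_add iA)
        fix t assume "t \<in> space \<theta>"
        then have t: "t \<ge> 0" using evaluationsD(3)[OF th] by simp
        show "cost (follow v y) y t \<le> cost (follow v' y) y t + 2 * cost_sup * indicator {A<..} t"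
        proof (cases "t \<le> A")
          case True
          then have "cost (follow v y) y t = cost (follow v' y) y t" unfolding cost_def using te[of t] t k by simp
          then show ?thesis using True by simp
        next
          case False
          then show ?thesis using cost_bound[of "follow v y" y t] cost_bound[of "follow v' y" y t] by simp
        qed
      qed
      also have "\<dots> = mean_cost \<theta> (follow v' y) y + 2 * cost_sup * prob {A<..}"
        unfolding mean_cost_def using sA by (subst Bochner_Integration.integral_add[OF int iA]) simp
      finally show ?thesis using tail by simp
    qed
    have "mean_cost \<theta> (follow w y) y \<le> mean_cost \<theta> (follow w' y) y + e" "mean_cost \<theta> (follow w' y) y \<le> mean_cost \<theta> (follow w y) y + e"
      using less[of w w'] less[of w' w] traj_eq by auto
    then show "\<bar>mean_cost \<theta> (follow w y) y - mean_cost \<theta> (follow w' y) y\<bar> \<le> e" by linarith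
  qed
qed

lemma random_control_follow:
  assumes M: "prob_space M" "sets M = sets (borel :: real measure)"
  shows "random_control U Y M (\<lambda>y \<omega>. follow (real_digit B \<omega>) y)"
  unfolding random_control_def
proof (intro conjI M standard_borel_real)
  let ?P = "restrict_space borel Y \<Otimes>\<^sub>M M \<Otimes>\<^sub>M nonneg_borel"
  have y: "fst \<in> borel_measurable ?P"
    by (rule measurable_compose[OF measurable_fst]) (rule measurable_restrict_space1, simp)
  have id: "(\<lambda>\<omega>. \<omega>) \<in> M \<rightarrow>\<^sub>M borel" by (rule measurable_ident_sets[OF M(2)])
  have om: "(\<lambda>p. fst (snd p)) \<in> borel_measurable ?P"
    by (rule measurable_compose[OF measurable_snd measurable_compose[OF measurable_fst id]])
  have t: "(\<lambda>p. snd (snd p)) \<in> borel_measurable ?P"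
    by (rule measurable_compose[OF measurable_snd measurable_compose[OF measurable_snd]])
      (rule measurable_restrict_space1, simp)
  have cellm: "(\<lambda>p. cell (fst p)) \<in> ?P \<rightarrow>\<^sub>M count_space UNIV"
  proof -
    have "cell \<in> borel \<rightarrow>\<^sub>M count_space UNIV" unfolding cell_def[abs_def] by measurable
    from measurable_compose[OF y this] show ?thesis .
  qed
  have digit: "(\<lambda>p. real_digit B (fst (snd p)) m) \<in> ?P \<rightarrow>\<^sub>M count_space UNIV" for m
    by (rule measurable_compose[OF om real_digit_measurable])
  have target: "(\<lambda>p. node (net_point (cell (fst p))) (net_digits (real_digit B (fst (snd p))) (cell (fst p))) k) \<in> borel_measurable ?P" for k
    by (rule measurable_compose_countable[where f = "\<lambda>j p. node (net_point j) (net_digits (real_digit B (fst (snd p))) j) k", OF node_measurable cellm])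
      (simp add: net_digits_def digit)
  have "(\<lambda>p. coded_control (tracker_digit (fst p) (node (net_point (cell (fst p))) (net_digits (real_digit B (fst (snd p))) (cell (fst p))))) (snd (snd p)))
      \<in> ?P \<rightarrow>\<^sub>M restrict_space borel U"
    by (intro coded_control_measurable tracker_digit_measurable y target t)
  then show "(\<lambda>(y, \<omega>, t). follow (real_digit B \<omega>) y t) \<in> ?P \<rightarrow>\<^sub>M restrict_space borel U"
    unfolding follow_def split_def .
qed

text \<open>Three errors of size \<delta>: reaching the neighbourhood of the position at \<tau>
  within time \<open>S\<close>, shadowing the trajectory from there, and encoding the concatenated
  control by tracking it from its own initial state.\<close>

lemma code_for_shifted_target:
  assumes x: "x \<in> Y" and u: "u \<in> controls U" and \<tau>: "\<tau> \<ge> 0"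
    and reach: "\<forall>u\<in>controls U. \<forall>s\<ge>0. \<exists>v\<in>controls U. \<exists>r\<in>{0..S}. norm (traj v x r - traj u x s) \<le> \<delta>"
  shows "\<exists>b. valid b \<and> (\<exists>s\<in>{0..S}. \<forall>t\<ge>0. norm (traj (coded_control b) x (s + t) - traj u x (\<tau> + t)) \<le> 3 * \<delta>)"
proof -
  obtain v s where v: "v \<in> controls U" "s \<in> {0..S}" "norm (traj v x s - traj u x \<tau>) \<le> \<delta>"
    using reach u \<tau> by blast
  then have s: "s \<ge> 0" by simp
  have us: "(\<lambda>r. u (\<tau> + r)) \<in> controls U" by (rule shift_control[OF u \<tau>])
  obtain w where w: "w \<in> controls U" "\<And>t. t \<ge> 0 \<Longrightarrow>
      norm (traj w (traj v x s) t - traj (\<lambda>r. u (\<tau> + r)) (traj u x \<tau>) t) \<le> norm (traj v x s - traj u x \<tau>) + \<delta>"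
    using shadowing[OF traj_in_Y[OF x v(1) s] traj_in_Y[OF x u \<tau>] us \<delta>_pos] by blast
  define W where "W = concat_control s v w"
  have W: "W \<in> controls U" unfolding W_def by (rule concat_control[OF v(1) w(1)])
  define b where "b = tracker_digit x (\<lambda>k. traj W x (grid k))"
  have "norm (traj (coded_control b) x (s + t) - traj u x (\<tau> + t)) \<le> 3 * \<delta>" if t: "t \<ge> 0" for t
  proof -
    have 1: "norm (traj (coded_control b) x (s + t) - traj W x (s + t)) \<le> \<delta>"
      using tracking_distance[OF x x W _ c_small, of "s + t"] s t \<delta>_pos by (simp add: b_def)
    have "norm (traj W x (s + t) - traj u x (\<tau> + t)) \<le> norm (traj v x s - traj u x \<tau>) + \<delta>"
      unfolding W_def traj_concat_after[OF v(1) w(1) s t] traj_shift[OF u \<tau> t] by (rule w(2)[OF t])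
    then have 2: "norm (traj W x (s + t) - traj u x (\<tau> + t)) \<le> 2 * \<delta>" using v(3) by simp
    have "norm (traj (coded_control b) x (s + t) - traj u x (\<tau> + t)) \<le>
        norm (traj (coded_control b) x (s + t) - traj W x (s + t)) + norm (traj W x (s + t) - traj u x (\<tau> + t))"
      using norm_triangle_ineq[of "traj (coded_control b) x (s + t) - traj W x (s + t)" "traj W x (s + t) - traj u x (\<tau> + t)"] by simp
    then show ?thesis using 1 2 by simp
  qed
  then show ?thesis using v(2) by (intro exI[of _ b] conjI bexI[of _ s]) (auto simp: b_def valid_tracker_digit)
qed

end

context nonexpansive_control
begin

lemma limval_lower:
  assumes x: "x \<in> Y"
  shows "- cost_sup \<le> limval x"
proof -
  obtain \<theta> where th: "\<theta> \<in> evaluations" using evaluations_nonempty by blast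
  have "- cost_sup \<le> tail_val \<theta> x"
  proof (rule tail_val_greatest)
    show "- cost_sup \<le> (\<integral>t. cost u x (t + s) \<partial>\<theta>)" if "u \<in> controls U" for u s
      using tail_abs_le[OF th x that, of s] by linarith
  qed
  then show ?thesis using limval_ge[OF th x] by linarith
qed

end

context random_tracking
begin

text \<open>The distance is \<open>2 * \<delta>\<close> from following the code and
  \<open>3 * \<delta>\<close> from the code itself, which costs one \<open>q\<close>. The other
  \<open>q\<close> pays for deleting the approach phase of length \<open>s\<close>.\<close>

lemma mean_cost_code_le:
  assumes th: "\<theta> \<in> evaluations" and y: "y \<in> Y" and u: "u \<in> controls U" and s: "s \<ge> 0" and \<tau>: "\<tau> \<ge> 0"
    and w: "valid (net_digits w (cell y))"
    and close: "\<And>t. t \<ge> 0 \<Longrightarrow>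
      norm (traj (coded_control (net_digits w (cell y))) (net_point (cell y)) (s + t) - traj u (net_point (cell y)) (\<tau> + t)) \<le> 3 * \<delta>"
    and osc: "\<And>x z. x \<in> Y \<Longrightarrow> z \<in> Y \<Longrightarrow> norm (x - z) \<le> 5 * \<delta> \<Longrightarrow> \<bar>G x - G z\<bar> \<le> q"
    and tv: "TV s \<theta> \<le> q / (4 * cost_sup)"
  shows "mean_cost \<theta> (follow w y) y \<le> (\<integral>t. cost u (net_point (cell y)) (\<tau> + t) \<partial>\<theta>) + 2 * q"
proof -
  have "\<bar>(\<integral>t. cost (follow w y) y (t + s) \<partial>\<theta>) - mean_cost \<theta> (follow w y) y\<bar> \<le> 4 * cost_sup * (q / (4 * cost_sup))"
    unfolding mean_cost_def by (rule TV_shift[OF th s tv cost_measurable[OF y follow_in_controls] cost_sup(1) cost_bound])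
  then have 1: "mean_cost \<theta> (follow w y) y \<le> (\<integral>t. cost (follow w y) y (t + s) \<partial>\<theta>) + q" using cost_sup(1) by simp
  have m: "(\<lambda>t. cost u (net_point (cell y)) (\<tau> + t)) \<in> borel_measurable borel"
    using cost_measurable_shift[OF net_point u, of "cell y" \<tau>] by (simp only: add.commute)
  have "(\<integral>t. cost (follow w y) y (t + s) \<partial>\<theta>) \<le> (\<integral>t. cost u (net_point (cell y)) (\<tau> + t) \<partial>\<theta>) + q"
  proof (rule evaluation_integral_le[OF th cost_measurable_shift[OF y follow_in_controls] cost_bound m cost_bound])
    fix t :: real assume t: "t \<ge> 0"
    let ?a = "traj (follow w y) y (s + t)" and ?b = "traj (coded_control (net_digits w (cell y))) (net_point (cell y)) (s + t)"
      and ?c = "traj u (net_point (cell y)) (\<tau> + t)"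
    have "norm (?a - ?b) \<le> 2 * \<delta>" by (rule follow_tracks[OF w y]) (use s t in simp)
    moreover have "norm (?a - ?c) \<le> norm (?a - ?b) + norm (?b - ?c)"
      using norm_triangle_ineq[of "?a - ?b" "?b - ?c"] by simp
    ultimately have "norm (?a - ?c) \<le> 5 * \<delta>" using close[OF t] by linarith
    then have "\<bar>G ?a - G ?c\<bar> \<le> q"
      using s t \<tau> by (intro osc traj_in_Y y net_point follow_in_controls u) auto
    then show "cost (follow w y) y (t + s) \<le> cost u (net_point (cell y)) (\<tau> + t) + q"
      using s t \<tau> by (simp add: cost_def add.commute abs_le_iff)
  qed
  then show ?thesis using 1 by linarith
qed

text \<open>The sum over the starting times \<open>i / T\<close> is a Riemann sum for the uniform average over
  \<open>[t, t + T]\<close>, which differs from that over \<open>[0, T]\<close> by a term that vanishes as \<open>T\<close> grows.\<close>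

lemma average_le:
  assumes th: "\<theta> \<in> evaluations" and x: "x \<in> Y" and u: "u \<in> controls U"
    and T: "T = real (Suc N)" and small: "size_bd / T \<le> 5 * \<delta>"
    and osc: "\<And>x z. x \<in> Y \<Longrightarrow> z \<in> Y \<Longrightarrow> norm (x - z) \<le> 5 * \<delta> \<Longrightarrow> \<bar>G x - G z\<bar> \<le> q"
    and opt: "integral {0..T} (cost u x) / T \<le> limval x + q" and q: "q > 0"
    and A: "A \<ge> 0" and tail: "2 * cost_sup * measure \<theta> {A<..} \<le> q"
  shows "(\<Sum>i<(Suc N)\<^sup>2. \<integral>t. cost u x (real i / T + t) \<partial>\<theta>) / real ((Suc N)\<^sup>2) \<le> limval x + 3 * q + 2 * cost_sup * A / T"
proof -
  interpret prob_space \<theta> by (rule evaluationsD(1)[OF th])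
  have Tpos: "T > 0" using T by simp
  define r where "r = (Suc N)\<^sup>2"
  have r: "real r > 0" by (simp add: r_def)
  define F where "F t = (\<Sum>i<r. cost u x (real i / T + t)) / real r" for t
  have m: "(\<lambda>t. cost u x (b + t)) \<in> borel_measurable borel" for b
    using cost_measurable_shift[OF x u, of b] by (simp only: add.commute)
  have int: "integrable \<theta> (\<lambda>t. cost u x (b + t))" for b
    by (rule evaluation_integrable[OF th m cost_bound])
  have intF: "integrable \<theta> F" unfolding F_def by (intro integrable_divide Bochner_Integration.integrable_sum int)
  have sA: "{A<..} \<in> sets \<theta>"
    unfolding evaluationsD(2)[OF th] sets_restrict_space using A by (intro image_eqI[of _ _ "{A<..}"]) auto
  have iA: "integrable \<theta> (\<lambda>t. 2 * cost_sup * indicator {A<..} t :: real)"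
    using sA by (intro integrable_mult_right integrable_real_indicator) (auto simp: less_top[symmetric])
  define K where "K = limval x + 2 * q + 2 * cost_sup * A / T"
  have "(\<Sum>i<r. \<integral>t. cost u x (real i / T + t) \<partial>\<theta>) / real r = (\<integral>t. F t \<partial>\<theta>)"
    unfolding F_def by (simp add: Bochner_Integration.integral_sum[OF int])
  also have "\<dots> \<le> (\<integral>t. K + 2 * cost_sup * indicator {A<..} t \<partial>\<theta>)"
  proof (intro integral_mono intF Bochner_Integration.integrable_add iA)
    fix t assume "t \<in> space \<theta>"
    then have t: "t \<ge> 0" using evaluationsD(3)[OF th] by simp
    show "F t \<le> K + 2 * cost_sup * indicator {A<..} t"
    proof (cases "t \<le> A")
      case True
      have "F t \<le> integral {0..T} (cost u x) / T + q + 2 * cost_sup * t / T"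
        unfolding F_def r_def
      proof (rule riemann_average[OF cost_continuous[OF x u] T cost_bound _ t])
        fix a b :: real assume ab: "0 \<le> a" "a \<le> b" "b \<le> a + 1 / T"
        have "norm (traj u x b - traj u x a) \<le> size_bd * (b - a)" by (rule traj_lipschitz[OF x u ab(1,2)])
        also have "\<dots> \<le> size_bd * (1 / T)" using ab size_bd(1) by (intro mult_left_mono) auto
        also have "\<dots> \<le> 5 * \<delta>" using small by simp
        finally have "\<bar>G (traj u x b) - G (traj u x a)\<bar> \<le> q"
          using ab by (intro osc traj_in_Y x u) auto
        then show "cost u x a \<le> cost u x b + q" using ab by (simp add: cost_def abs_le_iff)
      qed
      also have "2 * cost_sup * t / T \<le> 2 * cost_sup * A / T"
        using True cost_sup(1) Tpos by (intro divide_right_mono mult_left_mono) auto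
      finally show ?thesis using opt True by (simp add: K_def)
    next
      case False
      have "(\<Sum>i<r. cost u x (real i / T + t)) \<le> (\<Sum>i<r. cost_sup)"
        using cost_bound by (intro sum_mono) (simp add: abs_le_iff)
      then have "F t \<le> cost_sup" using r by (simp add: F_def field_simps)
      \<comment> \<open>Beyond \<open>A\<close> only the crude bound is available; it suffices since
        \<open>limval x\<close> is at least \<open>- cost_sup\<close>.\<close>
      also have "cost_sup \<le> K + 2 * cost_sup"
      proof -
        have "2 * cost_sup * A / T \<ge> 0" using cost_sup(1) A Tpos by simp
        then show ?thesis using limval_lower[OF x] q by (simp add: K_def)
      qed
      finally show ?thesis using False by simp
    qed
  qed simp
  also have "\<dots> = K + 2 * cost_sup * prob {A<..}"
    using sA by (subst Bochner_Integration.integral_add[OF _ iA]) (auto simp: prob_space)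
  also have "\<dots> \<le> limval x + 3 * q + 2 * cost_sup * A / T" using tail by (simp add: K_def)
  finally show ?thesis by (simp add: r_def)
qed

text \<open>Of the seven \<open>q\<close>, two come from replacing the target by its code, three
  from averaging over starting times, one from passing from the net point to \<open>y\<close>, and
  one from the remainder that vanishes as T grows.\<close>

lemma random_code_optimal:
  assumes q: "q > 0"
    and osc: "\<And>x z. x \<in> Y \<Longrightarrow> z \<in> Y \<Longrightarrow> norm (x - z) \<le> 5 * \<delta> \<Longrightarrow> \<bar>G x - G z\<bar> \<le> q"
    and lim: "\<And>x z. x \<in> Y \<Longrightarrow> z \<in> Y \<Longrightarrow> norm (x - z) \<le> 5 * \<delta> \<Longrightarrow> limval x \<le> limval z + q"
    and reach: "\<And>j. \<forall>u\<in>controls U. \<forall>s\<ge>0. \<exists>v\<in>controls U. \<exists>r\<in>{0..S}. norm (traj v (net_point j) r - traj u (net_point j) s) \<le> \<delta>"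
  shows "\<exists>M. real_distribution M \<and> (\<forall>\<theta>\<in>evaluations. slow \<theta> (q / (4 * cost_sup)) S \<longrightarrow>
    (\<forall>y\<in>Y. (\<integral>\<omega>. mean_cost \<theta> (follow (real_digit code_bound \<omega>) y) y \<partial>M) \<le> limval y + 7 * q))"
proof -
  obtain T0 where T0: "\<And>T x. T > T0 \<Longrightarrow> T > 0 \<Longrightarrow> x \<in> Y \<Longrightarrow> \<exists>u\<in>controls U. integral {0..T} (cost u x) / T \<le> limval x + q"
    using near_optimal_average[OF q] by blast
  obtain N0 :: nat where N0: "max T0 (size_bd / (5 * \<delta>)) < real N0" using reals_Archimedean2 by blast
  define T where "T N = real (Suc (N + N0))" for N
  have T: "T N > T0" "T N > 0" "size_bd / T N \<le> 5 * \<delta>" "T N \<ge> real N" for N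
  proof -
    have "real N0 \<le> T N" by (simp add: T_def)
    then have *: "max T0 (size_bd / (5 * \<delta>)) < T N" using N0 by linarith
    then show "T N > T0" by simp
    show "T N > 0" by (simp add: T_def)
    have "size_bd / (5 * \<delta>) < T N" using * by simp
    then show "size_bd / T N \<le> 5 * \<delta>" using \<delta>_pos \<open>T N > 0\<close> by (simp add: field_simps)
  qed (simp add: T_def)
  define u where "u N j = (SOME u. u \<in> controls U \<and> integral {0..T N} (cost u (net_point j)) / T N \<le> limval (net_point j) + q)" for N j
  have u: "u N j \<in> controls U" "integral {0..T N} (cost (u N j) (net_point j)) / T N \<le> limval (net_point j) + q" for N j
  proof -
    have "\<exists>u. u \<in> controls U \<and> integral {0..T N} (cost u (net_point j)) / T N \<le> limval (net_point j) + q"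
      using T0[OF T(1,2) net_point] by blast
    from someI_ex[OF this] show "u N j \<in> controls U" "integral {0..T N} (cost (u N j) (net_point j)) / T N \<le> limval (net_point j) + q"
      unfolding u_def[symmetric] by auto
  qed
  define P where "P N i j b \<longleftrightarrow> valid b \<and> (\<exists>s\<in>{0..S}. \<forall>t\<ge>0.
      norm (traj (coded_control b) (net_point j) (s + t) - traj (u N j) (net_point j) (real i / T N + t)) \<le> 3 * \<delta>)" for N i j b
  define b where "b N i j = (SOME b. P N i j b)" for N i j
  have b: "P N i j (b N i j)" for N i j
  proof -
    have "0 \<le> real i / T N" using T(2) by (simp add: less_imp_le)
    then have "\<exists>b. P N i j b"
      unfolding P_def by (rule code_for_shifted_target[OF net_point u(1) _ reach])
    then show ?thesis unfolding b_def by (rule someI_ex)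
  qed
  \<comment> \<open>The codes for all net points are interleaved under one random index
    \<open>i\<close>. This coupling is harmless, as each state reads the digits of its own cell
    only.\<close>
  define c where "c N i m = b N i (fst (prod_decode m)) (snd (prod_decode m))" for N i m
  have digs_c: "net_digits (c N i) j = b N i j" for N i j by (simp add: net_digits_def c_def fun_eq_iff)
  have c_bound: "c N i m \<le> code_bound m" for N i m
  proof -
    have "c N i m < n (snd (prod_decode m))" using b unfolding c_def P_def valid_def by blast
    then show ?thesis by (simp add: code_bound_def)
  qed
  define r where "r N = (Suc (N + N0))\<^sup>2" for N
  have r: "r N > 0" for N by (simp add: r_def)
  from code_compactness[where c = c and r = r and B = code_bound, OF c_bound r] obtain M \<phi> where
    \<phi>: "strict_mono \<phi>" and M: "real_distribution M" and conv: "\<And>\<Phi> C. prefix_continuous code_bound \<Phi> \<Longrightarrow> (\<forall>c. \<bar>\<Phi> c\<bar> \<le> C) \<Longrightarrow>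
      (\<lambda>N. (\<Sum>i<r (\<phi> N). \<Phi> (c (\<phi> N) i)) / real (r (\<phi> N))) \<longlonglongrightarrow> (\<integral>x. \<Phi> (real_digit code_bound x) \<partial>M)"
    by blast
  have "(\<integral>\<omega>. mean_cost \<theta> (follow (real_digit code_bound \<omega>) y) y \<partial>M) \<le> limval y + 7 * q"
    if th: "\<theta> \<in> evaluations" and slow: "slow \<theta> (q / (4 * cost_sup)) S" and y: "y \<in> Y" for \<theta> y
  proof -
    define j where "j = cell y"
    have "q / (2 * cost_sup) > 0" using q cost_sup(1) by simp
    \<comment> \<open>\<open>A\<close> depends on \<theta> but enters only through
      \<open>A / T N\<close>, which tends to 0 along the subsequence. Hence the limit law
      \<open>M\<close>, fixed before \<theta>, serves all \<theta>.\<close>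
    from evaluation_tail[OF th this] obtain A where A: "A > 0" "measure \<theta> {A<..} \<le> q / (2 * cost_sup)" by blast
    have tail: "2 * cost_sup * measure \<theta> {A<..} \<le> q" using A(2) cost_sup(1) by (simp add: field_simps)
    have avg: "(\<Sum>i<r N. mean_cost \<theta> (follow (c N i) y) y) / real (r N) \<le> limval y + 6 * q + 2 * cost_sup * A / T N" for N
    proof -
      have "mean_cost \<theta> (follow (c N i) y) y \<le> (\<integral>t. cost (u N j) (net_point j) (real i / T N + t) \<partial>\<theta>) + 2 * q" for i
      proof -
        obtain s where s: "s \<in> {0..S}" "\<And>t. t \<ge> 0 \<Longrightarrow>
            norm (traj (coded_control (b N i j)) (net_point j) (s + t) - traj (u N j) (net_point j) (real i / T N + t)) \<le> 3 * \<delta>"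
          using b[of N i j] unfolding P_def by blast
        have "0 \<le> real i / T N" using T(2) by (simp add: less_imp_le)
        moreover have "TV s \<theta> \<le> q / (4 * cost_sup)" using slow s(1) by (simp add: slow_def)
        moreover have "valid (b N i j)" using b by (simp add: P_def)
        ultimately show ?thesis
          unfolding j_def using s osc by (intro mean_cost_code_le[OF th y u(1), of s]) (auto simp: digs_c j_def)
      qed
      then have "(\<Sum>i<r N. mean_cost \<theta> (follow (c N i) y) y) \<le> (\<Sum>i<r N. (\<integral>t. cost (u N j) (net_point j) (real i / T N + t) \<partial>\<theta>) + 2 * q)"
        by (rule sum_mono)
      then have "(\<Sum>i<r N. mean_cost \<theta> (follow (c N i) y) y) / real (r N) \<le>
          (\<Sum>i<r N. (\<integral>t. cost (u N j) (net_point j) (real i / T N + t) \<partial>\<theta>) + 2 * q) / real (r N)"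
        by (rule divide_right_mono) simp
      also have "\<dots> = (\<Sum>i<r N. \<integral>t. cost (u N j) (net_point j) (real i / T N + t) \<partial>\<theta>) / real (r N) + 2 * q"
        using r[of N] by (simp add: sum.distrib add_divide_distrib)
      also have "\<dots> \<le> (limval (net_point j) + 3 * q + 2 * cost_sup * A / T N) + 2 * q"
        unfolding r_def using A(1)
        by (intro add_right_mono average_le[OF th net_point u(1) T_def T(3) osc u(2) q _ tail]) auto
      also have "limval (net_point j) \<le> limval y + q"
        using cell[OF y] \<delta>_pos by (intro lim net_point y) (simp add: j_def norm_minus_commute)
      finally show ?thesis by simp
    qed
    obtain N1 :: nat where N1: "2 * cost_sup * A / q < real N1" using reals_Archimedean2 by blast
    show ?thesis
    proof (rule LIMSEQ_le_const2[OF conv])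
      show "prefix_continuous code_bound (\<lambda>w. mean_cost \<theta> (follow w y) y)" by (rule mean_cost_follow_prefix_continuous[OF th y])
      show "\<forall>w. \<bar>mean_cost \<theta> (follow w y) y\<bar> \<le> cost_sup" using mean_cost_abs_le[OF th y follow_in_controls] by blast
      have "(\<Sum>i<r (\<phi> N). mean_cost \<theta> (follow (c (\<phi> N) i) y) y) / real (r (\<phi> N)) \<le> limval y + 7 * q" if N: "N \<ge> N1" for N
      proof -
        have "real N1 \<le> T (\<phi> N)" using T(4)[of "\<phi> N"] seq_suble[OF \<phi>, of N] N by linarith
        then have "2 * cost_sup * A / q < T (\<phi> N)" using N1 by linarith
        then have "2 * cost_sup * A / T (\<phi> N) \<le> q" using q T(2)[of "\<phi> N"] by (simp add: field_simps)
        then show ?thesis using avg[of "\<phi> N"] by linarith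
      qed
      then show "\<exists>N. \<forall>n\<ge>N. (\<Sum>i<r (\<phi> n). mean_cost \<theta> (follow (c (\<phi> n) i) y) y) / real (r (\<phi> n)) \<le> limval y + 7 * q" by blast
    qed
  qed
  then show ?thesis using M by blast
qed

end

context nonexpansive_control
begin

lemma optimal_random_control:
  assumes e: "e > 0" and Yne: "Y \<noteq> {}"
  shows "\<exists>\<eta>>0. \<exists>S>0. \<exists>(M :: real measure) u. random_control U Y M u \<and>
    (\<forall>\<theta>\<in>evaluations. slow \<theta> \<eta> S \<longrightarrow> (\<forall>y\<in>Y. expected_payoff f g \<theta> y M u \<le> limval y + e))"
proof -
  define q where "q = e / 7"
  have q: "q > 0" using e by (simp add: q_def)
  obtain d1 where d1: "d1 > 0" "\<forall>x\<in>Y. \<forall>z\<in>Y. norm (x - z) \<le> d1 \<longrightarrow> \<bar>G x - G z\<bar> \<le> q"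
    using G_uniform[OF q] by blast
  obtain d2 where d2: "d2 > 0" "\<And>x z. x \<in> Y \<Longrightarrow> z \<in> Y \<Longrightarrow> norm (x - z) \<le> d2 \<Longrightarrow> limval x \<le> limval z + q"
    using equicontinuity[OF q] by blast
  define \<delta> where "\<delta> = min d1 d2 / 5"
  have \<delta>: "\<delta> > 0" "5 * \<delta> \<le> d1" "5 * \<delta> \<le> d2" using d1 d2 by (auto simp: \<delta>_def)
  obtain c menu n where tr: "tracking U f g Y c menu n" and c: "(4 + step_error) * (2 * c\<^sup>2) \<le> \<delta>\<^sup>2"
    using ex_tracking[OF \<delta>(1)] by blast
  obtain Z where Z: "finite Z" "Z \<subseteq> Y" "\<forall>x\<in>Y. \<exists>z\<in>Z. norm (x - z) \<le> \<delta>" using finite_net_Y[OF \<delta>(1)] by blast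
  have Zne: "Z \<noteq> {}" using Yne Z(3) by blast
  \<comment> \<open>Enumerates the finite nonempty net over all naturals, with repetitions.\<close>
  define net_point where "net_point = from_nat_into Z"
  have yyZ: "net_point j \<in> Z" for j unfolding net_point_def using Zne by (rule from_nat_into)
  have ran: "range net_point = Z" unfolding net_point_def using Zne Z(1) by (intro range_from_nat_into) (auto intro: countable_finite)
  have rt: "random_tracking U f g Y c menu n net_point \<delta>"
  proof (intro random_tracking.intro tr random_tracking_axioms.intro \<delta>(1) c)
    show "net_point j \<in> Y" for j using yyZ Z(2) by blast
    show "\<exists>j. norm (y - net_point j) \<le> \<delta>" if y: "y \<in> Y" for y
    proof -
      obtain z where "z \<in> Z" "norm (y - z) \<le> \<delta>" using Z(3) y by blast
      then show ?thesis using ran by (metis rangeE)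
    qed
  qed
  have "\<forall>z\<in>Z. \<exists>S>0. \<forall>u\<in>controls U. \<forall>s\<ge>0. \<exists>v\<in>controls U. \<exists>r\<in>{0..S}. norm (traj v z r - traj u z s) \<le> \<delta>"
    using reach_in_bounded_time[OF _ \<delta>(1)] Z(2) by blast
  from bchoice[OF this] obtain S0 where S0: "\<forall>z\<in>Z. S0 z > 0 \<and> (\<forall>u\<in>controls U. \<forall>s\<ge>0. \<exists>v\<in>controls U. \<exists>r\<in>{0..S0 z}.
      norm (traj v z r - traj u z s) \<le> \<delta>)" ..
  \<comment> \<open>A common time bound for the finitely many net points: the summands are positive,
    so the sum dominates each of them.\<close>
  define S where "S = (\<Sum>z\<in>Z. S0 z)"
  have S0_le: "S0 z \<le> S" if "z \<in> Z" for z
    unfolding S_def using that Z(1) S0 by (intro member_le_sum) (auto intro: less_imp_le)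
  have S: "S > 0" using S0_le[OF yyZ] S0 yyZ by (meson less_le_trans)
  interpret random_tracking U f g Y c menu n net_point \<delta> by (rule rt)
  have "\<exists>M. real_distribution M \<and> (\<forall>\<theta>\<in>evaluations. slow \<theta> (q / (4 * cost_sup)) S \<longrightarrow>
    (\<forall>y\<in>Y. (\<integral>\<omega>. mean_cost \<theta> (follow (real_digit code_bound \<omega>) y) y \<partial>M) \<le> limval y + 7 * q))"
  proof (rule random_code_optimal[OF q])
    show "\<bar>G x - G z\<bar> \<le> q" if "x \<in> Y" "z \<in> Y" "norm (x - z) \<le> 5 * \<delta>" for x z
    proof -
      have "norm (x - z) \<le> d1" using that(3) \<delta>(2) by linarith
      then show ?thesis using d1(2) that(1,2) by blast
    qed
    show "limval x \<le> limval z + q" if "x \<in> Y" "z \<in> Y" "norm (x - z) \<le> 5 * \<delta>" for x z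
      using that \<delta>(3) by (intro d2(2)) linarith+
    show "\<forall>u\<in>controls U. \<forall>s\<ge>0. \<exists>v\<in>controls U. \<exists>r\<in>{0..S}. norm (traj v (net_point j) r - traj u (net_point j) s) \<le> \<delta>" for j
    proof (intro ballI allI impI)
      fix u s assume "u \<in> controls U" "s \<ge> (0::real)"
      then obtain v r where v: "v \<in> controls U" "r \<in> {0..S0 (net_point j)}" "norm (traj v (net_point j) r - traj u (net_point j) s) \<le> \<delta>"
        using S0 yyZ by blast
      have "r \<in> {0..S}" using v(2) S0_le[OF yyZ, of j] by simp
      with v(1,3) show "\<exists>v\<in>controls U. \<exists>r\<in>{0..S}. norm (traj v (net_point j) r - traj u (net_point j) s) \<le> \<delta>" by blast
    qed
  qed
  then obtain M where M: "real_distribution M" and opt: "\<And>\<theta> y. \<theta> \<in> evaluations \<Longrightarrow> slow \<theta> (q / (4 * cost_sup)) S \<Longrightarrow> y \<in> Y \<Longrightarrow>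
    (\<integral>\<omega>. mean_cost \<theta> (follow (real_digit code_bound \<omega>) y) y \<partial>M) \<le> limval y + 7 * q" by blast
  interpret M: real_distribution M by (rule M)
  let ?u = "\<lambda>y \<omega>. follow (real_digit code_bound \<omega>) y"
  have "random_control U Y M ?u" by (rule random_control_follow) (rule M.prob_space_axioms, rule M.events_eq_borel)
  moreover have "expected_payoff f g \<theta> y M ?u \<le> limval y + e"
    if "\<theta> \<in> evaluations" "slow \<theta> (q / (4 * cost_sup)) S" "y \<in> Y" for \<theta> y
    unfolding expected_payoff_def payoff_eq_mean_cost[OF that(1) follow_in_controls] using opt[OF that] by (simp add: q_def)
  moreover have "q / (4 * cost_sup) > 0" using q cost_sup(1) by simp
  ultimately show ?thesis using S by blast
qed

text \<open>Serves the case of empty \<open>Y\<close>, in which there is no net point to start from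
  but a random control must still be exhibited.\<close>

lemma trivial_random_control: "\<exists>(M :: real measure) u. random_control U Y M u"
proof -
  obtain b where b: "b \<in> U" using problem unfolding control_problem_def by blast
  have "random_control U Y (return borel (0::real)) (\<lambda>_ _ _. b)"
    unfolding random_control_def
    using b by (intro conjI standard_borel_real prob_space_return) (auto simp: space_restrict_space)
  then show ?thesis by blast
qed

theorem general_uniform_value_limval: "general_uniform_value U f g Y limval"
  unfolding general_uniform_value_def general_limit_value_def
proof (intro conjI allI impI)
  fix e :: real assume e: "e > 0"
  obtain \<eta> S where ES: "\<eta> > 0" "S > 0"
    "\<forall>\<theta>\<in>evaluations. slow \<theta> \<eta> S \<longrightarrow> (\<forall>x\<in>Y. \<bar>val \<theta> x - limval x\<bar> \<le> e)" using limit_value[OF e] by blast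
  have "\<forall>\<theta>\<in>evaluations. (SUP s\<in>{0..S}. TV s \<theta>) \<le> \<eta> \<longrightarrow> (\<forall>y0\<in>Y. \<bar>value_fun U f g \<theta> y0 - limval y0\<bar> \<le> e)"
    using ES(3) slow_of_SUP value_fun_eq by simp
  then show "\<exists>\<eta>>0. \<exists>S>0. \<forall>\<theta>\<in>evaluations. (SUP s\<in>{0..S}. TV s \<theta>) \<le> \<eta> \<longrightarrow>
      (\<forall>y0\<in>Y. \<bar>value_fun U f g \<theta> y0 - limval y0\<bar> \<le> e)" using ES(1,2) by blast
next
  fix e :: real assume e: "e > 0"
  show "\<exists>\<eta>>0. \<exists>S>0. \<exists>(M :: real measure) u. random_control U Y M u \<and>
      (\<forall>\<theta>\<in>evaluations. (SUP s\<in>{0..S}. TV s \<theta>) \<le> \<eta> \<longrightarrow> (\<forall>y0\<in>Y. expected_payoff f g \<theta> y0 M u \<le> limval y0 + e))"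
  proof (cases "Y = {}")
    case True
    obtain M :: "real measure" and u where "random_control U Y M u" using trivial_random_control by blast
    moreover have "(0::real) < 1" by simp
    ultimately show ?thesis using True by blast
  next
    case False
    obtain \<eta> S and M :: "real measure" and u where 1: "\<eta> > 0" "S > 0" "random_control U Y M u"
      "\<forall>\<theta>\<in>evaluations. slow \<theta> \<eta> S \<longrightarrow> (\<forall>y\<in>Y. expected_payoff f g \<theta> y M u \<le> limval y + e)"
      using optimal_random_control[OF e False] by blast
    have "\<forall>\<theta>\<in>evaluations. (SUP s\<in>{0..S}. TV s \<theta>) \<le> \<eta> \<longrightarrow> (\<forall>y0\<in>Y. expected_payoff f g \<theta> y0 M u \<le> limval y0 + e)"
      using 1(4) slow_of_SUP by simp
    then show ?thesis using 1(1-3) by blast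
  qed
qed

end

theorem theorem3p1:
  fixes U :: "'u::{metric_space,second_countable_topology} set"
    and f :: "real^'n \<Rightarrow> 'u \<Rightarrow> real^'n"
    and g :: "real^'n \<Rightarrow> 'u \<Rightarrow> real"
    and Y :: "(real^'n) set"
  assumes "control_problem U f g"
    and "compact_nonexpansive U f g Y"
  shows "general_uniform_value U f g Y
    (\<lambda>y0. SUP \<theta>\<in>evaluations. INF s\<in>{0..}. INF u\<in>controls U.
       (\<integral>t. state_cost U g (trajectory f u y0 (t + s)) \<partial>\<theta>))"
proof -
  interpret nonexpansive_control U f g Y
    by unfold_locales (fact assms)+
  show ?thesis using general_uniform_value_limval unfolding limval_eq[abs_def] .
qed

end
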